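(* Let $\lambda_1<\dots<\lambda_k$ be real, $I=(i_1,\dots,i_k)$ positive integers with sum $n$, and $\Lambda$ the diagonal matrix with $\lambda_j$ appearing $i_j$ times, in increasing order. Let $G={\rm SO}(n,\mathbb R)\cap({\rm O}(i_1)\times\dots\times{\rm O}(i_k))$ and let $\xi_I$ be the vector field on ${\rm Fl}_I(\mathbb R)={\rm SO}(n,\mathbb R)/G$ induced by the right-$G$-invariant vector field $M(\Psi)=\big((\Psi\Lambda\Psi^{-1})_+-(\Psi\Lambda\Psi^{-1})_-\big)\Psi$ on ${\rm SO}(n,\mathbb R)$. For $\tau\in S_n^I$ let $p_\tau\in{\rm Fl}_I(\mathbb R)$ be the singular point of $\xi_I$ given by the coset $[\Psi]$ with $\Psi\Lambda\Psi^{-1}=\operatorname{diag}(\lambda_{\tau(1)},\dots,\lambda_{\tau(n)})$. Let $\psi\neq\omega$ in $S_n^I$. Then $p_\psi$ and $p_\omega$ are connected by a trajectory of $\xi_I$ (i.e. there is an integral curve tending to one of them as $t\to-\infty$ and to the other as $t\to+\infty$) if and only if $\psi$ and $\omega$ are comparable in the Bruhat order on $S_n^I$. Moreover, when $\psi\preceq\omega$, the dimension of the subset of ${\rm Fl}_I(\mathbb R)$ swept out by the trajectories connecting $p_\psi$ and $p_\omega$ equals the length of the path from $\psi$ to $\omega$ in the Hasse diagram of the Bruhat order on $S_n^I$.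
   Context: For a square matrix $X$, $X_+$ (resp. $X_-$) is its strictly upper (resp. strictly lower) triangular part. $S_n^I$ is the set of surjective maps $\tau\colon\{1,\dots,n\}\to\{1,\dots,k\}$ with $|\tau^{-1}(j)|=i_j$ for all $j$. Put $r_\tau[p,q]=\#\{j\le p:\ \tau(j)\ge q\}$; the Bruhat order on $S_n^I$ is $\tau\preceq\upsilon$ iff $r_\tau[p,q]\le r_\upsilon[p,q]$ for all $1\le p\le n$, $1\le q\le k$. The Hasse diagram is the graph with an edge $a\to b$ whenever $a\prec b$ and there is no $c$ with $a\prec c\prec b$; the length of a path is its number of edges. *)

theory Defs
  imports "HOL-Analysis.Analysis"
begin

text \<open>Matrices are indexed by a finite linearly ordered type 'n (playing the role of
 the positions 1..n in their natural order); 'n has CARD('n) = n elements.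
 The multi-index I is a function nat => nat read on 1..k, lambda likewise.\<close>

definition SOn :: "(((real, 'n::{finite,linorder}) vec, 'n) vec) set" where
  "SOn = {A. orthogonal_matrix A \<and> det A = 1}"

definition upper_part :: "((real, 'n::{finite,linorder}) vec, 'n) vec \<Rightarrow> ((real, 'n) vec, 'n) vec" where
  "upper_part X = (\<chi> p q. if p < q then X $ p $ q else 0)"

definition lower_part :: "((real, 'n::{finite,linorder}) vec, 'n) vec \<Rightarrow> ((real, 'n) vec, 'n) vec" where
  "lower_part X = (\<chi> p q. if q < p then X $ p $ q else 0)"

definition pos :: "'n::{finite,linorder} \<Rightarrow> nat" where
  "pos p = card {q. q \<le> p}"

definition std_block :: "(nat \<Rightarrow> nat) \<Rightarrow> 'n::{finite,linorder} \<Rightarrow> nat" where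
  "std_block I p = (LEAST j. pos p \<le> (\<Sum>l=1..j. I l))"

definition diag_mat :: "('n::finite \<Rightarrow> real) \<Rightarrow> ((real, 'n) vec, 'n) vec" where
  "diag_mat d = (\<chi> p q. if p = q then d p else 0)"

definition Lambda_mat :: "(nat \<Rightarrow> real) \<Rightarrow> (nat \<Rightarrow> nat) \<Rightarrow> ((real, 'n::{finite,linorder}) vec, 'n) vec" where
  "Lambda_mat lam I = diag_mat (\<lambda>p. lam (std_block I p))"

definition Gsub :: "(nat \<Rightarrow> nat) \<Rightarrow> (((real, 'n::{finite,linorder}) vec, 'n) vec) set" where
  "Gsub I = {g \<in> SOn. \<forall>p q. std_block I p \<noteq> std_block I q \<longrightarrow> g $ p $ q = 0}"

definition coset :: "(nat \<Rightarrow> nat) \<Rightarrow> ((real, 'n::{finite,linorder}) vec, 'n) vec \<Rightarrow> (((real, 'n) vec, 'n) vec) set" where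
  "coset I Psi = {Psi ** g | g. g \<in> Gsub I}"

definition FlI :: "(nat \<Rightarrow> nat) \<Rightarrow> (((real, 'n::{finite,linorder}) vec, 'n) vec) set set" where
  "FlI I = coset I ` SOn"

definition FlI_top :: "(nat \<Rightarrow> nat) \<Rightarrow> (((real, 'n::{finite,linorder}) vec, 'n) vec) set topology" where
  "FlI_top I = topology (\<lambda>U. U \<subseteq> FlI I \<and>
      openin (top_of_set SOn) {Psi \<in> SOn. coset I Psi \<in> U})"

definition Mfield :: "(nat \<Rightarrow> real) \<Rightarrow> (nat \<Rightarrow> nat) \<Rightarrow> ((real, 'n::{finite,linorder}) vec, 'n) vec \<Rightarrow> ((real, 'n) vec, 'n) vec" where
  "Mfield lam I Psi =
     (let L = Psi ** Lambda_mat lam I ** matrix_inv Psi in (upper_part L - lower_part L) ** Psi)"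

text \<open>Integral curves of the induced field xi_I on Fl_I: projections of integral
 curves of M in SO(n).\<close>
definition xi_integral_curve ::
  "(nat \<Rightarrow> real) \<Rightarrow> (nat \<Rightarrow> nat) \<Rightarrow> (real \<Rightarrow> (((real, 'n::{finite,linorder}) vec, 'n) vec) set) \<Rightarrow> bool" where
  "xi_integral_curve lam I gamma \<longleftrightarrow>
     (\<exists>Psi. (\<forall>t. Psi t \<in> SOn \<and> (Psi has_vector_derivative Mfield lam I (Psi t)) (at t))
          \<and> (\<forall>t. gamma t = coset I (Psi t)))"

definition sing_pt :: "(nat \<Rightarrow> real) \<Rightarrow> (nat \<Rightarrow> nat) \<Rightarrow> ('n \<Rightarrow> nat) \<Rightarrow> (((real, 'n::{finite,linorder}) vec, 'n) vec) set" where
  "sing_pt lam I tau = (THE c. \<exists>Psi \<in> SOn.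
      Psi ** Lambda_mat lam I ** matrix_inv Psi = diag_mat (\<lambda>p. lam (tau p)) \<and> c = coset I Psi)"

definition connects :: "(nat \<Rightarrow> real) \<Rightarrow> (nat \<Rightarrow> nat) \<Rightarrow> (real \<Rightarrow> (((real, 'n::{finite,linorder}) vec, 'n) vec) set)
     \<Rightarrow> ('n \<Rightarrow> nat) \<Rightarrow> ('n \<Rightarrow> nat) \<Rightarrow> bool" where
  "connects lam I gamma a b \<longleftrightarrow> xi_integral_curve lam I gamma \<and>
     ((limitin (FlI_top I) gamma (sing_pt lam I a) at_bot \<and> limitin (FlI_top I) gamma (sing_pt lam I b) at_top)
    \<or> (limitin (FlI_top I) gamma (sing_pt lam I b) at_bot \<and> limitin (FlI_top I) gamma (sing_pt lam I a) at_top))"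

definition swept :: "(nat \<Rightarrow> real) \<Rightarrow> (nat \<Rightarrow> nat) \<Rightarrow> ('n \<Rightarrow> nat) \<Rightarrow> ('n \<Rightarrow> nat)
     \<Rightarrow> (((real, 'n::{finite,linorder}) vec, 'n) vec) set set" where
  "swept lam I a b = \<Union> {range gamma | gamma. connects lam I gamma a b}"

definition manifold_dim :: "'a topology \<Rightarrow> nat \<Rightarrow> bool" where
  "manifold_dim X d \<longleftrightarrow> (\<forall>x \<in> topspace X. \<exists>U V. openin X U \<and> x \<in> U \<and>
      openin (Euclidean_space d) V \<and> subtopology X U homeomorphic_space subtopology (Euclidean_space d) V)"

definition SnI :: "nat \<Rightarrow> (nat \<Rightarrow> nat) \<Rightarrow> ('n::{finite,linorder} \<Rightarrow> nat) set" where
  "SnI k I = {tau. range tau = {1..k} \<and> (\<forall>j \<in> {1..k}. card (tau -` {j}) = I j)}"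

definition rk :: "('n::{finite,linorder} \<Rightarrow> nat) \<Rightarrow> 'n \<Rightarrow> nat \<Rightarrow> nat" where
  "rk tau p q = card {j. j \<le> p \<and> tau j \<ge> q}"

definition bruhat_le :: "nat \<Rightarrow> ('n::{finite,linorder} \<Rightarrow> nat) \<Rightarrow> ('n \<Rightarrow> nat) \<Rightarrow> bool" where
  "bruhat_le k tau ups \<longleftrightarrow> (\<forall>p. \<forall>q \<in> {1..k}. rk tau p q \<le> rk ups p q)"

definition bruhat_less :: "nat \<Rightarrow> ('n::{finite,linorder} \<Rightarrow> nat) \<Rightarrow> ('n \<Rightarrow> nat) \<Rightarrow> bool" where
  "bruhat_less k tau ups \<longleftrightarrow> bruhat_le k tau ups \<and> tau \<noteq> ups"

definition hasse_edge :: "nat \<Rightarrow> (nat \<Rightarrow> nat) \<Rightarrow> ('n::{finite,linorder} \<Rightarrow> nat) \<Rightarrow> ('n \<Rightarrow> nat) \<Rightarrow> bool" where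
  "hasse_edge k I a b \<longleftrightarrow> a \<in> SnI k I \<and> b \<in> SnI k I \<and> bruhat_less k a b \<and>
     \<not> (\<exists>c \<in> SnI k I. bruhat_less k a c \<and> bruhat_less k c b)"

text \<open>A path in the Hasse diagram, given by its list of vertices; its length is the
 number of edges, length xs - 1.\<close>
definition hasse_path :: "nat \<Rightarrow> (nat \<Rightarrow> nat) \<Rightarrow> ('n::{finite,linorder} \<Rightarrow> nat) list \<Rightarrow> bool" where
  "hasse_path k I xs \<longleftrightarrow> xs \<noteq> [] \<and> set xs \<subseteq> SnI k I \<and>
     (\<forall>i. Suc i < length xs \<longrightarrow> hasse_edge k I (xs ! i) (xs ! Suc i))"

end

theory Submission
  imports Defs
begin

text \<open>Write \<open>L = Psi \<Lambda> Psi\<^sup>T\<close> and let \<open>P\<close> be the block upper triangular group. The solution through \<open>Psi\<close> is the orthogonal factor of \<open>Psi exp(t \<Lambda>)\<close> in its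
  LQ factorisation. If \<open>Psi = l s h\<close> with \<open>l\<close> unipotent lower triangular, \<open>s\<close> a permutation matrix
  and \<open>h\<close> in \<open>P\<close>, then \<open>exp(-t \<Lambda>) h exp(t \<Lambda>)\<close> tends to the block diagonal part of \<open>h\<close> as
  \<open>t\<close> tends to \<open>-\<infinity>\<close>, and \<open>L\<close> tends to the diagonal matrix given by \<open>s\<close>; the transpose of \<open>P\<close>
  governs \<open>t\<close> to \<open>+\<infinity>\<close> in the same way. Hence the points on trajectories
  from \<open>psi\<close> to \<open>omega\<close> form the intersection of a Schubert cell with an opposite one. Comparing
  dimensions of row spaces shows that it is empty unless \<open>psi \<preceq> omega\<close>; conversely
  \<open>p_psi\<close> lies in the closure of the other cell, so that cell meets the big cell around \<open>p_psi\<close>, and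
  a translation by an upper unipotent matrix moves a common point into the first cell. The
  intersection is transversal, hence a manifold of dimension \<open>inv(omega) - inv(psi)\<close>,
  and each edge of the Hasse diagram raises the number of inversions by one.\<close>

text \<open>Cosets are awkward to compute with, so the quotient topology and the sets
  \<open>swept\<close> are transported to the symmetric matrices \<open>Lax mu Psi\<close>: these
  determine the coset, and compactness of SO(n) makes the transport a homeomorphism. The two ends of
  a trajectory at first differ in their right factors, block upper against block lower. For
  orthogonal \<open>Psi\<close> the inverse transpose trades this for opposite left factors, and
  both cells become orbits in one quotient by P. Closures and tangent spaces are then treated on
  arbitrary invertible matrices; orthogonality is restored by orthonormalising columns, which
  multiplies on the right by an element of P. The dimension claim needs a chart with continuous
  inverse: a common point is recorded by its normal forms in the two cells and by the element of P
  joining them, which gives the zero set of a polynomial map on a linear space. Continuity of the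
  inverse comes from spectral projections of the Lax matrix. Since \<open>swept\<close> admits both
  directions of time, antisymmetry of the order has to discard one.\<close>

lemma matrix_inv_right: "invertible (A::real^'n^'n) \<Longrightarrow> A ** matrix_inv A = mat 1"
  and matrix_inv_left: "invertible (A::real^'n^'n) \<Longrightarrow> matrix_inv A ** A = mat 1"
  unfolding invertible_def matrix_inv_def by (metis (mono_tags, lifting) someI_ex)+

lemma invertible_matrix_inv: "invertible (A::real^'n^'n) \<Longrightarrow> invertible (matrix_inv A)"
  using matrix_inv_left matrix_inv_right invertible_def by blast

lemma matrix_inv_eqI: "(A::real^'n^'n) ** B = mat 1 \<Longrightarrow> matrix_inv A = B"
  by (metis invertible_right_inverse matrix_inv_left matrix_mul_assoc matrix_mul_lid matrix_mul_rid)

lemma matrix_inv_orthogonal: "orthogonal_matrix (A::real^'n^'n) \<Longrightarrow> matrix_inv A = transpose A"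
  by (simp add: matrix_inv_eqI orthogonal_matrix_def)

lemma orthogonal_invertible: "orthogonal_matrix (A::real^'n^'n) \<Longrightarrow> invertible A"
  unfolding orthogonal_matrix_def invertible_def by blast

lemma matrix_mult_nth: "(A ** B) $ i $ j = (\<Sum>k\<in>UNIV. A $ i $ k * B $ k $ j)"
  by (simp add: matrix_matrix_mult_def)

lemma invertible_mult_left: "invertible (A::real^'n^'n) \<Longrightarrow> invertible (A ** B) \<longleftrightarrow> invertible B"
  by (metis invertible_mult invertible_matrix_inv matrix_inv_left matrix_mul_assoc matrix_mul_lid)

lemma invertible_inj: "invertible (A::real^'n^'n) \<longleftrightarrow> (\<forall>x. A *v x = 0 \<longrightarrow> x = 0)"
  using invertible_left_inverse matrix_left_invertible_ker by blast

section \<open>Matrices triangular with respect to a grading\<close>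

text \<open>The grading is real-valued so that positions give the triangular groups, eigenvalues the
  block triangular group, and negated gradings the opposite groups.\<close>
definition btri :: "('n::finite \<Rightarrow> real) \<Rightarrow> real^'n^'n \<Rightarrow> bool" where
  "btri f M \<longleftrightarrow> (\<forall>p q. M $ p $ q \<noteq> 0 \<longrightarrow> f p \<le> f q)"

lemma btriD: "btri f M \<Longrightarrow> f q < f p \<Longrightarrow> M $ p $ q = 0"
  by (meson btri_def leD)

lemma btri_mult: assumes "btri f A" "btri f B" shows "btri f (A ** B)"
  unfolding btri_def
proof (intro allI impI)
  fix p q assume "(A ** B) $ p $ q \<noteq> 0"
  then obtain k where "A $ p $ k * B $ k $ q \<noteq> 0"
    unfolding matrix_mult_nth by (meson sum.not_neutral_contains_not_neutral)
  then have "f p \<le> f k" "f k \<le> f q" using assms by (auto simp: btri_def)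
  then show "f p \<le> f q" by simp
qed

lemma btri_mat1 [simp]: "btri f (mat 1)"
  by (simp add: btri_def mat_def)

lemma btri_add: assumes "btri f A" "btri f B" shows "btri f (A + B)"
proof -
  have "f p \<le> f q" if "A $ p $ q + B $ p $ q \<noteq> 0" for p q
    using assms that by (cases "A $ p $ q = 0") (auto simp: btri_def)
  then show ?thesis by (simp add: btri_def)
qed

lemma btri_diff: assumes "btri f A" "btri f B" shows "btri f (A - B)"
proof -
  have "f p \<le> f q" if "A $ p $ q - B $ p $ q \<noteq> 0" for p q
    using assms that by (cases "A $ p $ q = 0") (auto simp: btri_def)
  then show ?thesis by (simp add: btri_def)
qed

lemma btri_transpose: "btri f (transpose A) \<longleftrightarrow> btri (\<lambda>p. - f p) A"
  unfolding btri_def transpose_def by auto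

lemma btri_diag_mat [simp]: "btri f (diag_mat d)"
  by (simp add: btri_def diag_mat_def)

text \<open>The coordinate subspace \<open>V\<close> of grades at most \<open>f q\<close> is mapped
  into itself by \<open>M\<close>, hence onto itself by injectivity and dimension. So the inverse
  preserves it too, and column \<open>q\<close> of the inverse lies in \<open>V\<close>.\<close>

lemma btri_matrix_inv:
  assumes M: "btri f M" and inv: "invertible M"
  shows "btri f (matrix_inv M)"
  unfolding btri_def
proof (intro allI impI, rule ccontr)
  fix p q assume nz: "matrix_inv M $ p $ q \<noteq> 0" and less: "\<not> f p \<le> f q"
  define V where "V = {x::real^'a. \<forall>i. f q < f i \<longrightarrow> x $ i = 0}"
  have subV: "subspace V" by (auto simp: V_def subspace_def)
  have img: "(*v) M ` V \<subseteq> V"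
  proof
    fix y assume "y \<in> (*v) M ` V"
    then obtain x where x: "x \<in> V" "y = M *v x" by auto
    have "(M *v x) $ i = 0" if "f q < f i" for i
      unfolding matrix_vector_mult_def vec_lambda_beta
    proof (rule sum.neutral, intro ballI)
      fix j show "M $ i $ j * x $ j = 0"
        using x(1) that M by (cases "f q < f j") (auto simp: V_def intro: btriD)
    qed
    then show "y \<in> V" by (auto simp: V_def x)
  qed
  have inj: "inj ((*v) M)" by (simp add: inj_matrix_vector_mult inv)
  have "dim ((*v) M ` V) = dim V"
    by (rule dim_image_eq) (auto intro: inj_on_subset[OF inj])
  then have "(*v) M ` V = V"
    using img subV by (intro subspace_dim_equal) (auto intro: linear_subspace_image)
  moreover have "axis q 1 \<in> V" by (auto simp: V_def axis_def)
  ultimately obtain x where x: "x \<in> V" "M *v x = axis q 1" by (metis imageE)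
  then have "x = matrix_inv M *v axis q 1"
    by (metis inv matrix_inv_left matrix_vector_mul_assoc matrix_vector_mul_lid)
  then have "x $ p = matrix_inv M $ p $ q"
    by (simp add: matrix_vector_mult_basis column_def)
  with nz x(1) less show False by (auto simp: V_def)
qed

lemma btri_diag_mult:
  assumes "inj g" "btri g A" "btri g B"
  shows "(A ** B) $ p $ p = A $ p $ p * B $ p $ p"
proof -
  have "A $ p $ k * B $ k $ p = 0" if "k \<noteq> p" for k
  proof -
    have "g k \<noteq> g p" using assms(1) that by (auto dest: injD)
    then show ?thesis using assms(2,3) by (cases "g k < g p") (auto simp: btriD)
  qed
  then have "(\<Sum>k\<in>UNIV. A $ p $ k * B $ k $ p) = (\<Sum>k\<in>{p}. A $ p $ k * B $ k $ p)"
    by (intro sum.mono_neutral_right) auto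
  then show ?thesis by (simp add: matrix_mult_nth)
qed

lemma btri_diag_nonzero:
  assumes "inj g" "btri g A" "invertible A"
  shows "A $ p $ p \<noteq> 0"
proof -
  have "(A ** matrix_inv A) $ p $ p = A $ p $ p * matrix_inv A $ p $ p"
    using assms btri_diag_mult btri_matrix_inv by blast
  then show ?thesis using assms(3) by (auto simp: matrix_inv_right mat_def)
qed

lemma btri_invertible:
  assumes "inj g" "btri g A" "\<And>p. A $ p $ p \<noteq> 0"
  shows "invertible A"
  unfolding invertible_inj
proof (intro allI impI, rule ccontr)
  fix x assume x: "A *v x = 0" "x \<noteq> 0"
  \<comment> \<open>At the \<open>g\<close>-largest index of the support of \<open>x\<close> only
    the diagonal term of \<open>A *v x\<close> survives.\<close>
  define S where "S = {p. x $ p \<noteq> 0}"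
  have "S \<noteq> {}" using x(2) by (auto simp: S_def vec_eq_iff)
  have "Max (g ` S) \<in> g ` S" using \<open>S \<noteq> {}\<close> by (intro Max_in) auto
  then obtain p where p: "p \<in> S" "Max (g ` S) = g p" by auto
  have pmax: "g q \<le> g p" if "q \<in> S" for q using that p(2)[symmetric] by simp
  have "A $ p $ k * x $ k = 0" if "k \<noteq> p" for k
  proof (cases "k \<in> S")
    case True
    have "g k \<noteq> g p" using assms(1) that by (auto dest: injD)
    with pmax[OF True] have "g k < g p" by simp
    then show ?thesis using assms(2) by (simp add: btriD)
  qed (simp add: S_def)
  then have "(\<Sum>k\<in>UNIV. A $ p $ k * x $ k) = (\<Sum>k\<in>{p}. A $ p $ k * x $ k)"
    by (intro sum.mono_neutral_right) auto
  then have "A $ p $ p * x $ p = (A *v x) $ p" by (simp add: matrix_vector_mult_def)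
  with x(1) p(1) assms(3) show False by (simp add: S_def)
qed

text \<open>This is both the factorisation of a triangular matrix through a parabolic subgroup
  (\<open>X = mat 1\<close>) and, infinitesimally, the transversality behind the dimension count.
  Column \<open>j\<close> of \<open>K\<close> solves a triangular system on the rows with \<open>f p \<le> f j\<close>.\<close>
lemma triangular_split:
  assumes g: "inj g" and l: "btri g l" "invertible l" and X: "btri g X"
  obtains Y K where "X = Y + l ** K" "btri f K" "btri g K"
    "\<And>p q. Y $ p $ q \<noteq> 0 \<Longrightarrow> f q < f p \<and> g p < g q"
proof -
  \<comment> \<open>Outside the rows and columns with \<open>f p <= f j\<close> this is the identity
    matrix. So \<open>T j\<close> stays \<open>g\<close>-triangular with nonzero diagonal for every
    \<open>j\<close>, and the solution vanishes on the outer rows.\<close>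
  define T where "T j = (\<chi> p q. if f p \<le> f j \<and> f q \<le> f j then l $ p $ q else if p = q then 1 else 0)" for j
  define r where "r j = (\<chi> p. if f p \<le> f j then X $ p $ j else 0)" for j
  define K where "K = (\<chi> p j. (matrix_inv (T j) *v r j) $ p)"
  have Tg: "btri g (T j)" for j using l(1) by (auto simp: T_def btri_def)
  have Tinv: "invertible (T j)" for j
    by (rule btri_invertible[OF g Tg]) (use btri_diag_nonzero[OF g l] in \<open>auto simp: T_def\<close>)
  have TK: "(\<Sum>q\<in>UNIV. T j $ p $ q * K $ q $ j) = r j $ p" for j p
  proof -
    have "T j *v (matrix_inv (T j) *v r j) = r j"
      by (simp add: matrix_vector_mul_assoc matrix_inv_right Tinv)
    then show ?thesis
      by (simp add: K_def matrix_vector_mult_def[of "T j"] vec_eq_iff)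
  qed
  have K0: "K $ p $ j = 0" if "f j < f p" for p j
  proof -
    have "(\<Sum>q\<in>UNIV. T j $ p $ q * K $ q $ j) = (\<Sum>q\<in>UNIV. if q = p then K $ q $ j else 0)"
      using that by (intro sum.cong) (auto simp: T_def)
    then show ?thesis using TK[of j p] that by (simp add: r_def)
  qed
  have lK: "(l ** K) $ p $ j = X $ p $ j" if "f p \<le> f j" for p j
  proof -
    have "(\<Sum>q\<in>UNIV. T j $ p $ q * K $ q $ j) = (\<Sum>q\<in>UNIV. l $ p $ q * K $ q $ j)"
      using that K0 by (intro sum.cong) (auto simp: T_def not_le)
    then show ?thesis using TK[of j p] that by (simp add: r_def matrix_mult_nth)
  qed
  have Kf: "btri f K" using K0 by (meson btri_def not_le)
  have Kg: "btri g K"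
    unfolding btri_def
  proof (intro allI impI)
    fix p j assume "K $ p $ j \<noteq> 0"
    then have "(\<Sum>q\<in>UNIV. matrix_inv (T j) $ p $ q * r j $ q) \<noteq> 0"
      by (simp add: K_def matrix_vector_mult_def)
    then obtain q where q: "matrix_inv (T j) $ p $ q * r j $ q \<noteq> 0"
      by (meson sum.not_neutral_contains_not_neutral)
    then have "g p \<le> g q" using btri_matrix_inv[OF Tg Tinv] by (auto simp: btri_def)
    moreover have "g q \<le> g j" using q X by (auto simp: r_def btri_def split: if_splits)
    ultimately show "g p \<le> g j" by simp
  qed
  show ?thesis
  proof
    show "X = (X - l ** K) + l ** K" by simp
    fix p q assume nz: "(X - l ** K) $ p $ q \<noteq> 0"
    have f: "f q < f p" using lK[of p q] nz by force
    have "g p \<le> g q" using btri_diff[OF X btri_mult[OF l(1) Kg]] nz by (auto simp: btri_def)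
    moreover have "g p \<noteq> g q" using f g by (auto dest: injD)
    ultimately show "f q < f p \<and> g p < g q" using f by simp
  qed (use Kf Kg in auto)
qed

section \<open>Permutation and diagonal matrices\<close>

text \<open>The unit of row \<open>i\<close> sits in column \<open>s i\<close>. With this
  orientation \<open>diag_mat d\<close> passes through \<open>Pm s\<close> as
  \<open>diag_mat (\<lambda>p. d (s p))\<close>, which matches the diagonal that defines a singular
  point.\<close>

definition Pm :: "('n \<Rightarrow> 'n) \<Rightarrow> real^'n^'n::finite" where
  "Pm s = (\<chi> i j. if j = s i then 1 else 0)"

lemma Pm_mult_nth: "(Pm s ** h) $ i $ j = h $ (s i) $ j"
proof -
  have "(\<Sum>k\<in>UNIV. (if k = s i then 1 else 0) * h $ k $ j) = (\<Sum>k\<in>UNIV. if k = s i then h $ k $ j else 0)"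
    by (intro sum.cong) auto
  then show ?thesis by (simp add: matrix_mult_nth Pm_def)
qed

lemma mult_Pm_nth:
  assumes "bij s" shows "(h ** Pm s) $ i $ j = h $ i $ (inv s j)"
proof -
  have eq: "j = s k \<longleftrightarrow> k = inv s j" for k using assms by (metis bij_inv_eq_iff)
  have "(\<Sum>k\<in>UNIV. h $ i $ k * (if j = s k then 1 else 0)) = (\<Sum>k\<in>UNIV. if k = inv s j then h $ i $ k else 0)"
    by (intro sum.cong) (auto simp: eq)
  then show ?thesis by (simp add: matrix_mult_nth Pm_def)
qed

lemma Pm_inv_right: "bij s \<Longrightarrow> Pm s ** Pm (inv s) = mat 1"
  by (simp add: vec_eq_iff Pm_mult_nth) (auto simp: Pm_def mat_def bij_is_inj)

lemma Pm_inv_left: "bij s \<Longrightarrow> Pm (inv s) ** Pm s = mat 1"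
  using Pm_inv_right matrix_left_right_inverse by blast

lemma invertible_Pm: "bij s \<Longrightarrow> invertible (Pm s)"
  using Pm_inv_right Pm_inv_left invertible_def by blast

lemma transpose_Pm: "bij s \<Longrightarrow> transpose (Pm s) = Pm (inv s)"
  unfolding transpose_def Pm_def vec_eq_iff by (auto simp: bij_inv_eq_iff)

lemma orthogonal_Pm: "bij s \<Longrightarrow> orthogonal_matrix (Pm s)"
  by (simp add: orthogonal_matrix transpose_Pm Pm_inv_left)

lemma Pm_conj_nth: "bij s \<Longrightarrow> (Pm (inv s) ** K ** Pm s) $ i $ j = K $ (inv s i) $ (inv s j)"
  by (simp add: mult_Pm_nth Pm_mult_nth)

lemma btri_Pm_conj: "bij s \<Longrightarrow> btri (\<lambda>p. f (s p)) K \<Longrightarrow> btri f (Pm (inv s) ** K ** Pm s)"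
  unfolding btri_def Pm_conj_nth by (metis bij_is_surj surj_f_inv_f)

lemma diag_mat_mult_nth: "(diag_mat d ** M) $ i $ j = d i * M $ i $ j"
proof -
  have "(\<Sum>k\<in>UNIV. (if i = k then d i else 0) * M $ k $ j) = (\<Sum>k\<in>UNIV. if k = i then d i * M $ k $ j else 0)"
    by (intro sum.cong) auto
  then show ?thesis by (simp add: matrix_mult_nth diag_mat_def)
qed

lemma mult_diag_mat_nth: "(M ** diag_mat d) $ i $ j = M $ i $ j * d j"
proof -
  have "(\<Sum>k\<in>UNIV. M $ i $ k * (if k = j then d k else 0)) = (\<Sum>k\<in>UNIV. if k = j then M $ i $ k * d k else 0)"
    by (intro sum.cong) auto
  then show ?thesis by (simp add: matrix_mult_nth diag_mat_def)
qed

lemma Pm_diag_mat: "Pm s ** diag_mat d = diag_mat (\<lambda>p. d (s p)) ** Pm s"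
  by (simp add: vec_eq_iff diag_mat_mult_nth Pm_mult_nth) (simp add: diag_mat_def Pm_def)

lemma transpose_diag_mat [simp]: "transpose (diag_mat d) = diag_mat d"
  by (auto simp: transpose_def diag_mat_def vec_eq_iff)

lemma diag_mat_mult_diag_mat: "diag_mat d ** diag_mat e = diag_mat (\<lambda>p. d p * e p)"
  by (simp add: vec_eq_iff diag_mat_mult_nth) (simp add: diag_mat_def)

lemma diag_mat_one: "diag_mat (\<lambda>p. 1) = mat 1"
  by (simp add: diag_mat_def mat_def)

lemma diag_mat_eq_iff: "diag_mat d = diag_mat e \<longleftrightarrow> d = e"
  by (auto simp: diag_mat_def vec_eq_iff fun_eq_iff)

lemma invertible_diag_mat: "(\<And>p. d p \<noteq> 0) \<Longrightarrow> invertible (diag_mat d)"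
  unfolding invertible_right_inverse
  by (rule exI[of _ "diag_mat (\<lambda>p. inverse (d p))"]) (simp add: diag_mat_mult_diag_mat diag_mat_one)

section \<open>Lower and upper triangular matrices\<close>

definition low :: "'n::{finite,linorder} \<Rightarrow> real" where "low p = - real (pos p)"
definition up :: "'n::{finite,linorder} \<Rightarrow> real" where "up p = real (pos p)"

lemma pos_less_iff: "pos p < pos q \<longleftrightarrow> (p::'n::{finite,linorder}) < q"
proof -
  have "p < q \<Longrightarrow> pos p < pos q" for p q :: 'n
    unfolding pos_def by (rule psubset_card_mono) (use leD in \<open>auto simp: psubset_eq\<close>)
  then show ?thesis by (metis linorder_neqE not_less_iff_gr_or_eq)
qed

lemma pos_le_iff: "pos p \<le> pos q \<longleftrightarrow> (p::'n::{finite,linorder}) \<le> q"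
  by (metis not_le pos_less_iff)

lemma low_le_iff [simp]: "low p \<le> low q \<longleftrightarrow> q \<le> p" by (simp add: low_def pos_le_iff)
lemma up_le_iff [simp]: "up p \<le> up q \<longleftrightarrow> p \<le> q" by (simp add: up_def pos_le_iff)
lemma low_less_iff [simp]: "low p < low q \<longleftrightarrow> q < p" by (simp add: low_def pos_less_iff)
lemma up_less_iff [simp]: "up p < up q \<longleftrightarrow> p < q" by (simp add: up_def pos_less_iff)
lemma inj_low: "inj low" by (metis antisym injI low_le_iff order_refl)
lemma inj_up: "inj up" by (metis antisym injI up_le_iff order_refl)

lemma btri_low_iff: "btri low M \<longleftrightarrow> (\<forall>p q. p < q \<longrightarrow> M $ p $ q = 0)"
  unfolding btri_def low_le_iff by (meson not_le)
lemma btri_up_iff: "btri up M \<longleftrightarrow> (\<forall>p q. q < p \<longrightarrow> M $ p $ q = 0)"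
  unfolding btri_def up_le_iff by (meson not_le)

lemma btri_up_transpose: "btri up (transpose M) \<longleftrightarrow> btri low M"
  by (simp add: btri_transpose low_def[abs_def] up_def[abs_def])

lemma btri_low_transpose: "btri low (transpose M) \<longleftrightarrow> btri up M"
  by (simp add: btri_transpose low_def[abs_def] up_def[abs_def])

type_synonym 'n rmat = "((real, 'n) vec, 'n) vec"

lemma finite_less_induct [case_names less]:
  fixes a :: "'a::{finite,linorder}"
  assumes "\<And>x. (\<And>y. y < x \<Longrightarrow> P y) \<Longrightarrow> P x"
  shows "P a"
  by (induction a rule: measure_induct_rule[of pos]) (metis assms pos_less_iff)

section \<open>Row orthonormalisation\<close>

text \<open>Gram-Schmidt is given by explicit recursion, not by a choice of factors, so that
  continuity and differentiability of \<open>GS\<close> follow row by row.\<close>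

function gs :: "('n::{finite,linorder}) rmat \<Rightarrow> 'n \<Rightarrow> (real, 'n) vec" where
  "gs M p = (let v = M $ p - (\<Sum>r\<in>{r. r < p}. (M $ p \<bullet> gs M r) *\<^sub>R gs M r) in v /\<^sub>R norm v)"
  by auto
termination by (relation "Wellfounded.measure (\<lambda>x. pos (snd x))") (auto simp: pos_less_iff)

declare gs.simps [simp del]

definition gsv :: "('n::{finite,linorder}) rmat \<Rightarrow> 'n \<Rightarrow> (real, 'n) vec" where
  "gsv M p = M $ p - (\<Sum>r\<in>{r. r < p}. (M $ p \<bullet> gs M r) *\<^sub>R gs M r)"

definition GS :: "('n::{finite,linorder}) rmat \<Rightarrow> 'n rmat" where
  "GS M = (\<chi> p. gs M p)"

lemma gs_eq: "gs M p = gsv M p /\<^sub>R norm (gsv M p)"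
  unfolding gsv_def by (subst gs.simps) (simp add: Let_def)

text \<open>The vector \<open>x\<close> is dual to the rows of \<open>M\<close>: it pairs to 1 with
  row \<open>p\<close> and to 0 with all others. It therefore annihilates the earlier Gram-Schmidt
  vectors and pairs to 1 with \<open>gsv M p\<close>.\<close>

lemma gsv_nonzero:
  assumes "invertible M" shows "gsv M p \<noteq> 0"
proof -
  define x where "x = matrix_inv M *v axis p 1"
  have "M *v x = axis p 1" by (simp add: x_def matrix_vector_mul_assoc matrix_inv_right assms)
  then have Mx: "M $ r \<bullet> x = (if r = p then 1 else 0)" for r
    using matrix_vector_mul_component[of M x r] by (simp add: axis_def)
  have "r < p \<Longrightarrow> gs M r \<bullet> x = 0" for r
  proof (induction r rule: finite_less_induct)
    case (less r)
    then have "gsv M r \<bullet> x = 0"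
      by (auto simp: gsv_def inner_diff_left inner_sum_left Mx intro!: sum.neutral)
    then show ?case by (simp add: gs_eq)
  qed
  then have "gsv M p \<bullet> x = 1"
    by (simp add: gsv_def inner_diff_left inner_sum_left Mx)
  then show ?thesis by auto
qed

lemma gs_orthonormal:
  assumes "invertible M"
  shows "gs M p \<bullet> gs M q = (if p = q then 1 else 0)"
proof -
  have 1: "gs M p \<bullet> gs M p = 1" for p
    using gsv_nonzero[OF assms, of p] by (simp add: gs_eq dot_square_norm power2_eq_square field_simps)
  have 2: "r < p \<Longrightarrow> gs M p \<bullet> gs M r = 0" for p r
  proof (induction p arbitrary: r rule: finite_less_induct)
    case (less p)
    have "gs M s \<bullet> gs M r = (if s = r then 1 else 0)" if "s < p" for s
      using less.IH[OF that, of r] less.IH[OF less.prems, of s] 1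
      by (cases s r rule: linorder_cases) (auto simp: inner_commute)
    then have "(\<Sum>s\<in>{s. s < p}. (M $ p \<bullet> gs M s) * (gs M s \<bullet> gs M r))
        = (\<Sum>s\<in>{s. s < p}. if s = r then M $ p \<bullet> gs M s else 0)"
      by (intro sum.cong) auto
    also have "\<dots> = M $ p \<bullet> gs M r" using less.prems by simp
    finally have "gsv M p \<bullet> gs M r = 0" by (simp add: gsv_def inner_diff_left inner_sum_left)
    then show ?case by (simp add: gs_eq[of M p])
  qed
  show ?thesis
    using 1 2[of q p] 2[of p q] inner_commute[of "gs M p" "gs M q"]
    by (cases p q rule: linorder_cases) auto
qed

lemma orthogonal_GS: "invertible M \<Longrightarrow> orthogonal_matrix (GS M)"
  unfolding orthogonal_matrix_def
  by (rule conjI, subst matrix_left_right_inverse)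
     (simp_all add: matrix_mult_transpose_dot_row vec_eq_iff mat_def GS_def row_def gs_orthonormal vec_lambda_eta)

lemma GS_decomp:
  assumes "invertible M"
  obtains R where "M = R ** GS M" "btri low R" "\<And>p. R $ p $ p > 0"
proof
  define R where "R = (\<chi> p r. if r < p then M $ p \<bullet> gs M r else if r = p then norm (gsv M p) else 0)"
  show "btri low R" by (auto simp: btri_low_iff R_def)
  show "R $ p $ p > 0" for p using gsv_nonzero[OF assms] by (simp add: R_def)
  have "M $ p $ j = (R ** GS M) $ p $ j" for p j
  proof -
    have "M $ p = gsv M p + (\<Sum>r\<in>{r. r < p}. (M $ p \<bullet> gs M r) *\<^sub>R gs M r)" by (simp add: gsv_def)
    then have "M $ p $ j = gsv M p $ j + (\<Sum>r\<in>{r. r < p}. (M $ p \<bullet> gs M r) *\<^sub>R gs M r) $ j"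
      by (metis vector_add_component)
    moreover have "gsv M p $ j = norm (gsv M p) * gs M p $ j"
      using gsv_nonzero[OF assms, of p] by (simp add: gs_eq)
    ultimately have "M $ p $ j = norm (gsv M p) * gs M p $ j + (\<Sum>r\<in>{r. r < p}. (M $ p \<bullet> gs M r) * gs M r $ j)"
      by simp
    also have "(\<Sum>r\<in>{r. r < p}. (M $ p \<bullet> gs M r) * gs M r $ j) = (\<Sum>r\<in>{r. r < p}. R $ p $ r * gs M r $ j)"
      by (intro sum.cong) (auto simp: R_def)
    also have "norm (gsv M p) * gs M p $ j + \<dots> = (\<Sum>r\<in>insert p {r. r < p}. R $ p $ r * gs M r $ j)"
      by (subst sum.insert) (auto simp: R_def)
    also have "\<dots> = (\<Sum>r\<in>UNIV. R $ p $ r * gs M r $ j)"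
      by (intro sum.mono_neutral_left) (auto simp: R_def)
    finally show ?thesis by (simp add: matrix_mult_nth GS_def)
  qed
  then show "M = R ** GS M" by (simp add: vec_eq_iff)
qed

text \<open>The inverse of a lower triangular matrix is lower triangular, and here it is the
  transpose. So \<open>X\<close> is diagonal with entries squaring to 1.\<close>

lemma orthogonal_low_pos_eq_1:
  fixes X :: "('n::{finite,linorder}) rmat"
  assumes X: "orthogonal_matrix X" "btri low X" "\<And>p. X $ p $ p > 0"
  shows "X = mat 1"
proof -
  have tr: "btri low (transpose X)"
    using btri_matrix_inv[OF X(2) orthogonal_invertible[OF X(1)]] matrix_inv_orthogonal[OF X(1)] by simp
  then have off: "X $ p $ q = 0" if "p \<noteq> q" for p q
    using X(2) tr that unfolding btri_low_iff by (auto simp: neq_iff transpose_def)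
  have "X $ p $ p * transpose X $ p $ p = (mat 1 :: 'n rmat) $ p $ p" for p
    using btri_diag_mult[OF inj_low X(2) \<open>btri low (transpose X)\<close>] X(1) by (simp add: orthogonal_matrix_def)
  then have "X $ p $ p * X $ p $ p = 1" for p by (simp add: transpose_def mat_def)
  then have sq: "X $ p $ p = 1 \<or> X $ p $ p = -1" for p by (simp add: square_eq_1_iff)
  have "X $ p $ p = 1" for p using sq[of p] X(3)[of p] by auto
  with off show ?thesis by (simp add: vec_eq_iff mat_def)
qed

text \<open>The quotient of the triangular factors equals a quotient of the orthogonal ones, so it
  is the identity by \<open>orthogonal_low_pos_eq_1\<close>.\<close>

lemma LQ_unique:
  fixes Q1 Q2 :: "('n::{finite,linorder}) rmat"
  assumes eq: "R1 ** Q1 = R2 ** Q2" and Q: "orthogonal_matrix Q1" "orthogonal_matrix Q2"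
    and R: "btri low R1" "\<And>p. R1 $ p $ p > 0" "btri low R2" "\<And>p. R2 $ p $ p > 0"
  shows "Q1 = Q2"
proof -
  have i2: "invertible R2" using btri_invertible[OF inj_low R(3)] R(4) by (metis less_irrefl)
  define X where "X = matrix_inv R2 ** R1"
  have "X ** Q1 = Q2" unfolding X_def
    by (metis eq i2 matrix_inv_left matrix_mul_assoc matrix_mul_lid)
  then have XQ: "X = Q2 ** transpose Q1"
    by (metis Q(1) matrix_mul_assoc matrix_mul_rid orthogonal_matrix_def)
  have "orthogonal_matrix X" unfolding XQ using Q by (simp add: orthogonal_matrix_mul)
  moreover have "btri low X" unfolding X_def by (intro btri_mult btri_matrix_inv R i2)
  moreover have "X $ p $ p > 0" for p
  proof -
    have "R2 $ p $ p * X $ p $ p = (R2 ** X) $ p $ p"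
      using btri_diag_mult[OF inj_low R(3) \<open>btri low X\<close>] by simp
    also have "R2 ** X = R1" unfolding X_def by (metis i2 matrix_inv_right matrix_mul_assoc matrix_mul_lid)
    finally show ?thesis using R(2)[of p] R(4)[of p] zero_less_mult_pos[of "R2 $ p $ p" "X $ p $ p"] by simp
  qed
  ultimately have "X = mat 1" by (rule orthogonal_low_pos_eq_1)
  then show ?thesis using \<open>X ** Q1 = Q2\<close> by simp
qed

lemma GS_eqI:
  assumes "M = R ** Q" "orthogonal_matrix Q" "btri low R" "\<And>p. R $ p $ p > 0"
  shows "GS M = Q"
proof -
  have "invertible R" using btri_invertible[OF inj_low assms(3)] assms(4) by (metis less_irrefl)
  then have "invertible M" using assms(1,2) by (simp add: invertible_mult orthogonal_invertible)
  then obtain R' where "M = R' ** GS M" "btri low R'" "\<And>p. R' $ p $ p > 0"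
    using GS_decomp by blast
  with assms \<open>invertible M\<close> show ?thesis by (metis LQ_unique orthogonal_GS)
qed

lemma GS_orthogonal: "orthogonal_matrix Q \<Longrightarrow> GS Q = Q"
  by (rule GS_eqI[of _ "mat 1"]) (simp_all, simp add: mat_def)

text \<open>Prepared for \<open>flow_limit\<close>: lower factors with positive diagonal are
  invisible to \<open>GS\<close>, however fast they grow in time.\<close>

lemma GS_low_mult:
  assumes l: "btri low l" "\<And>p. l $ p $ p > 0" and M: "invertible M"
  shows "GS (l ** M) = GS M"
proof -
  obtain R where R: "M = R ** GS M" "btri low R" "\<And>p. R $ p $ p > 0" using GS_decomp[OF M] by blast
  show ?thesis
  proof (rule GS_eqI)
    show "l ** M = (l ** R) ** GS M" by (metis R(1) matrix_mul_assoc)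
    show "(l ** R) $ p $ p > 0" for p
      using btri_diag_mult[OF inj_low l(1) R(2), of p] l(2) R(3) by simp
  qed (use l R M in \<open>auto intro: btri_mult orthogonal_GS\<close>)
qed

lemma tendsto_GS:
  assumes M: "(M \<longlongrightarrow> A) F" and A: "invertible A"
  shows "((\<lambda>t. GS (M t)) \<longlongrightarrow> GS A) F"
proof -
  have "((\<lambda>t. gs (M t) p) \<longlongrightarrow> gs A p) F" for p
  proof (induction p rule: finite_less_induct)
    case (less p)
    have "((\<lambda>t. gsv (M t) p) \<longlongrightarrow> gsv A p) F"
      unfolding gsv_def by (intro tendsto_intros M less) auto
    then show ?case unfolding gs_eq
      by (intro tendsto_intros) (use gsv_nonzero[OF A, of p] in auto)
  qed
  then show ?thesis unfolding GS_def by (intro tendsto_intros)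
qed

lemma differentiable_scaleR_at:
  assumes "f differentiable (at t)" "g differentiable (at t)"
  shows "(\<lambda>x. f x *\<^sub>R g x) differentiable (at (t::real))"
  using assms unfolding differentiable_def by (blast intro: has_derivative_scaleR)

text \<open>The value of \<open>D\<close> stays open, since differentiating Gram-Schmidt gives an
  unwieldy formula; \<open>flow_exists\<close> identifies it by symmetry considerations.\<close>

lemma has_vector_derivative_GS:
  assumes M: "(M has_vector_derivative M') (at t)" and inv: "invertible (M t)"
  obtains D where "((\<lambda>t. GS (M t)) has_vector_derivative D) (at t)"
proof -
  have dM: "(\<lambda>t. M t $ p) differentiable (at t)" for p
    using bounded_linear.has_vector_derivative[OF bounded_linear_vec_nth M] by (rule differentiableI_vector)
  have 1: "(\<lambda>t. gs (M t) p) differentiable (at t)" for p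
  proof (induction p rule: finite_less_induct)
    case (less p)
    have d: "(\<lambda>t. gsv (M t) p) differentiable (at t)"
      unfolding gsv_def
      by (intro differentiable_diff differentiable_sum ballI differentiable_scaleR_at differentiable_inner dM less) auto
    have "norm differentiable (at (gsv (M t) p))"
      by (rule differentiable_norm_at) (rule gsv_nonzero[OF inv])
    then have "(\<lambda>t. norm (gsv (M t) p)) differentiable (at t)"
      using differentiable_chain_at[OF d] by (simp add: o_def)
    then have "(\<lambda>t. inverse (norm (gsv (M t) p))) differentiable (at t)"
      by (rule differentiable_inverse) (use gsv_nonzero[OF inv] in auto)
    then show ?case unfolding gs_eq by (intro differentiable_scaleR_at d)
  qed
  have eq: "GS A = (\<Sum>p\<in>UNIV. axis p (gs A p))" for A
    by (simp add: vec_eq_iff GS_def axis_def if_distrib[where f="\<lambda>x. x $ _"] cong: if_cong)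
  have "bounded_linear (axis p :: (real,'a) vec \<Rightarrow> _)" for p :: 'a
    unfolding linear_conv_bounded_linear[symmetric]
    by (intro linearI) (auto simp: vec_eq_iff axis_def)
  then have "((\<lambda>t. axis p (gs (M t) p)) has_vector_derivative axis p (vector_derivative (\<lambda>t. gs (M t) p) (at t))) (at t)" for p
    by (rule bounded_linear.has_vector_derivative) (use 1 vector_derivative_works in blast)
  then have "((\<lambda>t. GS (M t)) has_vector_derivative (\<Sum>p\<in>UNIV. axis p (vector_derivative (\<lambda>t. gs (M t) p) (at t)))) (at t)"
    unfolding eq by (rule has_vector_derivative_sum)
  then show ?thesis by (rule that)
qed

section \<open>Explicit solution of the flow\<close>

lemma bounded_bilinear_matrix_mult:
  "bounded_bilinear ((**) :: 'n::finite rmat \<Rightarrow> 'n rmat \<Rightarrow> 'n rmat)"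
  unfolding bilinear_conv_bounded_bilinear[symmetric] bilinear_def
  by (intro conjI allI linearI)
     (simp_all add: vec_eq_iff matrix_mult_nth sum.distrib sum_distrib_left algebra_simps)

lemmas tendsto_matrix_mult = bounded_bilinear.tendsto[OF bounded_bilinear_matrix_mult]
lemmas continuous_on_matrix_mult = bounded_bilinear.continuous_on[OF bounded_bilinear_matrix_mult]
lemmas has_vector_derivative_matrix_mult =
  bounded_bilinear.has_vector_derivative[OF bounded_bilinear_matrix_mult]
lemmas matrix_mult_diff_left = bounded_bilinear.diff_left[OF bounded_bilinear_matrix_mult]
lemmas matrix_mult_add_left = bounded_bilinear.add_left[OF bounded_bilinear_matrix_mult]
lemmas matrix_mult_add_right = bounded_bilinear.add_right[OF bounded_bilinear_matrix_mult]
lemmas matrix_mult_minus_left = bounded_bilinear.minus_left[OF bounded_bilinear_matrix_mult]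
lemmas matrix_mult_minus_right = bounded_bilinear.minus_right[OF bounded_bilinear_matrix_mult]

lemma has_vector_derivative_entry:
  "(M has_vector_derivative D) (at t) \<Longrightarrow> ((\<lambda>t. M t $ i $ j) has_real_derivative D $ i $ j) (at t)"
  unfolding has_real_derivative_iff_has_vector_derivative
  by (intro bounded_linear.has_vector_derivative[OF bounded_linear_vec_nth])

lemma continuous_on_det: "continuous_on S (det :: 'n::finite rmat \<Rightarrow> real)"
  unfolding det_def by (intro continuous_intros)

lemma tendsto_det: "(M \<longlongrightarrow> (A::'n::finite rmat)) F \<Longrightarrow> ((\<lambda>t. det (M t)) \<longlongrightarrow> det A) F"
  unfolding det_def by (intro tendsto_intros)

definition expD :: "('n \<Rightarrow> real) \<Rightarrow> real \<Rightarrow> 'n::finite rmat" where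
  "expD mu t = diag_mat (\<lambda>p. exp (t * mu p))"

definition Lax :: "('n \<Rightarrow> real) \<Rightarrow> 'n::finite rmat \<Rightarrow> 'n rmat" where
  "Lax mu Psi = Psi ** diag_mat mu ** transpose Psi"

lemma expD_0 [simp]: "expD mu 0 = mat 1"
  by (simp add: expD_def diag_mat_one)

lemma expD_minus: "expD mu t ** expD mu (- t) = mat 1" "expD mu (- t) ** expD mu t = mat 1"
  by (simp_all add: expD_def diag_mat_mult_diag_mat exp_minus diag_mat_one)

lemma invertible_expD: "invertible (expD mu t)"
  by (simp add: expD_def invertible_diag_mat)

lemma diag_mat_sum: "diag_mat d = (\<Sum>p\<in>UNIV. d p *\<^sub>R diag_mat (\<lambda>q. if q = p then 1 else 0))"
proof -
  have "(\<Sum>p\<in>UNIV. d p * diag_mat (\<lambda>q. if q = p then 1 else 0) $ i $ j)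
      = (\<Sum>p\<in>UNIV. if p = i then diag_mat d $ i $ j else 0)" for i j
    by (intro sum.cong) (auto simp: diag_mat_def)
  then show ?thesis by (simp add: vec_eq_iff)
qed

lemma has_vector_derivative_expD:
  "(expD mu has_vector_derivative diag_mat mu ** expD mu t) (at t)"
proof -
  define E :: "'a \<Rightarrow> 'a rmat" where "E p = diag_mat (\<lambda>q. if q = p then 1 else 0)" for p
  have "((\<lambda>t. \<Sum>p\<in>UNIV. exp (t * mu p) *\<^sub>R E p) has_vector_derivative
      (\<Sum>p\<in>UNIV. (mu p * exp (t * mu p)) *\<^sub>R E p)) (at t)"
    by (auto intro!: derivative_eq_intros has_vector_derivative_sum has_vector_derivative_scaleR[where g="\<lambda>_. E _" and g'=0, simplified])
  then show ?thesis
    unfolding E_def diag_mat_sum[symmetric] expD_def diag_mat_mult_diag_mat by simp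
qed

lemma has_vector_derivative_expD_neg:
  "((\<lambda>t. expD mu (- t)) has_vector_derivative - (diag_mat mu ** expD mu (- t))) (at t)"
proof -
  have "(uminus has_vector_derivative - 1) (at t)"
    using has_vector_derivative_minus[OF has_vector_derivative_id, of "at t"] by simp
  from vector_diff_chain_at[OF this has_vector_derivative_expD] show ?thesis by (simp add: o_def)
qed

lemma Lax_transpose: "transpose (Lax mu Psi) = Lax mu Psi"
  by (simp add: Lax_def matrix_transpose_mul matrix_mul_assoc)

lemma Lax_mult: "orthogonal_matrix Psi \<Longrightarrow> Lax mu Psi ** Psi = Psi ** diag_mat mu"
  unfolding Lax_def by (metis matrix_mul_assoc matrix_mul_rid orthogonal_matrix_def)

lemma Mfield_eq:
  "orthogonal_matrix Psi \<Longrightarrow> Mfield lam I Psi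
     = (upper_part (Lax (\<lambda>p. lam (std_block I p)) Psi) - lower_part (Lax (\<lambda>p. lam (std_block I p)) Psi)) ** Psi"
  by (simp add: Mfield_def Let_def Lambda_mat_def Lax_def matrix_inv_orthogonal)

lemma orthogonal_entry_le_1:
  assumes "orthogonal_matrix (Psi::'n::finite rmat)" shows "\<bar>Psi $ p $ q\<bar> \<le> 1"
proof -
  have "norm (row p Psi) = 1"
    using assms by (simp add: orthogonal_matrix_orthonormal_rows)
  then show ?thesis using component_le_norm_cart[of "row p Psi" q] by (simp add: row_def)
qed

text \<open>Orthogonality bounds the entries of \<open>Psi\<close>, so the coefficient of the scalar
  equations in \<open>flow_eq_GS\<close> is bounded uniformly in time.\<close>

lemma Lax_diag_bound:
  assumes "orthogonal_matrix (Psi::'n::finite rmat)"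
  shows "\<bar>Lax mu Psi $ p $ p\<bar> \<le> (\<Sum>q\<in>UNIV. \<bar>mu q\<bar>)"
proof -
  have "Lax mu Psi $ p $ p = (\<Sum>q\<in>UNIV. (Psi $ p $ q * mu q) * Psi $ p $ q)"
    unfolding Lax_def matrix_mult_nth[of "Psi ** diag_mat mu"] mult_diag_mat_nth by (simp add: transpose_def)
  also have "\<bar>\<dots>\<bar> \<le> (\<Sum>q\<in>UNIV. \<bar>mu q\<bar>)"
  proof (intro order_trans[OF sum_abs] sum_mono)
    fix q
    have "\<bar>Psi $ p $ q\<bar> * \<bar>Psi $ p $ q\<bar> \<le> 1 * 1"
      by (intro mult_mono orthogonal_entry_le_1 assms) auto
    then have "\<bar>mu q\<bar> * (\<bar>Psi $ p $ q\<bar> * \<bar>Psi $ p $ q\<bar>) \<le> \<bar>mu q\<bar> * 1"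
      by (intro mult_left_mono) auto
    then show "\<bar>Psi $ p $ q * mu q * Psi $ p $ q\<bar> \<le> \<bar>mu q\<bar>" by (simp add: abs_mult mult_ac)
  qed
  finally show ?thesis .
qed

text \<open>Gronwall's argument: the square of \<open>y\<close> weighted by
  \<open>exp (- (2 * K * t))\<close> is nonincreasing, and weighted by
  \<open>exp (2 * K * t)\<close> it is nondecreasing. Being nonnegative and zero at time 0, it
  vanishes forward by the first weight and backward by the second.\<close>

lemma scalar_ode_zero:
  fixes y a :: "real \<Rightarrow> real"
  assumes der: "\<And>t. (y has_real_derivative a t * y t) (at t)"
    and bound: "\<And>t. \<bar>a t\<bar> \<le> K" and y0: "y 0 = 0"
  shows "y t = 0"
proof (cases "t \<ge> 0")
  case True
  define z where "z t = (y t)\<^sup>2 * exp (- (2 * K * t))" for t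
  have "(z has_real_derivative 2 * (a s - K) * ((y s)\<^sup>2 * exp (- (2 * K * s)))) (at s)" for s
    unfolding z_def by (auto intro!: derivative_eq_intros der simp: power2_eq_square algebra_simps)
  moreover have "2 * (a s - K) * ((y s)\<^sup>2 * exp (- (2 * K * s))) \<le> 0" for s
    using abs_le_D1[OF bound[of s]] by (intro mult_nonpos_nonneg[of "2 * (a s - K)"]) simp_all
  ultimately have "z t \<le> z 0" by (intro DERIV_nonpos_imp_nonincreasing[OF True]) blast
  then have "(y t)\<^sup>2 * exp (- (2 * K * t)) \<le> 0" by (simp add: z_def y0)
  moreover have "(y t)\<^sup>2 * exp (- (2 * K * t)) \<ge> 0" by simp
  ultimately have "(y t)\<^sup>2 * exp (- (2 * K * t)) = 0" by linarith
  then show ?thesis by simp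
next
  case False
  define z where "z t = (y t)\<^sup>2 * exp (2 * K * t)" for t
  have "(z has_real_derivative 2 * (a s + K) * ((y s)\<^sup>2 * exp (2 * K * s))) (at s)" for s
    unfolding z_def by (auto intro!: derivative_eq_intros der simp: power2_eq_square algebra_simps)
  moreover have "2 * (a s + K) * ((y s)\<^sup>2 * exp (2 * K * s)) \<ge> 0" for s
    using abs_le_D2[OF bound[of s]] by (intro mult_nonneg_nonneg[of "2 * (a s + K)"]) simp_all
  moreover have "t \<le> 0" using False by simp
  ultimately have "z t \<le> z 0" by (intro DERIV_nonneg_imp_nondecreasing[of t 0 z]) blast+
  then have "(y t)\<^sup>2 * exp (2 * K * t) \<le> 0" by (simp add: z_def y0)
  moreover have "(y t)\<^sup>2 * exp (2 * K * t) \<ge> 0" by simp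
  ultimately have "(y t)\<^sup>2 * exp (2 * K * t) = 0" by linarith
  then show ?thesis by simp
qed

text \<open>With \<open>C = Psi(t) exp(-t Lambda) Psi(0)\<^sup>-\<^sup>1\<close> one has \<open>C' = (A - L) C\<close>, and \<open>A - L\<close> is lower
  triangular; the entries above the diagonal of \<open>C\<close> therefore vanish row by row.\<close>
lemma flow_eq_GS:
  fixes Psi :: "real \<Rightarrow> ('n::{finite,linorder}) rmat"
  assumes orth: "\<And>t. orthogonal_matrix (Psi t)"
    and der: "\<And>t. (Psi has_vector_derivative
        (upper_part (Lax mu (Psi t)) - lower_part (Lax mu (Psi t))) ** Psi t) (at t)"
  shows "Psi t = GS (Psi 0 ** expD mu t)"
proof -
  define L where "L t = Lax mu (Psi t)" for t
  define A where "A t = upper_part (L t) - lower_part (L t)" for t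
  define C where "C t = Psi t ** (expD mu (- t) ** transpose (Psi 0))" for t
  have dE: "((\<lambda>t. expD mu (- t)) has_vector_derivative - (diag_mat mu ** expD mu (- t))) (at t)" for t
    by (rule has_vector_derivative_expD_neg)
  have dC: "(C has_vector_derivative (A t - L t) ** C t) (at t)" for t
  proof -
    have "(C has_vector_derivative Psi t ** (expD mu (- t) ** 0 + - (diag_mat mu ** expD mu (- t)) ** transpose (Psi 0))
       + (A t ** Psi t) ** (expD mu (- t) ** transpose (Psi 0))) (at t)"
      unfolding C_def by (intro has_vector_derivative_matrix_mult dE has_vector_derivative_const)
         (use der A_def L_def in auto)
    moreover have "Psi t ** (expD mu (- t) ** 0 + - (diag_mat mu ** expD mu (- t)) ** transpose (Psi 0))
        = - ((Psi t ** diag_mat mu) ** (expD mu (- t) ** transpose (Psi 0)))"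
      by (simp add: matrix_mult_minus_left matrix_mult_minus_right matrix_mul_assoc
          bounded_bilinear.zero_right[OF bounded_bilinear_matrix_mult])
    moreover have "Psi t ** diag_mat mu = L t ** Psi t" using Lax_mult[OF orth] by (simp add: L_def)
    ultimately show ?thesis
      unfolding C_def matrix_mult_diff_left by (simp add: matrix_mul_assoc)
  qed
  have C0: "C 0 = mat 1" using orth[of 0] by (simp add: C_def orthogonal_matrix_def)
  have low: "(A t - L t) $ i $ k = 0" if "i < k" for i k t
    using that by (simp add: A_def upper_part_def lower_part_def)
  have Czero: "i < j \<Longrightarrow> \<forall>t. C t $ i $ j = 0" for i j
  proof (induction i rule: finite_less_induct)
    case (less i)
    have "((\<lambda>t. C t $ i $ j) has_real_derivative (A t - L t) $ i $ i * C t $ i $ j) (at t)" for t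
    proof -
      \<comment> \<open>Terms with \<open>k < i\<close> vanish by the induction hypothesis, as then
        \<open>k < j\<close>; terms with \<open>k > i\<close> vanish because
        \<open>A t - L t\<close> is lower triangular.\<close>
      have "(\<Sum>k\<in>UNIV. (A t - L t) $ i $ k * C t $ k $ j) = (\<Sum>k\<in>{i}. (A t - L t) $ i $ k * C t $ k $ j)"
        by (intro sum.mono_neutral_right) (use less low in \<open>auto simp: neq_iff\<close>)
      then have "((A t - L t) ** C t) $ i $ j = (A t - L t) $ i $ i * C t $ i $ j"
        by (simp add: matrix_mult_nth)
      then show ?thesis using has_vector_derivative_entry[OF dC[of t], where i=i and j=j] by simp
    qed
    moreover have "\<bar>(A t - L t) $ i $ i\<bar> \<le> (\<Sum>q\<in>UNIV. \<bar>mu q\<bar>)" for t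
      using Lax_diag_bound[OF orth] by (simp add: A_def upper_part_def lower_part_def L_def)
    moreover have "C 0 $ i $ j = 0" using less.prems by (simp add: C0 mat_def)
    ultimately show ?case by (intro allI) (rule scalar_ode_zero[of "\<lambda>t. C t $ i $ j"])
  qed
  have Clow: "btri low (C t)" for t using Czero by (auto simp: btri_low_iff)
  have Psi: "Psi t = C t ** (Psi 0 ** expD mu t)" for t
  proof -
    have "C t ** (Psi 0 ** expD mu t) = Psi t ** expD mu (- t) ** (transpose (Psi 0) ** Psi 0) ** expD mu t"
      by (simp add: C_def matrix_mul_assoc)
    also have "transpose (Psi 0) ** Psi 0 = mat 1" using orth[of 0] by (simp add: orthogonal_matrix_def)
    also have "Psi t ** expD mu (- t) ** mat 1 ** expD mu t = Psi t"
      by (simp add: matrix_mul_assoc[symmetric] expD_minus)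
    finally show ?thesis by simp
  qed
  have "invertible (C t)" for t
    unfolding C_def by (intro invertible_mult orthogonal_invertible invertible_expD orth) (simp add: orth)
  then have nz: "C t $ p $ p \<noteq> 0" for t p using btri_diag_nonzero[OF inj_low Clow] by blast
  have Cpos: "C t $ p $ p > 0" for p
  proof (rule ccontr)
    assume neg: "\<not> C t $ p $ p > 0"
    have cont: "isCont (\<lambda>t. C t $ p $ p) s" for s
      using has_vector_derivative_entry[OF dC] by (rule DERIV_isCont)
    have "C 0 $ p $ p = 1" by (simp add: C0 mat_def)
    then have "\<exists>s. C s $ p $ p = 0"
      using IVT[of "\<lambda>t. C t $ p $ p" t 0 0] IVT2[of "\<lambda>t. C t $ p $ p" t 0 0] neg cont
      by (cases "t \<le> 0") auto
    with nz show False by blast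
  qed

  obtain R where R: "R ** C t = mat 1" "C t ** R = mat 1"
    using \<open>invertible (C t)\<close> by (meson invertible_def)
  have Rl: "btri low R" using btri_matrix_inv[OF Clow \<open>invertible (C t)\<close>] matrix_inv_eqI[OF R(2)] by simp
  have "R $ p $ p > 0" for p
  proof -
    have "C t $ p $ p * R $ p $ p = 1"
      using btri_diag_mult[OF inj_low Clow[of t] Rl, of p] R(2) by (simp add: mat_def)
    then show ?thesis using Cpos[of p] zero_less_mult_pos[of "C t $ p $ p" "R $ p $ p"] by simp
  qed
  moreover have "Psi 0 ** expD mu t = R ** Psi t"
    by (metis Psi R(1) matrix_mul_assoc matrix_mul_lid)
  ultimately show ?thesis using GS_eqI[OF _ orth Rl] by metis
qed

text \<open>The velocity is found without differentiating Gram-Schmidt. As \<open>Psi\<close> stays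
  orthogonal, \<open>D t ** transpose (Psi t)\<close> is skew; as the triangular factor stays
  triangular, it differs from \<open>L\<close> by a lower triangular matrix. A skew matrix is
  determined by its entries above the diagonal, and \<open>L\<close> is symmetric, which leaves only
  \<open>upper_part L - lower_part L\<close>.\<close>

lemma flow_exists:
  fixes Psi0 :: "('n::{finite,linorder}) rmat" and mu :: "'n \<Rightarrow> real"
  assumes orth: "orthogonal_matrix Psi0"
  defines "Psi \<equiv> \<lambda>t. GS (Psi0 ** expD mu t)"
  shows "orthogonal_matrix (Psi t)" "Psi 0 = Psi0" "det (Psi t) = det Psi0"
    "(Psi has_vector_derivative
        (upper_part (Lax mu (Psi t)) - lower_part (Lax mu (Psi t))) ** Psi t) (at t)"
proof -
  define M where "M t = Psi0 ** expD mu t" for t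
  have inv: "invertible (M t)" for t
    unfolding M_def by (intro invertible_mult orthogonal_invertible orth invertible_expD)
  have PM: "Psi t = GS (M t)" for t by (simp add: Psi_def M_def)
  have orthP: "orthogonal_matrix (Psi t)" for t using inv by (simp add: PM orthogonal_GS)
  show "orthogonal_matrix (Psi t)" by (rule orthP)
  show P0: "Psi 0 = Psi0" using orth by (simp add: Psi_def GS_orthogonal)
  have dM: "(M has_vector_derivative Psi0 ** (diag_mat mu ** expD mu t) + 0 ** expD mu t) (at t)" for t
    unfolding M_def by (intro has_vector_derivative_matrix_mult has_vector_derivative_expD has_vector_derivative_const)
  have "\<exists>D. (Psi has_vector_derivative D) (at t)" for t
    using has_vector_derivative_GS[OF dM inv] unfolding PM[abs_def] by metis
  then obtain D where D: "\<And>t. (Psi has_vector_derivative D t) (at t)" by metis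
  have contP: "continuous_on UNIV Psi"
    using D by (meson continuous_at_imp_continuous_on has_vector_derivative_continuous)
  have "(\<lambda>t. det (Psi t)) ` UNIV \<subseteq> {1, -1}" using orthP det_orthogonal_matrix by blast
  moreover have "connected ((\<lambda>t. det (Psi t)) ` UNIV)"
    by (intro connected_continuous_image continuous_on_compose2[OF continuous_on_det contP]) auto
  ultimately have "\<exists>c. (\<lambda>t. det (Psi t)) ` UNIV = {c}"
    using connected_finite_iff_sing[of "(\<lambda>t. det (Psi t)) ` UNIV"] by (auto dest: finite_subset)
  then have "det (Psi t) = det (Psi 0)" by (metis rangeI singletonD)
  then show "det (Psi t) = det Psi0" by (simp add: P0)
  \<comment> \<open>This is the inverse of the triangular factor of \<open>M t\<close>, written as a
    product so that its derivative is available.\<close>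
  define K where "K t = Psi t ** (expD mu (- t) ** transpose Psi0)" for t
  have KM: "K t ** M t = Psi t" for t
  proof -
    have "K t ** M t = Psi t ** expD mu (- t) ** (transpose Psi0 ** Psi0) ** expD mu t"
      by (simp add: K_def M_def matrix_mul_assoc)
    also have "transpose Psi0 ** Psi0 = mat 1" using orth by (simp add: orthogonal_matrix_def)
    also have "Psi t ** expD mu (- t) ** mat 1 ** expD mu t = Psi t"
      by (simp add: matrix_mul_assoc[symmetric] expD_minus)
    finally show ?thesis .
  qed
  have Kinv: "invertible (K t)" for t
    unfolding K_def by (intro invertible_mult orthogonal_invertible orthP invertible_expD) (simp add: orth)
  have Klow: "btri low (K t)" for t
  proof -
    obtain R where R: "M t = R ** GS (M t)" "btri low R" "\<And>p. R $ p $ p > 0" using GS_decomp[OF inv] by blast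
    have Ri: "invertible R" using btri_invertible[OF inj_low R(2)] R(3) by (metis less_irrefl)
    have "R ** K t ** M t = M t" using R(1) KM[of t] PM[of t] by (simp add: matrix_mul_assoc[symmetric])
    then have "R ** K t = mat 1" using inv[of t] by (metis matrix_inv_right matrix_mul_assoc matrix_mul_rid)
    then have "K t = matrix_inv R" by (simp add: matrix_inv_eqI)
    then show ?thesis using btri_matrix_inv[OF R(2) Ri] by simp
  qed
  have dE: "((\<lambda>t. expD mu (- t)) has_vector_derivative - (diag_mat mu ** expD mu (- t))) (at t)"
    by (rule has_vector_derivative_expD_neg)
  define K' where "K' = Psi t ** (- (diag_mat mu ** expD mu (- t)) ** transpose Psi0) + D t ** (expD mu (- t) ** transpose Psi0)"
  have dK: "(K has_vector_derivative K') (at t)"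
  proof -
    have "(K has_vector_derivative Psi t ** (expD mu (- t) ** 0 + - (diag_mat mu ** expD mu (- t)) ** transpose Psi0)
       + D t ** (expD mu (- t) ** transpose Psi0)) (at t)"
      unfolding K_def by (intro has_vector_derivative_matrix_mult dE has_vector_derivative_const D)
    then show ?thesis by (simp add: K'_def bounded_bilinear.zero_right[OF bounded_bilinear_matrix_mult])
  qed
  have K'low: "btri low K'"
    unfolding btri_low_iff
  proof (intro allI impI)
    fix p q :: 'n assume "p < q"
    then have "(\<lambda>t. K t $ p $ q) = (\<lambda>t. 0)" using Klow by (auto simp: btri_low_iff)
    then show "K' $ p $ q = 0"
      using has_vector_derivative_entry[OF dK, of p q] DERIV_unique[of "\<lambda>t. 0" "K' $ p $ q" t 0] by simp
  qed
  define L where "L = Lax mu (Psi t)"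
  define W where "W = K' ** matrix_inv (K t)"
  have Wlow: "btri low W" unfolding W_def by (intro btri_mult K'low btri_matrix_inv Klow Kinv)
  have DW: "D t = (W + L) ** Psi t"
  proof -
    have "K' ** M t = - (Psi t ** diag_mat mu ** (expD mu (- t) ** (transpose Psi0 ** Psi0) ** expD mu t))
        + D t ** (expD mu (- t) ** (transpose Psi0 ** Psi0) ** expD mu t)"
      by (simp add: K'_def M_def matrix_mult_add_left matrix_mult_diff_left matrix_mult_minus_left matrix_mult_minus_right matrix_mul_assoc)
    also have "transpose Psi0 ** Psi0 = mat 1" using orth by (simp add: orthogonal_matrix_def)
    finally have "K' ** M t = D t - L ** Psi t"
      by (simp add: matrix_mul_assoc[symmetric] expD_minus L_def Lax_mult[OF orthP])
    moreover have "K' ** M t = W ** Psi t"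
      unfolding W_def KM[symmetric] by (metis Kinv matrix_inv_left matrix_mul_assoc matrix_mul_lid)
    ultimately show ?thesis by (simp add: matrix_mult_add_left)
  qed
  define S where "S = D t ** transpose (Psi t)"
  have SWL: "S = W + L"
    unfolding S_def DW by (metis matrix_mul_assoc matrix_mul_rid orthP orthogonal_matrix_def)
  have "bounded_linear (transpose :: 'n rmat \<Rightarrow> 'n rmat)"
    unfolding linear_conv_bounded_linear[symmetric] by (intro linearI) (auto simp: transpose_def vec_eq_iff)
  then have "((\<lambda>t. transpose (Psi t)) has_vector_derivative transpose (D t)) (at t)"
    using bounded_linear.has_vector_derivative D by blast
  then have "((\<lambda>t. Psi t ** transpose (Psi t)) has_vector_derivative Psi t ** transpose (D t) + D t ** transpose (Psi t)) (at t)"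
    by (intro has_vector_derivative_matrix_mult D)
  moreover have "(\<lambda>t. Psi t ** transpose (Psi t)) = (\<lambda>t. mat 1)" using orthP by (auto simp: orthogonal_matrix_def)
  ultimately have "Psi t ** transpose (D t) + D t ** transpose (Psi t) = 0"
    using vector_derivative_unique_at[OF _ has_vector_derivative_const[of "mat 1 :: 'n rmat"]] by metis
  then have "transpose S + S = 0" by (simp add: S_def matrix_transpose_mul)
  then have skew: "S $ q $ p + S $ p $ q = 0" for p q
    by (simp add: vec_eq_iff transpose_def)
  have Lsym: "L $ p $ q = L $ q $ p" for p q
    using Lax_transpose[of mu "Psi t"] unfolding L_def[symmetric] by (simp add: vec_eq_iff transpose_def)
  have Sup: "S $ p $ q = L $ p $ q" if "p < q" for p q
    using that Wlow by (simp add: SWL btri_low_iff)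
  have "S $ p $ q = (upper_part L - lower_part L) $ p $ q" for p q
  proof (cases p q rule: linorder_cases)
    case less then show ?thesis by (simp add: Sup upper_part_def lower_part_def)
  next
    case equal then show ?thesis using skew[of p p] by (simp add: upper_part_def lower_part_def)
  next
    case greater
    then show ?thesis using skew[of p q] Sup[of q p] Lsym[of p q] by (simp add: upper_part_def lower_part_def)
  qed
  then have "S = upper_part L - lower_part L" by (simp add: vec_eq_iff)
  then have "D t = (upper_part L - lower_part L) ** Psi t" using DW SWL by simp
  then show "(Psi has_vector_derivative
        (upper_part (Lax mu (Psi t)) - lower_part (Lax mu (Psi t))) ** Psi t) (at t)"
    using D[of t] by (simp add: L_def)
qed

section \<open>Cells and the limits of trajectories\<close>

definition unilow :: "('n::{finite,linorder}) rmat \<Rightarrow> bool" where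
  "unilow l \<longleftrightarrow> btri low l \<and> (\<forall>p. l $ p $ p = 1)"

text \<open>The double coset of \<open>Pm s\<close> under the unipotent lower matrices and the group
  of \<open>f\<close>. The left factor is lower for \<open>mu\<close> and \<open>- mu\<close> alike,
  because \<open>GS\<close> absorbs it; only the right factor changes with the direction of
  time.\<close>

definition cell :: "('n \<Rightarrow> real) \<Rightarrow> ('n \<Rightarrow> 'n) \<Rightarrow> ('n::{finite,linorder}) rmat \<Rightarrow> bool" where
  "cell f s M \<longleftrightarrow> (\<exists>l h. unilow l \<and> btri f h \<and> invertible h \<and> M = l ** Pm s ** h)"

lemma unilow_invertible: "unilow l \<Longrightarrow> invertible l"
  unfolding unilow_def by (metis btri_invertible inj_low zero_neq_one)

lemma unilow_mult: "unilow a \<Longrightarrow> unilow b \<Longrightarrow> unilow (a ** b)"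
  unfolding unilow_def by (simp add: btri_mult btri_diag_mult[OF inj_low])

lemma unilow_inv: assumes "unilow l" shows "unilow (matrix_inv l)"
proof -
  have l: "btri low (matrix_inv l)" "invertible l"
    using assms unilow_invertible by (auto simp: unilow_def intro: btri_matrix_inv)
  have "l $ p $ p * matrix_inv l $ p $ p = 1" for p
    using btri_diag_mult[of low l "matrix_inv l" p] l assms inj_low
    by (simp add: unilow_def matrix_inv_right mat_def)
  then show ?thesis using l(1) assms by (simp add: unilow_def)
qed

text \<open>On block triangular matrices, passing to the block diagonal part is multiplicative, so
  the block diagonal part of the inverse is an inverse.\<close>

lemma levi_part_invertible:
  fixes h :: "'n::finite rmat"
  assumes "btri f h" "invertible h"
  shows "invertible (\<chi> p q. if f p = f q then h $ p $ q else 0)"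
proof -
  define k where "k = matrix_inv h"
  have k: "btri f k" "h ** k = mat 1" using assms by (auto simp: k_def btri_matrix_inv matrix_inv_right)
  define h0 where "h0 = (\<chi> p q. if f p = f q then h $ p $ q else 0)"
  define k0 where "k0 = (\<chi> p q. if f p = f q then k $ p $ q else 0)"
  have "(h0 ** k0) $ p $ q = mat 1 $ p $ q" for p q
  proof (cases "f p = f q")
    case True
    have "h0 $ p $ r * k0 $ r $ q = h $ p $ r * k $ r $ q" for r
      using True btriD[OF assms(1), of r p] btriD[OF k(1), of q r]
      by (cases "f r" "f p" rule: linorder_cases) (auto simp: h0_def k0_def)
    then show ?thesis using k(2) by (simp add: matrix_mult_nth[symmetric] matrix_mult_nth[of h0])
  next
    case False
    then have "h0 $ p $ r * k0 $ r $ q = 0" for r by (auto simp: h0_def k0_def)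
    then show ?thesis using False unfolding matrix_mult_nth
      by (subst sum.neutral) (auto simp: mat_def)
  qed
  then have "h0 ** k0 = mat 1" by (simp add: vec_eq_iff)
  then show ?thesis unfolding h0_def[symmetric] using invertible_right_inverse by blast
qed

lemma tendsto_matrix_entries:
  assumes "\<And>i j. ((\<lambda>t. M t $ i $ j) \<longlongrightarrow> A $ i $ j) F"
  shows "(M \<longlongrightarrow> (A::'n::finite rmat)) F"
  by (intro vec_tendstoI assms)

lemma tendsto_transpose: "(M \<longlongrightarrow> (A::'n::finite rmat)) F \<Longrightarrow> ((\<lambda>t. transpose (M t)) \<longlongrightarrow> transpose A) F"
  by (rule tendsto_matrix_entries) (simp add: transpose_def tendsto_vec_nth)

lemma tendsto_Lax: "(M \<longlongrightarrow> (A::'n::finite rmat)) F \<Longrightarrow> ((\<lambda>t. Lax mu (M t)) \<longlongrightarrow> Lax mu A) F"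
  unfolding Lax_def by (intro tendsto_matrix_mult tendsto_transpose tendsto_const)

text \<open>Since \<open>h\<close> commutes with \<open>diag_mat mu\<close>, the triangular factor
  \<open>R\<close> conjugates the Lax matrix \<open>N\<close> into the diagonal matrix
  \<open>D\<close>. Hence \<open>N\<close> is lower triangular; being symmetric it is diagonal, with
  the diagonal of \<open>D\<close>.\<close>

lemma Lax_GS_levi:
  assumes s: "bij s" and h: "invertible h" "\<And>p q. h $ p $ q \<noteq> 0 \<Longrightarrow> mu p = mu q"
  shows "Lax mu (GS (Pm s ** h)) = diag_mat (\<lambda>p. mu (s p))"
proof -
  define M where "M = Pm s ** h"
  have inv: "invertible M" unfolding M_def by (intro invertible_mult invertible_Pm s h)
  define Q where "Q = GS M"
  obtain R where R: "M = R ** Q" "btri low R" "\<And>p. R $ p $ p > 0"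
    using GS_decomp[OF inv] unfolding Q_def by blast
  have Q: "orthogonal_matrix Q" unfolding Q_def by (rule orthogonal_GS[OF inv])
  have Ri: "invertible R" using btri_invertible[OF inj_low R(2)] R(3) by (metis less_irrefl)
  define N where "N = Lax mu Q"
  define D where "D = diag_mat (\<lambda>p. mu (s p))"
  have hc: "h ** diag_mat mu = diag_mat mu ** h"
    using h(2) by (simp add: vec_eq_iff mult_diag_mat_nth diag_mat_mult_nth) (metis mult.commute mult_eq_0_iff)
  have "R ** N ** Q = R ** Q ** diag_mat mu"
    by (metis Lax_mult N_def Q matrix_mul_assoc)
  also have "\<dots> = Pm s ** diag_mat mu ** h"
    by (simp add: R(1)[symmetric] M_def hc matrix_mul_assoc[symmetric])
  also have "\<dots> = D ** R ** Q" by (metis D_def M_def Pm_diag_mat R(1) matrix_mul_assoc)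
  finally have RN: "R ** N = D ** R"
    using Q by (metis matrix_mul_assoc matrix_mul_rid orthogonal_matrix_def)
  have "N = matrix_inv R ** (D ** R)" by (metis RN Ri matrix_inv_left matrix_mul_assoc matrix_mul_lid)
  then have Nlow: "btri low N" unfolding D_def using R(2) Ri by (simp add: btri_mult btri_matrix_inv)
  have Nsym: "N $ p $ q = N $ q $ p" for p q
    using Lax_transpose[of mu Q] unfolding N_def[symmetric] by (simp add: vec_eq_iff transpose_def)
  have off: "N $ p $ q = 0" if "p \<noteq> q" for p q
    using that Nlow Nsym[of p q] by (cases p q rule: linorder_cases) (auto simp: btri_low_iff)
  have "R $ p $ p * N $ p $ p = mu (s p) * R $ p $ p" for p
    using btri_diag_mult[OF inj_low R(2) Nlow, of p] unfolding RN D_def diag_mat_mult_nth by (rule sym)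
  then have "N $ p $ p = mu (s p)" for p
    using R(3)[of p] by (metis less_irrefl mult.commute mult_cancel_left)
  then show ?thesis using off unfolding N_def Q_def M_def by (simp add: vec_eq_iff diag_mat_def)
qed

text \<open>Moving the exponential to the left through \<open>h\<close> and \<open>Pm s\<close>
  turns it into a positive diagonal matrix \<open>E\<close>, and \<open>GS\<close> discards
  \<open>l ** E\<close>. What remains is \<open>Pm s\<close> times a convergent conjugate of
  \<open>h\<close>. The grading \<open>f\<close> is \<open>mu\<close> in the past and
  \<open>- mu\<close> in the future.\<close>

lemma flow_limit:
  assumes s: "bij s" and cell: "cell f s Psi0"
    and lim: "\<And>p q. f p < f q \<Longrightarrow> ((\<lambda>t. exp (t * (mu q - mu p))) \<longlongrightarrow> 0) F"
    and eq: "\<And>p q. f p = f q \<Longrightarrow> mu p = mu q"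
  shows "((\<lambda>t. Lax mu (GS (Psi0 ** expD mu t))) \<longlongrightarrow> diag_mat (\<lambda>p. mu (s p))) F"
proof -
  obtain l h where lh: "unilow l" "btri f h" "invertible h" "Psi0 = l ** Pm s ** h"
    using cell unfolding cell_def by blast
  define h0 where "h0 = (\<chi> p q. if f p = f q then h $ p $ q else 0)"
  define ht where "ht t = expD mu (- t) ** h ** expD mu t" for t
  have ent: "ht t $ p $ q = exp (t * (mu q - mu p)) * h $ p $ q" for t p q
    by (simp add: ht_def expD_def mult_diag_mat_nth diag_mat_mult_nth algebra_simps exp_diff exp_minus divide_inverse)
  have conv: "(ht \<longlongrightarrow> h0) F"
  proof (rule tendsto_matrix_entries)
    fix p q
    consider "f p < f q" | "f p = f q" | "f q < f p" by linarith
    then show "((\<lambda>t. ht t $ p $ q) \<longlongrightarrow> h0 $ p $ q) F"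
    proof cases
      case 1
      then show ?thesis using tendsto_mult_left_zero[OF lim[OF 1]] by (simp add: ent h0_def)
    next
      case 2
      then show ?thesis by (simp add: ent h0_def eq[OF 2])
    next
      case 3
      then show ?thesis using btriD[OF lh(2) 3] by (simp add: ent h0_def)
    qed
  qed
  have GSeq: "GS (Psi0 ** expD mu t) = GS (Pm s ** ht t)" for t
  proof -
    define E where "E = diag_mat (\<lambda>p. exp (t * mu (s p)))"
    have "(l ** E) ** (Pm s ** ht t) = l ** (E ** Pm s) ** ht t" by (simp add: matrix_mul_assoc)
    also have "E ** Pm s = Pm s ** expD mu t" by (simp add: E_def expD_def Pm_diag_mat)
    also have "l ** (Pm s ** expD mu t) ** ht t = l ** Pm s ** (expD mu t ** expD mu (- t)) ** h ** expD mu t"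
      by (simp add: ht_def matrix_mul_assoc)
    also have "\<dots> = Psi0 ** expD mu t" by (simp add: expD_minus lh(4))
    finally have e: "(l ** E) ** (Pm s ** ht t) = Psi0 ** expD mu t" .
    have "GS ((l ** E) ** (Pm s ** ht t)) = GS (Pm s ** ht t)"
    proof (rule GS_low_mult)
      show "btri low (l ** E)" using lh(1) by (simp add: unilow_def E_def btri_mult)
      show "(l ** E) $ p $ p > 0" for p
        using lh(1) by (simp add: unilow_def E_def mult_diag_mat_nth)
      show "invertible (Pm s ** ht t)"
        unfolding ht_def by (intro invertible_mult invertible_Pm s invertible_expD lh)
    qed
    then show ?thesis by (simp add: e)
  qed
  have h0inv: "invertible h0" unfolding h0_def by (rule levi_part_invertible[OF lh(2,3)])
  have "((\<lambda>t. Lax mu (GS (Pm s ** ht t))) \<longlongrightarrow> Lax mu (GS (Pm s ** h0))) F"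
    by (intro tendsto_Lax tendsto_GS tendsto_matrix_mult tendsto_const conv invertible_mult invertible_Pm s h0inv)
  moreover have "Lax mu (GS (Pm s ** h0)) = diag_mat (\<lambda>p. mu (s p))"
    by (rule Lax_GS_levi[OF s h0inv]) (auto simp: h0_def intro: eq split: if_splits)
  ultimately show ?thesis by (simp add: GSeq)
qed

section \<open>Limits in the two directions of time\<close>

lemma exp_mult_tendsto_at_bot:
  assumes "c > 0" shows "((\<lambda>t. exp (t * c)) \<longlongrightarrow> (0::real)) at_bot"
proof -
  have "filterlim (\<lambda>t. t * c) at_bot at_bot"
    using filterlim_tendsto_pos_mult_at_bot[OF tendsto_const assms filterlim_ident] by (simp add: mult.commute)
  then show ?thesis by (rule filterlim_compose[OF exp_at_bot])
qed

lemma exp_mult_tendsto_at_top: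
  assumes "c < 0" shows "((\<lambda>t. exp (t * c)) \<longlongrightarrow> (0::real)) at_top"
proof -
  have "((\<lambda>t. exp (- t * - c)) \<longlongrightarrow> (0::real)) at_top"
    using filterlim_compose[OF exp_mult_tendsto_at_bot[of "- c"] filterlim_uminus_at_bot_at_top] assms by simp
  then show ?thesis by simp
qed

lemma flow_limit_at_bot:
  "bij s \<Longrightarrow> cell mu s Psi0 \<Longrightarrow>
    ((\<lambda>t. Lax mu (GS (Psi0 ** expD mu t))) \<longlongrightarrow> diag_mat (\<lambda>p. mu (s p))) at_bot"
  by (rule flow_limit[where f=mu]) (auto intro: exp_mult_tendsto_at_bot)

lemma flow_limit_at_top:
  "bij s \<Longrightarrow> cell (\<lambda>p. - mu p) s Psi0 \<Longrightarrow>
    ((\<lambda>t. Lax mu (GS (Psi0 ** expD mu t))) \<longlongrightarrow> diag_mat (\<lambda>p. mu (s p))) at_top"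
  by (rule flow_limit[where f="\<lambda>p. - mu p"]) (auto intro: exp_mult_tendsto_at_top)

text \<open>Bruhat decomposition: among all \<open>l ** M\<close> with \<open>l\<close> unipotent lower triangular, take one whose
  pivots (\<open>g\<close>-least nonzero columns of the rows) have maximal total; two equal pivots could still be
  improved by a row operation, so the pivots are distinct.\<close>
lemma bruhat_decomposition:
  fixes M :: "('n::{finite,linorder}) rmat"
  assumes g: "inj g" and M: "invertible M"
  obtains s l h where "bij s" "unilow l" "btri g h" "invertible h" "M = l ** Pm s ** h"
proof -
  define piv where "piv W k \<longleftrightarrow> (\<forall>i. W $ i $ k i \<noteq> 0 \<and> (\<forall>c. g c < g (k i) \<longrightarrow> W $ i $ c = 0))"
    for W :: "'n rmat" and k :: "'n \<Rightarrow> 'n"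
  define K where "K = {k. \<exists>l. unilow l \<and> piv (l ** M) k}"
  have row: "\<exists>c. W $ i $ c \<noteq> 0 \<and> (\<forall>c'. g c' < g c \<longrightarrow> W $ i $ c' = 0)" if "invertible W" for W :: "'n rmat" and i
  proof -
    define S where "S = {c. W $ i $ c \<noteq> 0}"
    have "S \<noteq> {}"
    proof
      assume "S = {}"
      then have "W $ i = 0" by (auto simp: S_def vec_eq_iff)
      then have "(W ** matrix_inv W) $ i $ i = 0" by (simp add: matrix_mult_nth)
      then show False using that by (simp add: matrix_inv_right mat_def)
    qed
    then have "Min (g ` S) \<in> g ` S" by (intro Min_in) auto
    then obtain c where c: "c \<in> S" "Min (g ` S) = g c" by auto
    have "g c \<le> g c'" if "c' \<in> S" for c' using that c(2)[symmetric] by simp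
    then show ?thesis using c(1) by (intro exI[of _ c]) (auto simp: S_def not_le[symmetric])
  qed
  have pivex: "\<exists>k. piv W k" if "invertible W" for W
    unfolding piv_def using row[OF that] by metis
  have "unilow (mat 1 :: 'n rmat)" unfolding unilow_def by (simp, simp add: mat_def)
  then have "K \<noteq> {}" using pivex[OF M] unfolding K_def
    by (metis (mono_tags, lifting) empty_iff matrix_mul_lid mem_Collect_eq)
  define T where "T k = (\<Sum>i\<in>UNIV. g (k i))" for k :: "'n \<Rightarrow> 'n"
  have "Max (T ` K) \<in> T ` K" using \<open>K \<noteq> {}\<close> by (intro Max_in) auto
  then obtain k where k: "k \<in> K" "Max (T ` K) = T k" by auto
  have kmax: "T k' \<le> T k" if "k' \<in> K" for k' using that k(2)[symmetric] by simp
  obtain l where l: "unilow l" "piv (l ** M) k" using k(1) by (auto simp: K_def)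
  define W where "W = l ** M"
  have Winv: "invertible W" unfolding W_def by (intro invertible_mult unilow_invertible l M)
  have W: "W $ i $ k i \<noteq> 0" "g c < g (k i) \<Longrightarrow> W $ i $ c = 0" for i c
    using l(2) by (auto simp: W_def piv_def)
  have False if ij: "i < j" "k i = k j" for i j
  proof -
    define a where "a = W $ j $ k j / W $ i $ k i"
    define e where "e = (\<chi> p q. if p = q then 1 else if p = j \<and> q = i then - a else 0)"
    have e: "unilow e" using ij(1) by (auto simp: unilow_def e_def btri_low_iff)
    define W' where "W' = e ** W"
    have W'inv: "invertible W'" unfolding W'_def by (intro invertible_mult unilow_invertible e Winv)
    have W'eq: "W' $ p $ q = (if p = j then W $ j $ q - a * W $ i $ q else W $ p $ q)" for p q
    proof -
      have "(\<Sum>r\<in>UNIV. e $ p $ r * W $ r $ q) = (\<Sum>r\<in>UNIV. (if r = p then W $ p $ q else 0) + (if r = i then if p = j then - a * W $ i $ q else 0 else 0))"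
        using ij(1) by (intro sum.cong) (auto simp: e_def)
      then show ?thesis by (simp add: W'_def matrix_mult_nth sum.distrib)
    qed
    obtain c where c: "W' $ j $ c \<noteq> 0" "\<And>c'. g c' < g c \<Longrightarrow> W' $ j $ c' = 0" using row[OF W'inv] by metis
    have z: "W' $ j $ c' = 0" if "g c' \<le> g (k j)" for c'
    proof (cases "c' = k j")
      case True then show ?thesis using W(1)[of i] ij(2) by (simp add: W'eq a_def)
    next
      case False
      then have "g c' < g (k j)" using that g by (metis injD order_le_less)
      then show ?thesis using W(2)[of c' i] W(2)[of c' j] ij(2) by (simp add: W'eq)
    qed
    then have gc: "g (k j) < g c" using c(1) by (meson not_le)
    have "piv W' (k(j := c))" unfolding piv_def using c W W'eq by auto
    moreover have "W' = (e ** l) ** M" by (simp add: W'_def W_def matrix_mul_assoc)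
    ultimately have "k(j := c) \<in> K" unfolding K_def using unilow_mult[OF e l(1)] by auto
    moreover have "T (k(j := c)) = g c + (\<Sum>i\<in>UNIV - {j}. g (k i))"
      unfolding T_def by (subst sum.remove[of _ j]) auto
    moreover have "T k = g (k j) + (\<Sum>i\<in>UNIV - {j}. g (k i))"
      unfolding T_def by (subst sum.remove[of _ j]) auto
    ultimately show False using kmax[of "k(j := c)"] gc by simp
  qed
  then have "inj k" by (metis injI neq_iff)
  then have bk: "bij k" by (simp add: bij_def finite_UNIV_inj_surj)
  \<comment> \<open>Row \<open>k i\<close> of \<open>h\<close> is row \<open>i\<close> of
    \<open>W\<close>, whose entries vanish before its pivot column \<open>k i\<close>; so the pivots
    become the diagonal of \<open>h\<close>.\<close>
  define h where "h = Pm (inv k) ** W"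
  have "btri g h"
    unfolding btri_def h_def Pm_mult_nth using W(2) bk by (metis bij_inv_eq_iff not_le)
  moreover have "invertible h" unfolding h_def by (intro invertible_mult invertible_Pm bij_imp_bij_inv bk Winv)
  moreover have "M = matrix_inv l ** Pm k ** h"
  proof -
    have "Pm k ** h = W" unfolding h_def by (simp add: matrix_mul_assoc Pm_inv_right bk)
    then have "matrix_inv l ** Pm k ** h = matrix_inv l ** W" by (simp add: matrix_mul_assoc[symmetric])
    also have "\<dots> = M" unfolding W_def by (simp add: matrix_mul_assoc matrix_inv_left unilow_invertible l)
    finally show ?thesis by simp
  qed
  ultimately show ?thesis using that bk unilow_inv[OF l(1)] by blast
qed

text \<open>The cells exhaust the invertible matrices, so \<open>Psi0\<close> lies in some cell,
  whose limit is known; uniqueness of limits identifies the word. The decomposition for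
  \<open>up\<close> is finer than the one for \<open>mu\<close> by monotonicity.\<close>

lemma cell_of_limit_at_bot:
  assumes mono: "\<And>p q. p \<le> q \<Longrightarrow> mu p \<le> mu q" and orth: "orthogonal_matrix Psi0"
    and lim: "((\<lambda>t. Lax mu (GS (Psi0 ** expD mu t))) \<longlongrightarrow> diag_mat d) at_bot"
  obtains s where "bij s" "cell mu s Psi0" "d = (\<lambda>p. mu (s p))"
proof -
  obtain s l h where *: "bij s" "unilow l" "btri up h" "invertible h" "Psi0 = l ** Pm s ** h"
    using bruhat_decomposition[OF inj_up orthogonal_invertible[OF orth]] by metis
  have "btri mu h" using *(3) mono by (auto simp: btri_def)
  then have c: "cell mu s Psi0" using * unfolding cell_def by blast
  have "diag_mat d = diag_mat (\<lambda>p. mu (s p))"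
    by (rule tendsto_unique[OF _ lim flow_limit_at_bot[OF *(1) c]]) simp
  then show ?thesis using that *(1) c diag_mat_eq_iff by blast
qed

lemma cell_of_limit_at_top:
  assumes mono: "\<And>p q. p \<le> q \<Longrightarrow> mu p \<le> mu q" and orth: "orthogonal_matrix Psi0"
    and lim: "((\<lambda>t. Lax mu (GS (Psi0 ** expD mu t))) \<longlongrightarrow> diag_mat d) at_top"
  obtains s where "bij s" "cell (\<lambda>p. - mu p) s Psi0" "d = (\<lambda>p. mu (s p))"
proof -
  obtain s l h where *: "bij s" "unilow l" "btri low h" "invertible h" "Psi0 = l ** Pm s ** h"
    using bruhat_decomposition[OF inj_low orthogonal_invertible[OF orth]] by metis
  have "btri (\<lambda>p. - mu p) h" using *(3) mono by (auto simp: btri_def)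
  then have c: "cell (\<lambda>p. - mu p) s Psi0" using * unfolding cell_def by blast
  have "diag_mat d = diag_mat (\<lambda>p. mu (s p))"
    by (rule tendsto_unique[OF _ lim flow_limit_at_top[OF *(1) c]]) simp
  then show ?thesis using that *(1) c diag_mat_eq_iff by blast
qed

lemma Pm_quotient:
  assumes s: "bij s" "bij s'" and eq: "\<And>p. f (s p) = f (s' p)"
  shows "btri f (Pm (inv s') ** Pm s)" "invertible (Pm (inv s') ** Pm s)"
proof -
  show "btri f (Pm (inv s') ** Pm s)" unfolding btri_def Pm_mult_nth
    using eq s(2) by (auto simp: Pm_def bij_is_surj surj_f_inv_f)
  show "invertible (Pm (inv s') ** Pm s)" by (intro invertible_mult invertible_Pm bij_imp_bij_inv s)
qed

text \<open>Two permutations with the same word differ by a permutation inside the blocks, which the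
  right factor absorbs. So a cell depends only on the word, and any lift of it may be used.\<close>

lemma cell_cong:
  assumes s: "bij s" "bij s'" and eq: "\<And>p. f (s p) = f (s' p)" and c: "cell f s M"
  shows "cell f s' M"
proof -
  obtain l h where lh: "unilow l" "btri f h" "invertible h" "M = l ** Pm s ** h"
    using c unfolding cell_def by blast
  define k where "k = Pm (inv s') ** Pm s"
  have k: "btri f k" "invertible k" unfolding k_def by (rule Pm_quotient[OF s eq])+
  have "Pm s = Pm s' ** k" unfolding k_def by (simp add: matrix_mul_assoc Pm_inv_right s)
  then have "M = l ** Pm s' ** (k ** h)" by (simp add: lh(4) matrix_mul_assoc)
  then show ?thesis unfolding cell_def using lh k by (blast intro: btri_mult invertible_mult)
qed

section \<open>Rank inequalities between meeting cells\<close>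

lemma dim_rows_invertible:
  fixes M :: "'n::finite rmat"
  assumes "invertible M" shows "dim ((\<lambda>i. M $ i) ` A) = card A"
proof -
  define E where "E = (\<lambda>i. axis i (1::real) :: (real,'n) vec) ` A"
  have row: "transpose M *v axis i 1 = M $ i" for i
    by (simp add: matrix_vector_mult_basis column_def transpose_def vec_lambda_eta)
  have "inj ((*v) (transpose M))" using assms by (intro inj_matrix_vector_mult transpose_invertible)
  then have "dim ((*v) (transpose M) ` E) = dim E"
    by (intro dim_image_eq) (auto intro: inj_on_subset)
  moreover have "(*v) (transpose M) ` E = (\<lambda>i. M $ i) ` A"
    unfolding E_def image_image by (intro image_cong refl row)
  moreover have "independent E"
    by (rule independent_mono[OF independent_Basis]) (auto simp: E_def axis_in_Basis_iff)
  then have "dim E = card E" by (rule dim_eq_card_independent)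
  moreover have "card E = card A"
    unfolding E_def by (intro card_image) (auto simp: inj_on_def axis_eq_axis)
  ultimately show ?thesis by simp
qed

text \<open>The initial rows of \<open>M1\<close> up to \<open>p\<close> lie in the span
  \<open>Z\<close> of those of \<open>M2\<close>, as \<open>C\<close> is lower triangular. Rows of
  \<open>M1\<close> with \<open>mu (s i)\<close> above \<open>c\<close> are supported on coordinates
  above \<open>c\<close>, and rows of \<open>M2\<close> with \<open>mu (s' i)\<close> at most
  \<open>c\<close> on the remaining ones. The spans \<open>S\<close> and \<open>T\<close> are thus
  independent inside \<open>Z\<close>, and counting dimensions gives the inequality.\<close>

lemma cells_meet_imp_le:
  fixes Psi :: "('n::{finite,linorder}) rmat"
  assumes s: "bij s" "bij s'" and c: "cell mu s Psi" and c': "cell (\<lambda>p. - mu p) s' Psi"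
  shows "card {i. i \<le> p \<and> c < mu (s i)} \<le> card {i. i \<le> p \<and> c < mu (s' i)}"
proof -
  obtain l h where lh: "unilow l" "btri mu h" "invertible h" "Psi = l ** Pm s ** h"
    using c unfolding cell_def by blast
  obtain l' h' where lh': "unilow l'" "btri (\<lambda>p. - mu p) h'" "invertible h'" "Psi = l' ** Pm s' ** h'"
    using c' unfolding cell_def by blast
  define M1 where "M1 = Pm s ** h"
  define M2 where "M2 = Pm s' ** h'"
  define C where "C = matrix_inv l ** l'"
  have inv: "invertible M1" "invertible M2"
    unfolding M1_def M2_def by (intro invertible_mult invertible_Pm s lh lh')+
  have "l ** M1 = l' ** M2" using lh(4) lh'(4) by (simp add: M1_def M2_def matrix_mul_assoc)
  then have CM: "M1 = C ** M2" unfolding C_def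
    by (metis lh(1) matrix_inv_left matrix_mul_assoc matrix_mul_lid unilow_invertible)
  have Clow: "btri low C" unfolding C_def
    using lh(1) lh'(1) unilow_inv by (auto simp: unilow_def intro!: btri_mult)
  define A where "A = {i. i \<le> p \<and> c < mu (s i)}"
  define B where "B = {i. i \<le> p \<and> \<not> c < mu (s' i)}"
  define S where "S = span ((\<lambda>i. M1 $ i) ` A)"
  define T where "T = span ((\<lambda>i. M2 $ i) ` B)"
  define Z where "Z = span ((\<lambda>i. M2 $ i) ` {i. i \<le> p})"
  have "S \<subseteq> {x. \<forall>q. mu q \<le> c \<longrightarrow> x $ q = 0}"
    unfolding S_def
  proof (rule span_minimal)
    have "h $ s i $ q = 0" if "c < mu (s i)" "mu q \<le> c" for i q using that btriD[OF lh(2), of q "s i"] by simp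
    then show "(\<lambda>i. M1 $ i) ` A \<subseteq> {x. \<forall>q. mu q \<le> c \<longrightarrow> x $ q = 0}"
      by (auto simp: A_def M1_def Pm_mult_nth)
  qed (auto simp: subspace_def)
  moreover have "T \<subseteq> {x. \<forall>q. c < mu q \<longrightarrow> x $ q = 0}"
    unfolding T_def
  proof (rule span_minimal)
    have "h' $ s' i $ q = 0" if "\<not> c < mu (s' i)" "c < mu q" for i q using that btriD[OF lh'(2), of q "s' i"] by simp
    then show "(\<lambda>i. M2 $ i) ` B \<subseteq> {x. \<forall>q. c < mu q \<longrightarrow> x $ q = 0}"
      by (auto simp: B_def M2_def Pm_mult_nth)
  qed (auto simp: subspace_def)
  ultimately have int: "S \<inter> T \<subseteq> {0}" by (force simp: vec_eq_iff not_le[symmetric])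
  have "S \<subseteq> Z" unfolding S_def
  proof (rule span_minimal)
    show "(\<lambda>i. M1 $ i) ` A \<subseteq> Z"
    proof clarify
      fix i assume i: "i \<in> A"
      have "M1 $ i = (\<Sum>r\<in>UNIV. C $ i $ r *\<^sub>R M2 $ r)" unfolding CM
        by (simp add: vec_eq_iff matrix_mult_nth)
      also have "\<dots> \<in> Z"
      proof (rule subspace_sum)
        fix r
        show "C $ i $ r *\<^sub>R M2 $ r \<in> Z"
        proof (cases "r \<le> p")
          case True
          then show ?thesis unfolding Z_def by (intro span_scale span_base) auto
        next
          case False
          then have "i < r" using i by (auto simp: A_def)
          then have "C $ i $ r = 0" using Clow by (simp add: btri_low_iff)
          then show ?thesis by (simp add: Z_def span_zero)
        qed
      qed (simp add: Z_def)
      finally show "M1 $ i \<in> Z" .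
    qed
  qed (simp add: Z_def)
  moreover have "T \<subseteq> Z" unfolding T_def Z_def by (intro span_mono) (auto simp: B_def)
  ultimately have sum: "{x + y |x y. x \<in> S \<and> y \<in> T} \<subseteq> Z"
    unfolding Z_def by (auto intro: span_add)
  have "dim {x + y |x y. x \<in> S \<and> y \<in> T} + dim (S \<inter> T) = dim S + dim T"
    by (rule dim_sums_Int) (auto simp: S_def T_def)
  moreover have "dim (S \<inter> T) = 0" using int dim_eq_0 by blast
  moreover have "dim {x + y |x y. x \<in> S \<and> y \<in> T} \<le> dim Z" by (rule dim_subset[OF sum])
  moreover have "dim S = card A" "dim T = card B" "dim Z = card {i. i \<le> p}"
    unfolding S_def T_def Z_def by (simp_all add: dim_rows_invertible inv)
  moreover have "card {i. i \<le> p} = card B + card {i. i \<le> p \<and> c < mu (s' i)}"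
    unfolding B_def by (subst card_Un_disjoint[symmetric]) (auto intro: arg_cong[where f=card])
  ultimately show ?thesis by (simp add: A_def)
qed

text \<open>Inverse transposition is multiplicative and fixes both \<open>Psi\<close> and
  \<open>Pm s\<close>, so it acts on the outer factors alone.\<close>

lemma orthogonal_inverse_transpose:
  fixes Psi a b :: "'n::finite rmat"
  assumes orth: "orthogonal_matrix Psi" and s: "bij s"
    and eq: "Psi = a ** Pm s ** b" and inv: "invertible a" "invertible b"
  shows "Psi = transpose (matrix_inv a) ** Pm s ** transpose (matrix_inv b)"
proof -
  have "matrix_inv Psi = matrix_inv b ** Pm (inv s) ** matrix_inv a"
  proof (rule matrix_inv_eqI)
    have "Psi ** (matrix_inv b ** Pm (inv s) ** matrix_inv a)
        = a ** (Pm s ** (b ** matrix_inv b) ** Pm (inv s)) ** matrix_inv a"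
      by (simp add: eq matrix_mul_assoc)
    also have "\<dots> = mat 1" unfolding matrix_inv_right[OF inv(2)] matrix_mul_rid Pm_inv_right[OF s]
      by (simp add: matrix_inv_right inv)
    finally show "Psi ** (matrix_inv b ** Pm (inv s) ** matrix_inv a) = mat 1" .
  qed
  then have "transpose Psi = matrix_inv b ** Pm (inv s) ** matrix_inv a"
    by (simp add: matrix_inv_orthogonal orth)
  then have "Psi = transpose (matrix_inv b ** Pm (inv s) ** matrix_inv a)"
    by (metis transpose_transpose)
  then show ?thesis
    by (simp add: matrix_transpose_mul transpose_Pm bij_imp_bij_inv s inv_inv_eq matrix_mul_assoc)
qed

text \<open>Inverse transposition turns lower into upper on the left and \<open>- f\<close> into
  \<open>f\<close> on the right. In this form the future cell is an orbit of upper unipotent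
  matrices in the same quotient in which the past cell is an orbit of lower ones.\<close>

lemma cell_opposite_iff:
  fixes Psi :: "('n::{finite,linorder}) rmat"
  assumes orth: "orthogonal_matrix Psi" and s: "bij s"
  shows "cell (\<lambda>p. - f p) s Psi \<longleftrightarrow>
    (\<exists>u h. unilow (transpose u) \<and> btri f h \<and> invertible h \<and> Psi = u ** Pm s ** h)"
proof
  assume "cell (\<lambda>p. - f p) s Psi"
  then obtain l h where lh: "unilow l" "btri (\<lambda>p. - f p) h" "invertible h" "Psi = l ** Pm s ** h"
    unfolding cell_def by blast
  have "Psi = transpose (matrix_inv l) ** Pm s ** transpose (matrix_inv h)"
    by (rule orthogonal_inverse_transpose[OF orth s lh(4) unilow_invertible[OF lh(1)] lh(3)])
  moreover have "unilow (transpose (transpose (matrix_inv l)))" using unilow_inv[OF lh(1)] by simp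
  moreover have "btri f (transpose (matrix_inv h))"
    unfolding btri_transpose by (rule btri_matrix_inv[OF lh(2,3)])
  moreover have "invertible (transpose (matrix_inv h))"
    by (intro transpose_invertible invertible_matrix_inv lh)
  ultimately show "\<exists>u h. unilow (transpose u) \<and> btri f h \<and> invertible h \<and> Psi = u ** Pm s ** h" by blast
next
  assume "\<exists>u h. unilow (transpose u) \<and> btri f h \<and> invertible h \<and> Psi = u ** Pm s ** h"
  then obtain u h where uh: "unilow (transpose u)" "btri f h" "invertible h" "Psi = u ** Pm s ** h"
    by blast
  have ui: "invertible u" using transpose_invertible[OF unilow_invertible[OF uh(1)]] by simp
  have "Psi = transpose (matrix_inv u) ** Pm s ** transpose (matrix_inv h)"
    by (rule orthogonal_inverse_transpose[OF orth s uh(4) ui uh(3)])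
  moreover have "unilow (transpose (matrix_inv u))"
  proof -
    have "transpose u ** transpose (matrix_inv u) = mat 1"
      by (simp add: matrix_transpose_mul[symmetric] matrix_inv_left ui)
    then show ?thesis using unilow_inv[OF uh(1)] matrix_inv_eqI by metis
  qed
  moreover have "btri (\<lambda>p. - f p) (transpose (matrix_inv h))"
    unfolding btri_transpose using btri_matrix_inv[OF uh(2,3)] by simp
  moreover have "invertible (transpose (matrix_inv h))"
    by (intro transpose_invertible invertible_matrix_inv uh)
  ultimately show "cell (\<lambda>p. - f p) s Psi" unfolding cell_def by blast
qed

section \<open>Bruhat order on words\<close>

text \<open>Equal letters contribute nothing: this is the length of the shortest permutation with
  the given word, and the dimension of its upper cell.\<close>

definition invs :: "('n::{finite,linorder} \<Rightarrow> nat) \<Rightarrow> nat" where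
  "invs a = card {(p, q). p < q \<and> a q < a p}"

lemma SnI_range: "a \<in> SnI k I \<Longrightarrow> a p \<in> {1..k}"
  unfolding SnI_def by (metis (mono_tags, lifting) mem_Collect_eq rangeI)

lemma card_as_sum: "card {m::'n::finite. P m} = (\<Sum>m\<in>UNIV. if P m then 1 else 0)"
  by (simp add: sum.If_cases)

lemma sum_two_points:
  fixes f :: "'n::finite \<Rightarrow> nat"
  assumes "i \<noteq> j" shows "sum f UNIV = f i + f j + sum f (UNIV - {i, j})"
proof -
  have "sum f UNIV = sum f ({i, j} \<union> (UNIV - {i, j}))" by (rule arg_cong[where f="sum f"]) auto
  also have "\<dots> = sum f {i, j} + sum f (UNIV - {i, j})" by (rule sum.union_disjoint) auto
  finally show ?thesis using assms by simp
qed

lemma rk_swap: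
  fixes a :: "'n::{finite,linorder} \<Rightarrow> nat"
  assumes ij: "i < j" "a i < a j"
  shows "rk (a(i := a j, j := a i)) p q = rk a p q + (if i \<le> p \<and> p < j \<and> a i < q \<and> q \<le> a j then 1 else 0)"
proof -
  define F where "F c m = (if m \<le> p \<and> q \<le> c m then 1 else 0 :: nat)" for c :: "'n \<Rightarrow> nat" and m
  define c where "c = a(i := a j, j := a i)"
  have rk: "rk c p q = sum (F c) UNIV" for c unfolding rk_def F_def by (rule card_as_sum)
  have "sum (F c) (UNIV - {i, j}) = sum (F a) (UNIV - {i, j})"
    by (intro sum.cong) (auto simp: F_def c_def)
  moreover have "F c i + F c j = F a i + F a j + (if i \<le> p \<and> p < j \<and> a i < q \<and> q \<le> a j then 1 else 0)"
    using ij by (auto simp: F_def c_def)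
  ultimately show ?thesis
    unfolding c_def[symmetric] rk using ij by (simp add: sum_two_points[of i j])
qed

lemma invs_as_sum: "invs a = (\<Sum>p\<in>UNIV. \<Sum>q\<in>UNIV. if p < q \<and> a q < a p then 1 else 0)"
proof -
  have "invs a = (\<Sum>x\<in>UNIV. if fst x < snd x \<and> a (snd x) < a (fst x) then 1 else 0)"
    unfolding invs_def case_prod_beta by (rule card_as_sum)
  also have "\<dots> = (\<Sum>p\<in>UNIV. \<Sum>q\<in>UNIV. if p < q \<and> a q < a p then 1 else 0)"
    unfolding UNIV_Times_UNIV[symmetric] sum.cartesian_product by (simp add: case_prod_beta)
  finally show ?thesis .
qed

text \<open>A position outside the interval from \<open>i\<close> to \<open>j\<close> sees the same
  two letters in the same order relative to itself. A position inside carries a letter outside the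
  range from \<open>a i\<close> to \<open>a j\<close>, so its total contribution is unchanged. Only
  the pair \<open>(i, j)\<close> itself becomes an inversion.\<close>

lemma invs_swap:
  fixes a :: "'n::{finite,linorder} \<Rightarrow> nat"
  assumes ij: "i < j" "a i < a j"
    and between: "\<And>m. i < m \<Longrightarrow> m < j \<Longrightarrow> a m < a i \<or> a j < a m"
  shows "invs (a(i := a j, j := a i)) = invs a + 1"
proof -
  define G where "G c p q = (if p < q \<and> c q < c p then 1 else 0 :: nat)" for c :: "'n \<Rightarrow> nat" and p q
  define U where "U = UNIV - {i, j}"
  define c where "c = a(i := a j, j := a i)"
  have inv: "invs c = sum (\<lambda>p. sum (G c p) U) U + sum (\<lambda>m. G c m i + G c m j + G c i m + G c j m) U
      + (G c i i + G c i j + G c j i + G c j j)" for c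
  proof -
    have "invs c = sum (\<lambda>p. sum (G c p) UNIV) UNIV" by (simp add: invs_as_sum G_def)
    also have "\<dots> = sum (G c i) UNIV + sum (G c j) UNIV + sum (\<lambda>p. sum (G c p) UNIV) U"
      unfolding U_def using ij by (intro sum_two_points) auto
    also have "sum (\<lambda>p. sum (G c p) UNIV) U = sum (\<lambda>p. G c p i + G c p j + sum (G c p) U) U"
      unfolding U_def using ij by (intro sum.cong sum_two_points) auto
    finally show ?thesis
      using ij sum_two_points[of i j "G c i"] sum_two_points[of i j "G c j"]
      by (simp add: U_def[symmetric] sum.distrib)
  qed
  have "sum (\<lambda>p. sum (G c p) U) U = sum (\<lambda>p. sum (G a p) U) U"
    by (intro sum.cong) (auto simp: G_def c_def U_def)
  moreover have "sum (\<lambda>m. G c m i + G c m j + G c i m + G c j m) U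
      = sum (\<lambda>m. G a m i + G a m j + G a i m + G a j m) U"
  proof (intro sum.cong refl)
    fix m assume m: "m \<in> U"
    consider "m < i" | "i < m" "m < j" | "j < m" using m by (auto simp: U_def neq_iff)
    then show "G c m i + G c m j + G c i m + G c j m = G a m i + G a m j + G a i m + G a j m"
    proof cases
      case 1 then show ?thesis using ij m by (auto simp: G_def c_def U_def)
    next
      case 2 then show ?thesis using ij m between[of m] by (auto simp: G_def c_def U_def)
    next
      case 3 then show ?thesis using ij m by (auto simp: G_def c_def U_def)
    qed
  qed
  moreover have "G c i i + G c i j + G c j i + G c j j = G a i i + G a i j + G a j i + G a j j + 1"
    using ij by (auto simp: G_def c_def)
  ultimately show ?thesis unfolding c_def[symmetric] by (simp add: inv)
qed

lemma SnI_swap: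
  assumes a: "a \<in> SnI k I" and ij: "i \<noteq> j"
  shows "a(i := a j, j := a i) \<in> SnI k I"
proof -
  define t where "t = (\<lambda>m. if m = i then j else if m = j then i else m)"
  have tt: "t (t m) = m" for m using ij by (auto simp: t_def)
  have inj: "inj t" by (metis injI tt)
  have surj: "surj t" by (metis surjI tt)
  have c: "a(i := a j, j := a i) = a \<circ> t" using ij by (auto simp: t_def fun_eq_iff)
  have "range (a \<circ> t) = range a" using surj by (metis image_comp)
  moreover have "card ((a \<circ> t) -` {v}) = card (a -` {v})" for v
  proof -
    have "(a \<circ> t) -` {v} = t ` (a -` {v})"
    proof (intro equalityI subsetI)
      fix x assume "x \<in> (a \<circ> t) -` {v}"
      then have "t x \<in> a -` {v}" by simp
      then show "x \<in> t ` (a -` {v})" using tt[of x] by (metis imageI)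
    qed (auto simp: tt)
    then show ?thesis using card_image[OF inj_on_subset[OF inj]] by simp
  qed
  ultimately show ?thesis using a unfolding c SnI_def by simp
qed

lemma SnI_card_ge:
  assumes "a \<in> SnI k I" shows "card {m. q \<le> a m} = (\<Sum>v\<in>{q..k} \<inter> {1..k}. I v)"
proof -
  have "{m. q \<le> a m} = (\<Union>v\<in>{q..k} \<inter> {1..k}. a -` {v})" using SnI_range[OF assms] by auto
  also have "card \<dots> = (\<Sum>v\<in>{q..k} \<inter> {1..k}. card (a -` {v}))"
    by (rule card_UN_disjoint) auto
  also have "\<dots> = (\<Sum>v\<in>{q..k} \<inter> {1..k}. I v)" using assms by (intro sum.cong) (auto simp: SnI_def)
  finally show ?thesis .
qed

lemma first_difference:
  assumes "a \<noteq> (b :: 'n::{finite,linorder} \<Rightarrow> nat)"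
  obtains i where "a i \<noteq> b i" "\<And>m. m < i \<Longrightarrow> a m = b m"
proof -
  have "\<exists>i. a i \<noteq> b i" using assms by auto
  then have "Min {i. a i \<noteq> b i} \<in> {i. a i \<noteq> b i}" by (intro Min_in) auto
  moreover have "a m = b m" if "m < Min {i. a i \<noteq> b i}" for m
    using Min_le[of "{i. a i \<noteq> b i}" m] that by (meson finite leD mem_Collect_eq)
  ultimately show ?thesis using that by blast
qed

text \<open>If the letter dropped at \<open>i\<close>, the count of letters at least
  \<open>a i\<close> up to position \<open>i\<close> would be larger for \<open>a\<close> by exactly
  the letter at \<open>i\<close>.\<close>

lemma first_difference_less:
  assumes a: "a \<in> SnI k I" and le: "bruhat_le k a b"
    and i: "a i \<noteq> b i" "\<And>m. m < i \<Longrightarrow> a m = b m"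
  shows "a i < b i"
proof (rule ccontr)
  assume "\<not> a i < b i"
  then have less: "b i < a i" using i(1) by simp
  have "{m. m \<le> i \<and> a i \<le> a m} = insert i {m. m < i \<and> a i \<le> a m}" by auto
  then have "rk a i (a i) = Suc (card {m. m < i \<and> a i \<le> a m})" by (simp add: rk_def)
  moreover have "{m. m \<le> i \<and> a i \<le> b m} = {m. m < i \<and> a i \<le> a m}"
    using less i(2) by (auto simp: le_less)
  then have "rk b i (a i) = card {m. m < i \<and> a i \<le> a m}" by (simp add: rk_def)
  moreover have "rk a i (a i) \<le> rk b i (a i)"
    using le SnI_range[OF a] by (auto simp: bruhat_le_def)
  ultimately show False by simp
qed

lemma bruhat_le_antisym:
  assumes "a \<in> SnI k I" "b \<in> SnI k I" "bruhat_le k a b" "bruhat_le k b a"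
  shows "a = b"
proof (rule ccontr)
  assume "a \<noteq> b"
  then obtain i where i: "a i \<noteq> b i" "\<And>m. m < i \<Longrightarrow> a m = b m" by (metis first_difference)
  have "a i < b i" using first_difference_less[of a k I b i] assms i by blast
  moreover have "b i < a i" using first_difference_less[of b k I a i] assms i by metis
  ultimately show False by simp
qed

text \<open>The swap is chosen as in the classical proof of the tableau criterion: start at the first
  position where \<open>a\<close> and \<open>b\<close> differ, swap with the next position carrying a value in
  \<open>(a i, b i]\<close>, and let \<open>i'\<close> be the last occurrence of \<open>a i\<close> before it, so that no value in
  between creates further inversions.\<close>
lemma bruhat_cover_below:
  fixes a b :: "'n::{finite,linorder} \<Rightarrow> nat"
  assumes a: "a \<in> SnI k I" and b: "b \<in> SnI k I" and le: "bruhat_le k a b" and ne: "a \<noteq> b"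
  obtains i j where "i < j" "a i < a j" "invs (a(i := a j, j := a i)) = invs a + 1"
    "bruhat_less k a (a(i := a j, j := a i))" "bruhat_le k (a(i := a j, j := a i)) b"
proof -
  obtain i where i: "a i \<noteq> b i" "\<And>m. m < i \<Longrightarrow> a m = b m" using first_difference[OF ne] by metis
  have aib: "a i < b i" by (rule first_difference_less[OF a le i])
  \<comment> \<open>Before \<open>i\<close> the words agree, so the rank inequalities pass to the
    counts that start at \<open>i\<close>.\<close>
  define H where "H c p q = card {m. i \<le> m \<and> m \<le> p \<and> q \<le> c m}" for c :: "'n \<Rightarrow> nat" and p q
  have split: "rk c p q = card {m. m < i \<and> q \<le> c m} + H c p q" if "i \<le> p" for c :: "'n \<Rightarrow> nat" and p q
  proof -
    have "{j. j \<le> p \<and> q \<le> c j} = {m. m < i \<and> q \<le> c m} \<union> {m. i \<le> m \<and> m \<le> p \<and> q \<le> c m}"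
      using that by auto
    then show ?thesis unfolding rk_def H_def by (simp add: card_Un_disjoint disjoint_iff not_le)
  qed
  have same: "{m. m < i \<and> q \<le> a m} = {m. m < i \<and> q \<le> b m}" for q using i(2) by auto
  have Hle: "H a p q \<le> H b p q" if "i \<le> p" "1 \<le> q" for p q
  proof (cases "q \<le> k")
    case True
    then have "rk a p q \<le> rk b p q" using le that by (auto simp: bruhat_le_def)
    then show ?thesis using split[OF that(1), of a q] split[OF that(1), of b q] same[of q] by simp
  next
    case False
    then have "\<not> q \<le> a m" for m using SnI_range[OF a, of m] by simp
    then show ?thesis by (simp add: H_def)
  qed
  have Hb: "H b p (b i + 1) < H b p q" if "i \<le> p" "q \<le> b i" for p q
  proof -
    have "i \<in> {m. i \<le> m \<and> m \<le> p \<and> q \<le> b m} - {m. i \<le> m \<and> m \<le> p \<and> b i + 1 \<le> b m}"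
      using that by auto
    moreover have "{m. i \<le> m \<and> m \<le> p \<and> b i + 1 \<le> b m} \<subseteq> {m. i \<le> m \<and> m \<le> p \<and> q \<le> b m}"
      using that by auto
    ultimately show ?thesis unfolding H_def by (intro psubset_card_mono) (auto simp only: finite)
  qed
  \<comment> \<open>Raising the threshold from \<open>q\<close> to \<open>b i + 1\<close> loses no
    letter of \<open>a\<close>, as none lies in the gap, but loses at least the letter
    \<open>b i\<close> of \<open>b\<close> at position \<open>i\<close>.\<close>
  have strict: "H a p q < H b p q"
    if p: "i \<le> p" and q: "a i < q" "q \<le> b i" and none: "\<And>m. i \<le> m \<Longrightarrow> m \<le> p \<Longrightarrow> \<not> (a i < a m \<and> a m \<le> b i)" for p q
  proof -
    have "{m. i \<le> m \<and> m \<le> p \<and> q \<le> a m} = {m. i \<le> m \<and> m \<le> p \<and> b i + 1 \<le> a m}"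
      using q none by (force simp: not_le)
    then have "H a p q = H a p (b i + 1)" by (simp add: H_def)
    also have "\<dots> \<le> H b p (b i + 1)" by (rule Hle[OF p]) simp
    also have "\<dots> < H b p q" by (rule Hb[OF p q(2)])
    finally show ?thesis .
  qed
  define J where "J = {m. i < m \<and> a i < a m \<and> a m \<le> b i}"
  \<comment> \<open>Otherwise \<open>strict\<close> would apply at the last position, where the
    ranks agree because both words have the same content.\<close>
  have "J \<noteq> {}"
  proof
    assume J: "J = {}"
    define p where "p = Max (UNIV :: 'n set)"
    have p: "m \<le> p" for m unfolding p_def by (rule Max_ge) auto
    have "\<not> (a i < a m \<and> a m \<le> b i)" if "i \<le> m" for m
      using J that by (cases "m = i") (auto simp: J_def)
    then have "H a p (a i + 1) < H b p (a i + 1)" using aib p by (intro strict) auto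
    then have "rk a p (a i + 1) < rk b p (a i + 1)"
      using split[OF p, of a "a i + 1"] split[OF p, of b "a i + 1"] same[of "a i + 1"] by simp
    moreover have "rk a p (a i + 1) = rk b p (a i + 1)"
      using SnI_card_ge[OF a] SnI_card_ge[OF b] p by (simp add: rk_def)
    ultimately show False by simp
  qed
  define j where "j = Min J"
  have jJ: "j \<in> J" unfolding j_def using \<open>J \<noteq> {}\<close> by (intro Min_in) auto
  have jmin: "\<not> (a i < a m \<and> a m \<le> b i)" if "i \<le> m" "m < j" for m
  proof
    assume *: "a i < a m \<and> a m \<le> b i"
    then have "m \<in> J" using that(1) by (cases "m = i") (auto simp: J_def)
    then show False using that(2) Min_le[of J m] by (simp add: j_def not_le[symmetric])
  qed
  define Q where "Q = {m. i \<le> m \<and> m < j \<and> a m = a i}"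
  define i' where "i' = Max Q"
  have "i \<in> Q" using jJ by (auto simp: Q_def J_def)
  then have i'Q: "i' \<in> Q" unfolding i'_def by (intro Max_in) auto
  have i'max: "a m \<noteq> a i" if "i' < m" "m < j" for m
  proof
    assume "a m = a i"
    then have "m \<in> Q" using that i'Q by (auto simp: Q_def)
    then show False using that(1) Max_ge[of Q m] by (simp add: i'_def not_le[symmetric])
  qed
  have ij: "i' < j" "a i' < a j" and ai': "a i' = a i" "i \<le> i'" using i'Q jJ by (auto simp: Q_def J_def)
  define c where "c = a(i' := a j, j := a i')"
  have rkc: "rk c p q = rk a p q + (if i' \<le> p \<and> p < j \<and> a i' < q \<and> q \<le> a j then 1 else 0)" for p q
    unfolding c_def by (rule rk_swap[OF ij])
  have "invs c = invs a + 1"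
    unfolding c_def
  proof (rule invs_swap[OF ij])
    fix m assume m: "i' < m" "m < j"
    then have "\<not> (a i < a m \<and> a m \<le> b i)" "a m \<noteq> a i" using jmin[of m] i'max ai'(2) by auto
    then show "a m < a i' \<or> a j < a m" using jJ ai' by (auto simp: J_def)
  qed
  moreover have "c \<noteq> a" unfolding c_def using ij by (metis fun_upd_same less_irrefl)
  then have "bruhat_less k a c" by (auto simp: bruhat_less_def bruhat_le_def rkc)
  moreover have "bruhat_le k c b"
    unfolding bruhat_le_def
  proof (intro allI ballI)
    fix p q assume q: "q \<in> {1..k}"
    show "rk c p q \<le> rk b p q"
    proof (cases "i' \<le> p \<and> p < j \<and> a i' < q \<and> q \<le> a j")
      case True
      then have ip: "i \<le> p" using ai'(2) by auto
      have "H a p q < H b p q"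
        using True ip jJ ai' by (intro strict jmin) (auto simp: J_def)
      then show ?thesis using split[OF ip, of a q] split[OF ip, of b q] same[of q] rkc[of p q] True by simp
    next
      case False
      then have "rk c p q = rk a p q" by (auto simp: rkc)
      then show ?thesis using le q by (simp add: bruhat_le_def)
    qed
  qed
  ultimately show ?thesis using that[of i' j] ij unfolding c_def by blast
qed

section \<open>Saturated chains and the grading by inversions\<close>

lemma invs_bound: "invs (a :: 'n::{finite,linorder} \<Rightarrow> nat) \<le> card (UNIV :: ('n \<times> 'n) set)"
  unfolding invs_def by (rule card_mono) auto

text \<open>The induction climbs from \<open>a\<close> to \<open>b\<close> by swaps of one inversion
  each. The measure is the gap to the number of all pairs, since the comparison of
  \<open>invs a\<close> with \<open>invs b\<close> is itself a consequence of this
  induction.\<close>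

lemma bruhat_chain_induct [consumes 3, case_names base step]:
  fixes a b :: "'n::{finite,linorder} \<Rightarrow> nat"
  assumes a: "a \<in> SnI k I" and b: "b \<in> SnI k I" and le: "bruhat_le k a b"
    and base: "P b"
    and step: "\<And>a i j. a \<in> SnI k I \<Longrightarrow> i < j \<Longrightarrow> a i < a j \<Longrightarrow>
      invs (a(i := a j, j := a i)) = invs a + 1 \<Longrightarrow> a(i := a j, j := a i) \<in> SnI k I \<Longrightarrow>
      bruhat_less k a (a(i := a j, j := a i)) \<Longrightarrow> P (a(i := a j, j := a i)) \<Longrightarrow> P a"
  shows "P a"
  using a le
proof (induction "card (UNIV :: ('n \<times> 'n) set) - invs a" arbitrary: a rule: less_induct)
  case less
  show ?case
  proof (cases "a = b")
    case True then show ?thesis using base by simp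
  next
    case False
    obtain i j where ij: "i < j" "a i < a j" "invs (a(i := a j, j := a i)) = invs a + 1"
      "bruhat_less k a (a(i := a j, j := a i))" "bruhat_le k (a(i := a j, j := a i)) b"
      using bruhat_cover_below[OF less.prems(1) b less.prems(2) False] by metis
    have c: "a(i := a j, j := a i) \<in> SnI k I" using SnI_swap[OF less.prems(1)] ij(1) by simp
    have "P (a(i := a j, j := a i))"
    proof (rule less.hyps[OF _ c ij(5)])
      show "card (UNIV :: ('n \<times> 'n) set) - invs (a(i := a j, j := a i)) < card (UNIV :: ('n \<times> 'n) set) - invs a"
        using invs_bound[of "a(i := a j, j := a i)"] ij(3) by linarith
    qed
    then show ?thesis by (rule step[OF less.prems(1) ij(1-3) c ij(4)])
  qed
qed

lemma bruhat_less_invs: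
  assumes "a \<in> SnI k I" "b \<in> SnI k I" "bruhat_less k a b"
  shows "invs a < invs b"
proof -
  have "bruhat_le k a b" using assms(3) by (simp add: bruhat_less_def)
  with assms(1,2) have "a = b \<or> invs a < invs b"
  proof (induction rule: bruhat_chain_induct)
    case (step a i j)
    then have "invs (a(i := a j, j := a i)) \<le> invs b" by (metis less_imp_le order_refl)
    then show ?case using step by simp
  qed simp
  then show ?thesis using assms(3) by (simp add: bruhat_less_def)
qed

text \<open>Between \<open>a\<close> and \<open>b\<close> there is always a swap of \<open>a\<close>
  with one more inversion; on an edge it can only be \<open>b\<close>.\<close>

lemma hasse_edge_invs:
  assumes "hasse_edge k I a b" shows "invs b = invs a + 1"
proof -
  have ab: "a \<in> SnI k I" "b \<in> SnI k I" "bruhat_le k a b" "a \<noteq> b"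
    and none: "\<And>c. c \<in> SnI k I \<Longrightarrow> bruhat_less k a c \<Longrightarrow> \<not> bruhat_less k c b"
    using assms by (auto simp: hasse_edge_def bruhat_less_def)
  obtain i j where ij: "i < j" "invs (a(i := a j, j := a i)) = invs a + 1"
    "bruhat_less k a (a(i := a j, j := a i))" "bruhat_le k (a(i := a j, j := a i)) b"
    using bruhat_cover_below[OF ab] by metis
  have "a(i := a j, j := a i) \<in> SnI k I" using SnI_swap[OF ab(1)] ij(1) by simp
  then have "a(i := a j, j := a i) = b" using none[OF _ ij(3)] ij(4) by (auto simp: bruhat_less_def)
  then show ?thesis using ij(2) by simp
qed

lemma hasse_path_invs: "hasse_path k I xs \<Longrightarrow> invs (last xs) = invs (hd xs) + (length xs - 1)"
proof (induction xs)
  case (Cons x xs)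
  show ?case
  proof (cases xs)
    case (Cons y ys)
    have edge: "hasse_edge k I x y" and path: "hasse_path k I xs"
      using Cons.prems Cons unfolding hasse_path_def by (force, force)
    show ?thesis using Cons.IH[OF path] hasse_edge_invs[OF edge] Cons by simp
  qed simp
qed (simp add: hasse_path_def)

text \<open>Every swap in the chain is an edge: an element strictly between would have an inversion
  number strictly between two consecutive integers.\<close>

lemma hasse_path_exists:
  assumes "a \<in> SnI k I" "b \<in> SnI k I" "bruhat_le k a b"
  shows "\<exists>xs. hasse_path k I xs \<and> hd xs = a \<and> last xs = b"
  using assms
proof (induction rule: bruhat_chain_induct)
  case base
  show ?case using assms(2) by (intro exI[of _ "[b]"]) (auto simp: hasse_path_def)
next
  case (step a i j)
  let ?c = "a(i := a j, j := a i)"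
  obtain xs where xs: "hasse_path k I xs" "hd xs = ?c" "last xs = b" using step by blast
  have edge: "hasse_edge k I a ?c"
    unfolding hasse_edge_def
  proof (intro conjI notI)
    assume "\<exists>c\<in>SnI k I. bruhat_less k a c \<and> bruhat_less k c ?c"
    then obtain c where c: "c \<in> SnI k I" "bruhat_less k a c" "bruhat_less k c ?c" by blast
    then have "invs a < invs c" "invs c < invs ?c" using bruhat_less_invs step by blast+
    then show False using step by simp
  qed (use step in auto)
  have ne: "xs \<noteq> []" using xs by (simp add: hasse_path_def)
  have "hasse_path k I (a # xs)"
    unfolding hasse_path_def
  proof (intro conjI allI impI)
    fix m assume m: "Suc m < length (a # xs)"
    show "hasse_edge k I ((a # xs) ! m) ((a # xs) ! Suc m)"
    proof (cases m)
      case 0 then show ?thesis using edge ne xs(2) by (simp add: hd_conv_nth)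
    next
      case (Suc m') then show ?thesis using m xs(1) by (simp add: hasse_path_def)
    qed
  qed (use xs step in \<open>auto simp: hasse_path_def\<close>)
  then show ?case using xs ne by (intro exI[of _ "a # xs"]) simp
qed

section \<open>The block function\<close>

lemma inj_pos: "inj (pos :: 'n::{finite,linorder} \<Rightarrow> nat)"
  by (metis injI less_irrefl linorder_neqE pos_less_iff)

lemma range_pos: "range (pos :: 'n::{finite,linorder} \<Rightarrow> nat) = {1..CARD('n)}"
proof (rule card_subset_eq)
  show "range (pos :: 'n \<Rightarrow> nat) \<subseteq> {1..CARD('n)}"
  proof clarify
    fix p :: 'n
    have "0 < pos p" unfolding pos_def by (subst card_gt_0_iff) auto
    moreover have "pos p \<le> CARD('n)" unfolding pos_def by (rule card_mono) auto
    ultimately show "pos p \<in> {1..CARD('n)}" by simp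
  qed
  show "card (range (pos :: 'n \<Rightarrow> nat)) = card {1..CARD('n)}" by (simp add: card_image inj_pos)
qed simp

context
  fixes k :: nat and I :: "nat \<Rightarrow> nat"
  assumes I_sum: "(\<Sum>j=1..k. I j) = CARD('n::{finite,linorder})"
begin

lemma std_block_le_iff: "std_block I (p::'n) \<le> j \<longleftrightarrow> pos p \<le> (\<Sum>l=1..j. I l)"
proof -
  have ex: "pos p \<le> (\<Sum>l=1..k. I l)" using I_sum range_pos by (metis atLeastAtMost_iff rangeI)
  have mono: "(\<Sum>l=1..i. I l) \<le> (\<Sum>l=1..j. I l)" if "i \<le> j" for i j using that by (intro sum_mono2) auto
  show ?thesis
  proof
    assume "std_block I p \<le> j"
    moreover have "pos p \<le> (\<Sum>l=1..std_block I p. I l)" unfolding std_block_def by (rule LeastI[of "\<lambda>j. pos p \<le> (\<Sum>l=1..j. I l)", OF ex])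
    ultimately show "pos p \<le> (\<Sum>l=1..j. I l)" using mono order_trans by blast
  next
    assume "pos p \<le> (\<Sum>l=1..j. I l)"
    then show "std_block I p \<le> j" unfolding std_block_def by (rule Least_le)
  qed
qed

lemma std_block_mono: "(p::'n) \<le> q \<Longrightarrow> std_block I p \<le> std_block I q"
  using std_block_le_iff[of q "std_block I q"] std_block_le_iff[of p "std_block I q"] pos_le_iff[of p q]
  by simp

lemma std_block_range: "std_block I (p::'n) \<in> {1..k}"
proof -
  have p: "1 \<le> pos p" "pos p \<le> CARD('n)" using range_pos by (metis atLeastAtMost_iff rangeI)+
  then show ?thesis using std_block_le_iff[of p 0] std_block_le_iff[of p k] I_sum by auto
qed

lemma card_std_block:
  assumes "j \<in> {1..k}" shows "card ((std_block I :: 'n \<Rightarrow> nat) -` {j}) = I j"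
proof -
  define A where "A = (\<Sum>l=1..j - 1. I l)"
  have Aj: "(\<Sum>l=1..j. I l) = A + I j"
    using assms sum.atLeast_Suc_atMost[of 1] unfolding A_def by (cases j) auto
  have "(\<Sum>l=1..j. I l) \<le> CARD('n)" unfolding I_sum[symmetric] using assms by (intro sum_mono2) auto
  then have sub: "{A + 1..A + I j} \<subseteq> range (pos :: 'n \<Rightarrow> nat)" unfolding range_pos using Aj by auto
  have "std_block I p = j \<longleftrightarrow> pos p \<in> {A + 1..A + I j}" for p :: 'n
  proof -
    have "std_block I p = j \<longleftrightarrow> std_block I p \<le> j \<and> \<not> std_block I p \<le> j - 1" using assms by auto
    then show ?thesis unfolding std_block_le_iff Aj A_def[symmetric] by auto
  qed
  then have "(std_block I :: 'n \<Rightarrow> nat) -` {j} = pos -` {A + 1..A + I j}"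
    by (simp add: vimage_def)
  then show ?thesis using card_vimage_inj[OF inj_pos sub] by simp
qed

text \<open>The fibres of \<open>a\<close> have the sizes of the standard blocks, so bijections
  chosen fibre by fibre glue to a permutation. It lifts the word to a permutation matrix;
  \<open>cell_cong\<close> makes the choice harmless.\<close>

lemma SnI_permutation:
  fixes a :: "'n \<Rightarrow> nat"
  assumes a: "a \<in> SnI k I"
  obtains s :: "'n \<Rightarrow> 'n" where "bij s" "\<And>p. std_block I (s p) = a p"
proof -
  have "\<exists>f. bij_betw f (a -` {v}) ((std_block I :: 'n \<Rightarrow> nat) -` {v})" if "v \<in> {1..k}" for v
    by (rule finite_same_card_bij) (use a card_std_block[OF that] that in \<open>auto simp: SnI_def\<close>)
  then obtain F where F: "\<And>v. v \<in> {1..k} \<Longrightarrow> bij_betw (F v) (a -` {v}) ((std_block I :: 'n \<Rightarrow> nat) -` {v})"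
    by metis
  define s where "s p = F (a p) p" for p
  have sp: "std_block I (s p) = a p" for p
    using bij_betwE[OF F[OF SnI_range[OF a, of p]]] by (auto simp: s_def)
  have "inj s"
  proof (rule injI)
    fix p q assume "s p = s q"
    then have "a p = a q" "F (a p) p = F (a p) q" using sp by (metis, metis s_def sp)
    then show "p = q" using bij_betw_imp_inj_on[OF F[OF SnI_range[OF a, of p]]] by (auto simp: inj_on_def)
  qed
  then have "bij s" by (simp add: bij_def finite_UNIV_inj_surj)
  then show ?thesis using that sp by blast
qed

end

section \<open>Opposite cells meet\<close>

text \<open>The orbit is taken among all invertible matrices and under the full upper triangular
  group, so that explicit degenerations can be used for its closure. \<open>cells_meet\<close> later
  moves the diagonal to the right and restores orthogonality.\<close>

definition upcell :: "('n \<Rightarrow> real) \<Rightarrow> ('n \<Rightarrow> 'n) \<Rightarrow> ('n::{finite,linorder}) rmat set" where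
  "upcell f s = {u ** Pm s ** h | u h. btri up u \<and> invertible u \<and> btri f h \<and> invertible h}"

lemma upcell_mult:
  assumes "M \<in> upcell f s" "btri up u" "invertible u" "btri f h" "invertible h"
  shows "u ** M ** h \<in> upcell f s"
proof -
  obtain u' h' where *: "M = u' ** Pm s ** h'" "btri up u'" "invertible u'" "btri f h'" "invertible h'"
    using assms(1) unfolding upcell_def by blast
  have "u ** M ** h = (u ** u') ** Pm s ** (h' ** h)" by (simp add: *(1) matrix_mul_assoc)
  then show ?thesis unfolding upcell_def using * assms by (blast intro: btri_mult invertible_mult)
qed

text \<open>The closure is stable under the group actions on both sides, so a single point of an
  orbit brings the whole orbit with it.\<close>

lemma upcell_closure_subset:
  assumes "Pm s \<in> closure (upcell f s')" shows "upcell f s \<subseteq> closure (upcell f s')"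
proof
  fix M assume "M \<in> upcell f s"
  then obtain u h where *: "M = u ** Pm s ** h" "btri up u" "invertible u" "btri f h" "invertible h"
    unfolding upcell_def by blast
  obtain N where N: "\<And>n. N n \<in> upcell f s'" "N \<longlonglongrightarrow> Pm s"
    using assms unfolding closure_sequential by blast
  have "(\<lambda>n. u ** N n ** h) \<longlonglongrightarrow> M"
    unfolding *(1) by (intro tendsto_matrix_mult tendsto_const N)
  then show "M \<in> closure (upcell f s')"
    unfolding closure_sequential using upcell_mult[OF N(1) *(2-5)]
    by (intro exI[of _ "\<lambda>n. u ** N n ** h"]) auto
qed

text \<open>Row-wise form of the rank one identity
  \<open>[[1,0],[e,1]] = [[-1/e,1/e],[0,1]] ** [[0,1],[1,0]] ** [[e,1],[0,1]]\<close>.\<close>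
lemma Pm_in_closure_swap:
  fixes s :: "'n::{finite,linorder} \<Rightarrow> 'n"
  assumes s: "bij s" and ij: "i < j" "mu (s i) < mu (s j)"
    and mono: "\<And>p q. p \<le> q \<Longrightarrow> mu p \<le> mu q"
  shows "Pm s \<in> closure (upcell mu (s(i := s j, j := s i)))"
proof -
  define s' where "s' = s(i := s j, j := s i)"
  define M where "M e = (\<chi> p q. if q = s p then 1 else if p = j \<and> q = s i then e else 0)" for e :: real
  have inj: "s p = s q \<longleftrightarrow> p = q" for p q using s by (meson bij_is_inj inj_eq)
  have ab: "s i < s j" using ij(2) mono by (meson not_le)
  have mem: "M e \<in> upcell mu s'" if e: "e \<noteq> 0" for e
  proof -
    define u :: "'n rmat" where "u = (\<chi> p q. if p = i then (if q = i then - 1 / e else if q = j then 1 / e else 0)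
      else if p = q then 1 else 0)"
    define h :: "'n rmat" where "h = (\<chi> p q. if p = s i then (if q = s i then e else if q = s j then 1 else 0)
      else if p = q then 1 else 0)"
    have u: "btri up u" "invertible u"
    proof -
      show b: "btri up u" using ij(1) by (auto simp: btri_up_iff u_def)
      show "invertible u" by (rule btri_invertible[OF inj_up b]) (use e in \<open>auto simp: u_def\<close>)
    qed
    have h: "btri mu h" "invertible h"
    proof -
      show "btri mu h" using ij(2) by (auto simp: btri_def h_def)
      have b: "btri up h" using ab by (auto simp: btri_up_iff h_def)
      show "invertible h" by (rule btri_invertible[OF inj_up b]) (use e in \<open>auto simp: h_def\<close>)
    qed
    have "(u ** Pm s' ** h) $ p $ q = M e $ p $ q" for p q
    proof -
      have eq: "(u ** Pm s' ** h) $ p $ q = (\<Sum>r\<in>UNIV. u $ p $ r * h $ s' r $ q)"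
        unfolding matrix_mul_assoc[symmetric] matrix_mult_nth[of u] Pm_mult_nth ..
      show ?thesis
      proof (cases "p = i")
        case True
        have "(\<Sum>r\<in>UNIV. u $ p $ r * h $ s' r $ q) = (\<Sum>r\<in>{i, j}. u $ p $ r * h $ s' r $ q)"
          using True by (intro sum.mono_neutral_right) (auto simp: u_def)
        also have "\<dots> = u $ p $ i * h $ s' i $ q + u $ p $ j * h $ s' j $ q" using ij(1) by auto
        also have "\<dots> = M e $ p $ q" using True ij(1) e ab
          by (auto simp: u_def h_def s'_def M_def inj field_simps)
        finally show ?thesis using eq by simp
      next
        case False
        have "(\<Sum>r\<in>UNIV. u $ p $ r * h $ s' r $ q) = (\<Sum>r\<in>{p}. u $ p $ r * h $ s' r $ q)"
          using False by (intro sum.mono_neutral_right) (auto simp: u_def)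
        then show ?thesis using eq False ij(1) ab by (auto simp: u_def h_def s'_def M_def inj)
      qed
    qed
    then have "M e = u ** Pm s' ** h" by (simp add: vec_eq_iff)
    then show ?thesis unfolding upcell_def using u h by blast
  qed
  have "(\<lambda>n. M (inverse (real (Suc n)))) \<longlonglongrightarrow> Pm s"
  proof (rule tendsto_matrix_entries)
    fix p q
    show "(\<lambda>n. M (inverse (real (Suc n))) $ p $ q) \<longlonglongrightarrow> Pm s $ p $ q"
      using LIMSEQ_inverse_real_of_nat by (cases "p = j \<and> q = s i") (auto simp: M_def Pm_def)
  qed
  moreover have "M (inverse (real (Suc n))) \<in> upcell mu s'" for n by (rule mem) simp
  ultimately show ?thesis unfolding closure_sequential s'_def[symmetric]
    by (intro exI[of _ "\<lambda>n. M (inverse (real (Suc n)))"]) auto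
qed

lemma Pm_in_upcell_cong:
  assumes s: "bij s" "bij s'" and eq: "\<And>p. f (s p) = f (s' p)"
  shows "Pm s \<in> upcell f s'"
proof -
  define k where "k = Pm (inv s') ** Pm s"
  have k: "btri f k" "invertible k" unfolding k_def by (rule Pm_quotient[OF s eq])+
  have "Pm s = mat 1 ** Pm s' ** k" unfolding k_def by (simp add: matrix_mul_assoc Pm_inv_right s)
  moreover have "invertible (mat 1 :: 'a rmat)" by (metis invertible_def matrix_mul_lid)
  ultimately show ?thesis unfolding upcell_def using k btri_mat1 by blast
qed

lemma Pm_in_closure_of_bruhat_le:
  fixes psi omega :: "'n::{finite,linorder} \<Rightarrow> nat" and sb :: "'n \<Rightarrow> nat"
  assumes psi: "psi \<in> SnI k I" and omega: "omega \<in> SnI k I" and le: "bruhat_le k psi omega"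
    and lam: "\<And>a b. 1 \<le> a \<Longrightarrow> a < b \<Longrightarrow> b \<le> k \<Longrightarrow> lam a < lam b"
    and mono: "\<And>p q. p \<le> q \<Longrightarrow> lam (sb p) \<le> lam (sb q)"
    and s': "bij s'" "\<And>p. sb (s' p) = omega p"
    and s: "bij s" "\<And>p. sb (s p) = psi p"
  shows "Pm s \<in> closure (upcell (\<lambda>p. lam (sb p)) s')"
proof -
  define mu where "mu p = lam (sb p)" for p
  \<comment> \<open>All lifts are quantified at once, because the lift \<open>t\<close> of the
    swapped word is dictated by the current \<open>s\<close>.\<close>
  have "\<forall>s. bij s \<and> (\<forall>p. sb (s p) = psi p) \<longrightarrow> Pm s \<in> closure (upcell mu s')"
    using psi omega le
  proof (induction rule: bruhat_chain_induct)
    case base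
    show ?case
    proof (intro allI impI)
      fix s assume s: "bij s \<and> (\<forall>p. sb (s p) = omega p)"
      then have "Pm s \<in> upcell mu s'" using s' by (intro Pm_in_upcell_cong) (auto simp: mu_def)
      then show "Pm s \<in> closure (upcell mu s')" using closure_subset by blast
    qed
  next
    case (step a i j)
    show ?case
    proof (intro allI impI)
      fix s assume s: "bij s \<and> (\<forall>p. sb (s p) = a p)"
      define t where "t = s(i := s j, j := s i)"
      have "inj s" using s by (simp add: bij_is_inj)
      then have "inj t" unfolding t_def by (intro injI) (auto split: if_splits dest: injD)
      then have t: "bij t" by (simp add: bij_def finite_UNIV_inj_surj)
      have tb: "\<forall>p. sb (t p) = (a(i := a j, j := a i)) p" using s by (simp add: t_def)
      have "mu (s i) < mu (s j)"
        unfolding mu_def using s step(3) SnI_range[OF step(1)] by (intro lam) auto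
      then have "Pm s \<in> closure (upcell mu t)"
        unfolding t_def using s step(2) mono by (intro Pm_in_closure_swap) (auto simp: mu_def)
      moreover have "upcell mu t \<subseteq> closure (upcell mu s')"
        using step.IH t tb by (intro upcell_closure_subset) blast
      ultimately show "Pm s \<in> closure (upcell mu s')"
        using closure_minimal[OF _ closed_closure] by blast
    qed
  qed
  then show ?thesis using s unfolding mu_def by blast
qed

text \<open>Row \<open>i\<close> of \<open>v\<close> must agree with the unit vector in the columns
  up to \<open>i\<close> and annihilate the later columns of \<open>M\<close>; the auxiliary matrix
  collects these linear conditions. Its determinant is a trailing principal minor of
  \<open>M\<close>, so the hypothesis is an open condition that holds at the identity.\<close>

lemma UL_decomposition:
  fixes M :: "('n::{finite,linorder}) rmat"
  assumes T: "\<And>i. invertible (\<chi> p q. if q \<le> i then (if p = q then 1 else 0) else M $ p $ q)"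
  obtains v where "unilow (transpose v)" "btri low (v ** M)"
proof
  define T where "T i = (\<chi> p q. if q \<le> i then (if p = q then 1 else 0) else M $ p $ q)" for i
  define v where "v = (\<chi> i r. matrix_inv (T i) $ i $ r)"
  have vT: "(\<Sum>r\<in>UNIV. v $ i $ r * T i $ r $ q) = (if i = q then 1 else 0)" for i q
  proof -
    have "(matrix_inv (T i) ** T i) $ i $ q = (if i = q then 1 else 0)"
      using T[of i] by (simp add: T_def[symmetric] matrix_inv_left mat_def)
    then show ?thesis by (simp add: matrix_mult_nth v_def)
  qed
  have v: "v $ i $ q = (if i = q then 1 else 0)" if "q \<le> i" for i q
  proof -
    have "(\<Sum>r\<in>UNIV. v $ i $ r * T i $ r $ q) = (\<Sum>r\<in>UNIV. if r = q then v $ i $ r else 0)"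
      using that by (intro sum.cong) (auto simp: T_def)
    then show ?thesis using vT[of i q] by simp
  qed
  then show "unilow (transpose v)" by (auto simp: unilow_def btri_low_iff transpose_def)
  have "(v ** M) $ i $ q = 0" if "i < q" for i q
  proof -
    have "(\<Sum>r\<in>UNIV. v $ i $ r * T i $ r $ q) = (v ** M) $ i $ q"
      unfolding matrix_mult_nth using that by (intro sum.cong) (auto simp: T_def)
    then show ?thesis using vT[of i q] that by (metis less_irrefl)
  qed
  then show "btri low (v ** M)" by (simp add: btri_low_iff)
qed

lemma lower_unilow_decomp:
  assumes "btri low l" "invertible l"
  obtains l1 d where "unilow l1" "\<And>p. d p \<noteq> 0" "l = l1 ** diag_mat d"
proof
  define d where "d p = l $ p $ p" for p
  have d: "d p \<noteq> 0" for p unfolding d_def by (rule btri_diag_nonzero[OF inj_low assms])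
  define l1 where "l1 = l ** diag_mat (\<lambda>p. inverse (d p))"
  show "unilow l1" unfolding unilow_def l1_def
    using assms d by (auto simp: btri_mult mult_diag_mat_nth d_def[symmetric])
  show "d p \<noteq> 0" for p by (rule d)
  show "l = l1 ** diag_mat d" using d
    by (simp add: l1_def matrix_mul_assoc[symmetric] diag_mat_mult_diag_mat diag_mat_one)
qed

lemma diag_mat_Pm:
  assumes "bij s" shows "diag_mat d ** Pm s = Pm s ** diag_mat (\<lambda>p. d (inv s p))"
  by (simp add: Pm_diag_mat assms bij_is_inj)

lemma btri_mono: "btri up M \<Longrightarrow> (\<And>p q. p \<le> q \<Longrightarrow> mu p \<le> mu q) \<Longrightarrow> btri mu M"
  by (auto simp: btri_def)

text \<open>Row orthonormalisation of the transpose acts on the columns of \<open>M\<close>, by an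
  upper triangular right factor. This makes a representative orthogonal without changing its
  flag.\<close>

lemma column_GS:
  fixes M :: "('n::{finite,linorder}) rmat"
  assumes "invertible M"
  obtains k where "orthogonal_matrix (M ** k)" "btri up k" "invertible k"
    "M ** k = transpose (GS (transpose M))"
proof -
  have inv: "invertible (transpose M)" using assms by (rule transpose_invertible)
  obtain R where R: "transpose M = R ** GS (transpose M)" "btri low R" "\<And>p. R $ p $ p > 0"
    using GS_decomp[OF inv] by blast
  have Ri: "invertible R" using btri_invertible[OF inj_low R(2)] R(3) by (metis less_irrefl)
  define k where "k = transpose (matrix_inv R)"
  have "transpose (GS (transpose M)) = transpose (matrix_inv R ** transpose M)"
    by (metis R(1) Ri matrix_inv_left matrix_mul_assoc matrix_mul_lid)
  then have eq: "M ** k = transpose (GS (transpose M))" by (simp add: matrix_transpose_mul k_def)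
  show ?thesis
  proof (rule that[OF _ _ _ eq])
    show "orthogonal_matrix (M ** k)" unfolding eq using orthogonal_GS[OF inv] by simp
    show "btri up k" unfolding k_def by (simp add: btri_up_transpose btri_matrix_inv R(2) Ri)
    show "invertible k" unfolding k_def by (intro transpose_invertible invertible_matrix_inv Ri)
  qed
qed

lemma tendsto_det_nonzero_invertible:
  assumes "(M \<longlongrightarrow> (A::'n::finite rmat)) F" "invertible A"
  shows "\<forall>\<^sub>F t in F. invertible (M t)"
proof -
  have "((\<lambda>t. det (M t)) \<longlongrightarrow> det A) F" by (rule tendsto_det[OF assms(1)])
  moreover have "det A \<noteq> 0" using assms(2) by (simp add: invertible_det_nz)
  ultimately have "\<forall>\<^sub>F t in F. det (M t) \<noteq> 0" by (rule tendsto_imp_eventually_ne)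
  then show ?thesis by (simp add: invertible_det_nz)
qed

lemma cells_meet:
  fixes s s' :: "'n::{finite,linorder} \<Rightarrow> 'n"
  assumes mono: "\<And>p q. p \<le> q \<Longrightarrow> mu p \<le> mu q" and s: "bij s" "bij s'"
    and cl: "Pm s \<in> closure (upcell mu s')"
  obtains Psi where "orthogonal_matrix Psi" "cell mu s Psi" "cell (\<lambda>p. - mu p) s' Psi"
proof -
  obtain N where N: "\<And>n. N n \<in> upcell mu s'" "N \<longlonglongrightarrow> Pm s"
    using cl unfolding closure_sequential by blast
  \<comment> \<open>The shift by \<open>Pm (inv s)\<close> moves the limit to the identity, near
    which the conditions of \<open>UL_decomposition\<close> persist.\<close>
  have lim: "(\<lambda>n. N n ** Pm (inv s)) \<longlonglongrightarrow> mat 1"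
    using tendsto_matrix_mult[OF N(2) tendsto_const, of "Pm (inv s)"] by (simp add: Pm_inv_right s)
  define T where "T M i = (\<chi> p q. if q \<le> i then (if p = q then 1 else 0) else M $ p $ q)"
    for M :: "'n rmat" and i
  have "\<forall>\<^sub>F n in sequentially. invertible (T (N n ** Pm (inv s)) i)" for i
  proof (rule tendsto_det_nonzero_invertible)
    show "(\<lambda>n. T (N n ** Pm (inv s)) i) \<longlonglongrightarrow> T (mat 1) i"
      unfolding T_def by (rule tendsto_matrix_entries) (auto intro!: tendsto_vec_nth[OF tendsto_vec_nth[OF lim]])
    have "T (mat 1) i = mat 1" by (simp add: T_def mat_def vec_eq_iff)
    then show "invertible (T (mat 1) i)" by (metis invertible_def matrix_mul_lid)
  qed
  then have "\<forall>\<^sub>F n in sequentially. \<forall>i. invertible (T (N n ** Pm (inv s)) i)"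
    by (simp add: eventually_all_finite)
  then obtain n where n: "\<And>i. invertible (T (N n ** Pm (inv s)) i)"
    using eventually_happens'[OF sequentially_bot] by blast
  define M where "M = N n"
  \<comment> \<open>Being upper triangular, \<open>v\<close> keeps \<open>M\<close> in the upper
    orbit of \<open>s'\<close>; at the same time it makes \<open>v ** M\<close> a lower triangular
    multiple of \<open>Pm s\<close>. So \<open>v ** M\<close> belongs to both orbits.\<close>
  obtain v where v: "unilow (transpose v)" "btri low (v ** (M ** Pm (inv s)))"
    using UL_decomposition[of "M ** Pm (inv s)"] n unfolding T_def M_def by blast
  have vi: "invertible v" using transpose_invertible[OF unilow_invertible[OF v(1)]] by simp
  have vup: "btri up v" using v(1) by (simp add: unilow_def btri_low_transpose)
  obtain u h where uh: "M = u ** Pm s' ** h" "btri up u" "invertible u" "btri mu h" "invertible h"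
    using N(1)[of n] unfolding upcell_def M_def by blast
  have Mi: "invertible M" unfolding uh(1) by (intro invertible_mult invertible_Pm s uh)
  define l where "l = v ** (M ** Pm (inv s))"
  have li: "invertible l" unfolding l_def by (intro invertible_mult vi Mi invertible_Pm bij_imp_bij_inv s)
  have M1: "v ** M = l ** Pm s" unfolding l_def by (simp add: matrix_mul_assoc[symmetric] Pm_inv_left s)
  obtain l1 d where l1: "unilow l1" "\<And>p. d p \<noteq> 0" "l = l1 ** diag_mat d"
    using lower_unilow_decomp[OF v(2)[folded l_def] li] by blast
  obtain k where k: "orthogonal_matrix (v ** M ** k)" "btri up k" "invertible k"
    using column_GS[of "v ** M"] vi Mi invertible_mult by blast
  have kmu: "btri mu k" by (rule btri_mono[OF k(2) mono])
  define Psi where "Psi = v ** M ** k"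
  have "cell mu s Psi"
  proof -
    have "Psi = l1 ** (diag_mat d ** Pm s) ** k"
      unfolding Psi_def M1 l1(3) by (simp add: matrix_mul_assoc)
    also have "\<dots> = l1 ** Pm s ** (diag_mat (\<lambda>p. d (inv s p)) ** k)"
      unfolding diag_mat_Pm[OF s(1)] by (simp add: matrix_mul_assoc)
    finally have "Psi = l1 ** Pm s ** (diag_mat (\<lambda>p. d (inv s p)) ** k)" .
    moreover have "btri mu (diag_mat (\<lambda>p. d (inv s p)) ** k)" using kmu by (simp add: btri_mult)
    moreover have "invertible (diag_mat (\<lambda>p. d (inv s p)) ** k)"
      by (intro invertible_mult invertible_diag_mat l1 k)
    ultimately show ?thesis unfolding cell_def using l1(1) by blast
  qed
  moreover have "cell (\<lambda>p. - mu p) s' Psi"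
  proof -
    have "btri low (transpose (v ** u))" unfolding btri_low_transpose by (rule btri_mult[OF vup uh(2)])
    moreover have "invertible (transpose (v ** u))" by (intro transpose_invertible invertible_mult vi uh)
    ultimately obtain u1 e where u1: "unilow u1" "\<And>p. e p \<noteq> 0" "transpose (v ** u) = u1 ** diag_mat e"
      using lower_unilow_decomp by blast
    have vu: "v ** u = diag_mat e ** transpose u1"
      using arg_cong[OF u1(3), of transpose] by (simp add: matrix_transpose_mul)
    \<comment> \<open>Conjugation by \<open>diag_mat e\<close> makes the left factor unipotent
      again; the leftover \<open>diag_mat e\<close> passes through \<open>Pm s'\<close> into the
      right factor.\<close>
    define w where "w = diag_mat e ** transpose u1 ** diag_mat (\<lambda>p. inverse (e p))"
    have "unilow (transpose w)"
    proof -
      have "transpose w = diag_mat (\<lambda>p. inverse (e p)) ** (u1 ** diag_mat e)"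
        by (simp add: w_def matrix_transpose_mul)
      then show ?thesis using u1(1,2)
        by (auto simp: unilow_def btri_mult diag_mat_mult_nth mult_diag_mat_nth)
    qed
    moreover have "Psi = w ** Pm s' ** (diag_mat (\<lambda>p. e (inv s' p)) ** h ** k)"
    proof -
      have "w ** Pm s' ** (diag_mat (\<lambda>p. e (inv s' p)) ** h ** k)
          = w ** (diag_mat e ** Pm s') ** h ** k"
        unfolding diag_mat_Pm[OF s(2)] by (simp add: matrix_mul_assoc)
      also have "\<dots> = (w ** diag_mat e) ** Pm s' ** h ** k" by (simp add: matrix_mul_assoc)
      also have "w ** diag_mat e = v ** u" unfolding w_def vu
        using u1(2) by (simp add: matrix_mul_assoc[symmetric] diag_mat_mult_diag_mat diag_mat_one)
      finally show ?thesis by (simp add: Psi_def uh(1) matrix_mul_assoc)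
    qed
    moreover have "btri mu (diag_mat (\<lambda>p. e (inv s' p)) ** h ** k)" using kmu uh(4) by (simp add: btri_mult)
    moreover have "invertible (diag_mat (\<lambda>p. e (inv s' p)) ** h ** k)"
      by (intro invertible_mult invertible_diag_mat u1 k uh)
    moreover have "orthogonal_matrix Psi" using k(1) by (simp add: Psi_def)
    ultimately show ?thesis using cell_opposite_iff[of Psi s' mu] s(2) by blast
  qed
  ultimately show ?thesis using that k(1) unfolding Psi_def by blast
qed

section \<open>Manifolds\<close>

lemma manifold_dim_homeomorphic:
  assumes hom: "homeomorphic_maps X Y f g" and Y: "manifold_dim Y d"
  shows "manifold_dim X d"
  unfolding manifold_dim_def
proof
  fix x assume x: "x \<in> topspace X"
  have cf: "continuous_map X Y f" and cg: "continuous_map Y X g" and gf: "\<And>x. x \<in> topspace X \<Longrightarrow> g (f x) = x"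
    and fg: "\<And>y. y \<in> topspace Y \<Longrightarrow> f (g y) = y"
    using hom by (auto simp: homeomorphic_maps_def)
  have "f x \<in> topspace Y" using cf x by (meson continuous_map_image_subset_topspace image_subset_iff)
  then obtain U V where UV: "openin Y U" "f x \<in> U" "openin (Euclidean_space d) V"
      "subtopology Y U homeomorphic_space subtopology (Euclidean_space d) V"
    using Y unfolding manifold_dim_def by blast
  define U' where "U' = {z \<in> topspace X. f z \<in> U}"
  have "openin X U'" unfolding U'_def by (rule openin_continuous_map_preimage[OF cf UV(1)])
  moreover have "x \<in> U'" using x UV(2) by (simp add: U'_def)
  moreover have "homeomorphic_maps (subtopology X U') (subtopology Y U) f g"
  proof (rule homeomorphic_maps_subtopologies_alt[OF hom])
    show "f ` (topspace X \<inter> U') \<subseteq> U" by (auto simp: U'_def)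
    show "g ` (topspace Y \<inter> U) \<subseteq> U'"
      using cg fg by (auto simp: U'_def continuous_map_def)
  qed
  then have "subtopology X U' homeomorphic_space subtopology (Euclidean_space d) V"
    using UV(4) homeomorphic_space_trans unfolding homeomorphic_space_def[of "subtopology X U'" "subtopology Y U"]
    by (metis homeomorphic_space_def homeomorphic_space_trans)
  ultimately show "\<exists>U V. openin X U \<and> x \<in> U \<and> openin (Euclidean_space d) V \<and>
      subtopology X U homeomorphic_space subtopology (Euclidean_space d) V"
    using UV(3) by blast
qed

lemma open_subset_subspace_homeomorphic:
  fixes K :: "'a::euclidean_space set"
  assumes K: "subspace K" and V: "open V"
  obtains W where "openin (Euclidean_space (dim K)) W"
    "top_of_set (V \<inter> K) homeomorphic_space subtopology (Euclidean_space (dim K)) W"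
proof -
  define d where "d = dim K"
  obtain B where B: "B \<subseteq> K" "pairwise orthogonal B" "\<And>x. x \<in> B \<Longrightarrow> norm x = 1"
      "independent B" "card B = dim K" "span B = K"
    using orthonormal_basis_subspace[OF K] by metis
  have finB: "finite B" using B(4) by (rule finiteI_independent)
  obtain b where b: "bij_betw b {..<d} B"
    using ex_bij_betw_nat_finite[OF finB] B(5) by (auto simp: d_def lessThan_atLeast0)
  have bB: "b i \<in> B" if "i < d" for i using bij_betwE[OF b] that by auto
  have bb: "b i \<bullet> b j = (if i = j then 1 else 0)" if "i < d" "j < d" for i j
  proof (cases "i = j")
    case True then show ?thesis using B(3)[OF bB[OF that(1)]] by (simp add: dot_square_norm)
  next
    case False
    then have "b i \<noteq> b j" using b that by (auto simp: bij_betw_def inj_on_def)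
    then show ?thesis using B(2) bB that False by (auto simp: pairwise_def orthogonal_def)
  qed
  define c where "c y = (\<Sum>i<d. y i *\<^sub>R b i)" for y :: "nat \<Rightarrow> real"
  \<comment> \<open>The value 0 from index \<open>d\<close> on is forced: points of
    \<open>Euclidean_space d\<close> vanish there.\<close>
  define e where "e v = (\<lambda>i. if i < d then v \<bullet> b i else 0)" for v
  have cb: "c y \<bullet> b j = y j" if "j < d" for y j
  proof -
    have "c y \<bullet> b j = (\<Sum>i<d. y i * (b i \<bullet> b j))" by (simp add: c_def inner_sum_left)
    also have "\<dots> = (\<Sum>i<d. if i = j then y i else 0)" using that by (intro sum.cong) (auto simp: bb)
    finally show ?thesis using that by simp
  qed
  have cK: "c y \<in> K" for y unfolding c_def
    using B(1) bB by (intro subspace_sum[OF K] subspace_scale[OF K]) auto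
  have ec: "e (c y) = y" if "y \<in> topspace (Euclidean_space d)" for y
    using that by (auto simp: e_def cb fun_eq_iff topspace_Euclidean_space)
  have ce: "c (e v) = v" if "v \<in> K" for v
  proof -
    have "v - c (e v) \<in> span B" using that cK K B(6) subspace_diff by blast
    moreover have "orthogonal (v - c (e v)) x" if x: "x \<in> B" for x
    proof -
      obtain j where "j < d" "x = b j" using b x by (auto simp: bij_betw_def)
      then show ?thesis by (simp add: orthogonal_def inner_diff_left cb) (simp add: e_def)
    qed
    ultimately have "orthogonal (v - c (e v)) (v - c (e v))" using orthogonal_to_span by blast
    then show ?thesis by (simp add: orthogonal_self)
  qed
  have contc: "continuous_map (Euclidean_space d) euclidean c"
    unfolding continuous_map_Euclidean_space_iff c_def
    by (intro continuous_intros continuous_on_product_coordinates continuous_on_subset[OF continuous_on_product_coordinates]) auto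
  have conte: "continuous_map euclidean (Euclidean_space d) e"
    unfolding e_def continuous_map_componentwise_Euclidean_space
    by (simp add: continuous_intros)
  have hom: "homeomorphic_maps (top_of_set K) (Euclidean_space d) e c"
    unfolding homeomorphic_maps_def
    using conte contc cK ce ec by (auto simp: continuous_map_in_subtopology continuous_map_from_subtopology)
  define W where "W = {y \<in> topspace (Euclidean_space d). c y \<in> V}"
  have "openin (Euclidean_space d) W"
    unfolding W_def by (rule openin_continuous_map_preimage[OF contc]) (simp add: V)
  moreover have "homeomorphic_maps (subtopology (top_of_set K) V) (subtopology (Euclidean_space d) W) e c"
  proof (rule homeomorphic_maps_subtopologies_alt[OF hom])
    show "e ` (topspace (top_of_set K) \<inter> V) \<subseteq> W"
      using ce by (auto simp: W_def topspace_Euclidean_space e_def)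
    show "c ` (topspace (Euclidean_space d) \<inter> W) \<subseteq> V" by (auto simp: W_def)
  qed
  then have "top_of_set (V \<inter> K) homeomorphic_space subtopology (Euclidean_space d) W"
    unfolding homeomorphic_space_def by (metis inf_commute subtopology_subtopology)
  ultimately show ?thesis using that unfolding d_def by blast
qed

lemma homeomorphism_imp_homeomorphic_maps:
  assumes "homeomorphism S T f g" shows "homeomorphic_maps (top_of_set S) (top_of_set T) f g"
proof -
  have 1: "continuous_on S f" "continuous_on T g" "\<And>x. x \<in> S \<Longrightarrow> f x \<in> T" "\<And>y. y \<in> T \<Longrightarrow> g y \<in> S"
    "\<And>x. x \<in> S \<Longrightarrow> g (f x) = x" "\<And>y. y \<in> T \<Longrightarrow> f (g y) = y"
    using assms unfolding homeomorphism_def by blast+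
  have "f \<in> S \<rightarrow> T" "g \<in> T \<rightarrow> S" using 1(3,4) by blast+
  then show ?thesis
    unfolding homeomorphic_maps_def continuous_map_in_subtopology using 1(1,2,5,6) by simp
qed

text \<open>The map \<open>G u = u + A (F (\<pi> u) - L (\<pi> u))\<close> has derivative \<open>id\<close> at \<open>x\<close>; it maps
  the zero set inside \<open>V\<close> exactly to the kernel of \<open>L = F' x\<close> on \<open>V\<close>. Here \<open>\<pi>\<close> is a projection onto
  \<open>V\<close> and \<open>A\<close> a right inverse of \<open>L\<close> on \<open>V\<close>.\<close>
lemma zero_set_manifold:
  fixes F :: "'a::euclidean_space \<Rightarrow> 'b::euclidean_space" and F' :: "'a \<Rightarrow> 'a \<Rightarrow>\<^sub>L 'b"
  assumes V: "subspace V"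
    and der: "\<And>x. (F has_derivative blinfun_apply (F' x)) (at x)"
    and cont: "continuous_on UNIV F'"
    and surj: "\<And>x. x \<in> V \<Longrightarrow> F x = 0 \<Longrightarrow> blinfun_apply (F' x) ` V = UNIV"
    and dim: "dim V = d + DIM('b)"
  shows "manifold_dim (top_of_set {v \<in> V. F v = 0}) d"
  unfolding manifold_dim_def
proof
  fix x assume "x \<in> topspace (top_of_set {v \<in> V. F v = 0})"
  then have x: "x \<in> V" "F x = 0" by auto
  define L where "L = blinfun_apply (F' x)"
  have linL: "linear L" unfolding L_def by (simp add: blinfun.bounded_linear_right bounded_linear.linear)
  obtain A where A: "range A \<subseteq> V" "linear A" "\<And>v. v \<in> L ` V \<Longrightarrow> L (A v) = v"
    using linear_exists_right_inverse_on[OF linL V] by auto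
  have LV: "L ` V = UNIV" using surj[OF x] by (simp add: L_def)
  have LA: "L (A y) = y" for y using A(3) LV by auto
  have AV: "A y \<in> V" for y using A(1) by auto
  obtain P where P: "range P \<subseteq> V" "linear P" "\<And>v. v \<in> V \<Longrightarrow> P v = v"
    using linear_exists_left_inverse_on[OF linear_id V] by auto
  have PV: "P u \<in> V" for u using P(1) by auto
  define K where "K = {v \<in> V. L v = 0}"
  have K: "subspace K" using V linL unfolding K_def subspace_def
    by (auto simp: linear_add linear_scale linear_0)
  have dimK: "dim K = d"
  proof -
    have "inj A" by (metis LA injI)
    then have "dim (range A) = DIM('b)"
      using dim_image_eq[OF A(2), of UNIV] by (simp add: inj_on_subset)
    moreover have "dim {x + y |x y. x \<in> K \<and> y \<in> range A} + dim (K \<inter> range A) = dim K + dim (range A)"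
      by (rule dim_sums_Int[OF K]) (simp add: A(2) linear_subspace_image)
    moreover have "{x + y |x y. x \<in> K \<and> y \<in> range A} = V"
    proof
      show "{x + y |x y. x \<in> K \<and> y \<in> range A} \<subseteq> V"
        using AV V by (auto simp: K_def subspace_add)
      show "V \<subseteq> {x + y |x y. x \<in> K \<and> y \<in> range A}"
      proof
        fix v assume v: "v \<in> V"
        have "v - A (L v) \<in> K" using v V AV linL LA by (simp add: K_def subspace_diff linear_diff)
        then show "v \<in> {x + y |x y. x \<in> K \<and> y \<in> range A}"
          by (intro CollectI exI[of _ "v - A (L v)"] exI[of _ "A (L v)"]) auto
      qed
    qed
    moreover have "K \<inter> range A \<subseteq> {0}"
      using LA linear_0[OF A(2)] by (auto simp: K_def)
    then have "dim (K \<inter> range A) = 0" using dim_eq_0 by blast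
    ultimately show ?thesis using dim by simp
  qed
  define bA where "bA = Blinfun A"
  define bP where "bP = Blinfun P"
  have bA: "blinfun_apply bA = A" unfolding bA_def
    using A(2) by (simp add: bounded_linear_Blinfun_apply linear_conv_bounded_linear)
  have bP: "blinfun_apply bP = P" unfolding bP_def
    using P(2) by (simp add: bounded_linear_Blinfun_apply linear_conv_bounded_linear)
  define G where "G u = u + A (F (P u) - L (P u))" for u
  define G' where "G' u = id_blinfun + (bA o\<^sub>L ((F' (P u) - F' x) o\<^sub>L bP))" for u
  have dG: "(G has_derivative blinfun_apply (G' u)) (at u)" for u
  proof -
    have dP: "(P has_derivative P) (at u)" using P(2) by (simp add: bounded_linear_imp_has_derivative linear_conv_bounded_linear)
    have dF: "((\<lambda>u. F (P u)) has_derivative (\<lambda>h. blinfun_apply (F' (P u)) (P h))) (at u)"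
      by (rule has_derivative_compose[OF dP der])
    have dL: "((\<lambda>u. L (P u)) has_derivative (\<lambda>h. L (P h))) (at u)"
      using linL P(2) by (intro bounded_linear_imp_has_derivative) (simp add: linear_conv_bounded_linear[symmetric] linear_compose[unfolded o_def])
    have dA: "(A has_derivative A) (at y)" for y
      using A(2) by (simp add: bounded_linear_imp_has_derivative linear_conv_bounded_linear)
    have "((\<lambda>u. A (F (P u) - L (P u))) has_derivative (\<lambda>h. A (blinfun_apply (F' (P u)) (P h) - L (P h)))) (at u)"
      by (rule has_derivative_compose[OF has_derivative_diff[OF dF dL] dA])
    then have "(G has_derivative (\<lambda>h. h + A (blinfun_apply (F' (P u)) (P h) - L (P h)))) (at u)"
      unfolding G_def by (intro has_derivative_add has_derivative_ident)
    moreover have "(\<lambda>h. h + A (blinfun_apply (F' (P u)) (P h) - L (P h))) = blinfun_apply (G' u)"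
      by (auto simp: G'_def blinfun.add_left blinfun.diff_left bA bP L_def)
    ultimately show ?thesis by simp
  qed
  have contG: "continuous_on UNIV G'"
  proof -
    have cP: "continuous_on UNIV P" using P(2) by (simp add: linear_continuous_on linear_conv_bounded_linear)
    have "continuous_on UNIV (\<lambda>u. F' (P u))" by (rule continuous_on_compose2[OF cont cP]) auto
    then show ?thesis unfolding G'_def by (intro continuous_intros)
  qed
  have "G' x = id_blinfun" using x(1) by (simp add: G'_def P(3))
  then have "id_blinfun o\<^sub>L G' x = id_blinfun" by (intro blinfun_eqI) simp
  then obtain U' V' g g' where UV: "open U'" "x \<in> U'" "open V'" "G x \<in> V'" "homeomorphism U' V' G g"
    using inverse_function_theorem[OF open_UNIV dG contG UNIV_I] by metis
  \<comment> \<open>The correction term lies in \<open>V\<close>, so \<open>G u\<close> in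
    \<open>V\<close> forces \<open>u\<close> in \<open>V\<close>; and on \<open>V\<close> one has
    \<open>L (G u) = F u\<close>, because \<open>A\<close> is a right inverse of
    \<open>L\<close>.\<close>
  have GK: "G u \<in> K \<longleftrightarrow> u \<in> V \<and> F u = 0" for u
  proof
    assume "u \<in> V \<and> F u = 0"
    then show "G u \<in> K"
      using V AV linL LA by (simp add: G_def K_def P(3) subspace_add linear_add)
  next
    assume GK: "G u \<in> K"
    then have "G u - A (F (P u) - L (P u)) \<in> V" using V AV subspace_diff unfolding K_def by blast
    then have u: "u \<in> V" by (simp add: G_def)
    have "L (G u) = L u + (F u - L u)" using linL LA u by (simp add: G_def linear_add P(3))
    then show "u \<in> V \<and> F u = 0" using GK u by (simp add: K_def)
  qed
  define N where "N = U' \<inter> {v \<in> V. F v = 0}"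
  have hom: "homeomorphism N (V' \<inter> K) G g"
  proof (rule homeomorphism_of_subsets[OF UV(5)])
    show "N \<subseteq> U'" by (simp add: N_def)
    show "V' \<inter> K \<subseteq> V'" by simp
    show "G ` N = V' \<inter> K"
    proof
      show "G ` N \<subseteq> V' \<inter> K" using UV(5) GK unfolding N_def homeomorphism_def by blast
      show "V' \<inter> K \<subseteq> G ` N"
      proof
        fix y assume y: "y \<in> V' \<inter> K"
        have "y \<in> V'" using y by simp
        then have gy: "g y \<in> U'" "G (g y) = y" using UV(5) unfolding homeomorphism_def by blast+
        then have "g y \<in> N" using GK[of "g y"] y by (simp add: N_def)
        then show "y \<in> G ` N" using gy(2) by (intro image_eqI[where f=G and x="g y"]) auto
      qed
    qed
  qed
  then have "top_of_set N homeomorphic_space top_of_set (V' \<inter> K)"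
    using homeomorphism_imp_homeomorphic_maps homeomorphic_space_def by blast
  moreover obtain W where W: "openin (Euclidean_space (dim K)) W"
      "top_of_set (V' \<inter> K) homeomorphic_space subtopology (Euclidean_space (dim K)) W"
    using open_subset_subspace_homeomorphic[OF K UV(3)] by metis
  ultimately have "top_of_set N homeomorphic_space subtopology (Euclidean_space d) W"
    using homeomorphic_space_trans dimK by blast
  moreover have "subtopology (top_of_set {v \<in> V. F v = 0}) N = top_of_set N"
    by (simp add: subtopology_subtopology N_def Int_absorb1 inf.absorb2)
  moreover have "openin (top_of_set {v \<in> V. F v = 0}) N"
    unfolding N_def by (subst Int_commute) (rule openin_open_Int[OF UV(1)])
  moreover have "x \<in> N" using x UV by (simp add: N_def)
  moreover have "openin (Euclidean_space d) W" using W(1) dimK by simp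
  ultimately show "\<exists>U W. openin (top_of_set {v \<in> V. F v = 0}) U \<and> x \<in> U \<and> openin (Euclidean_space d) W \<and>
      subtopology (top_of_set {v \<in> V. F v = 0}) U homeomorphic_space subtopology (Euclidean_space d) W"
    by (intro exI[of _ N] exI[of _ W]) simp
qed

section \<open>Coordinates on the intersection of two opposite cells\<close>

definition supp :: "('n \<times> 'n) set \<Rightarrow> 'n::finite rmat set" where
  "supp S = {Z. \<forall>p q. Z $ p $ q \<noteq> 0 \<longrightarrow> (p, q) \<in> S}"

lemma subspace_supp: "subspace (supp S)"
proof -
  have "(p, q) \<in> S" if "x \<in> supp S" "y \<in> supp S" "(x + y) $ p $ q \<noteq> 0" for x y :: "'a rmat" and p q
    using that by (cases "x $ p $ q = 0") (auto simp: supp_def)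
  then have add: "x + y \<in> supp S" if "x \<in> supp S" "y \<in> supp S" for x y :: "'a rmat"
    using that unfolding supp_def[of S] by blast
  show ?thesis
  proof (rule subspaceI)
    show "0 \<in> supp S" by (simp add: supp_def)
    show "c *\<^sub>R x \<in> supp S" if "x \<in> supp S" for c and x :: "'a rmat" using that by (simp add: supp_def)
  qed (rule add)
qed

lemma dim_supp: "dim (supp S :: 'n::finite rmat set) = card S"
proof -
  define e where "e = (\<lambda>(p, q). axis p (axis q 1) :: 'n rmat)"
  have inner: "Z \<bullet> e (p, q) = Z $ p $ q" for Z p q by (simp add: e_def inner_axis)
  have Basis: "Basis = range e" unfolding e_def Basis_vec_def by (auto simp: image_iff)
  have inj: "inj e" unfolding e_def by (auto simp: inj_def axis_eq_axis)
  have "supp S = {Z. \<forall>i\<in>Basis. i \<notin> e ` S \<longrightarrow> Z \<bullet> i = 0}"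
    unfolding Basis supp_def using inj by (auto simp: inner inj_image_mem_iff)
  also have "dim \<dots> = card (e ` S)" by (rule dim_substandard) (auto simp: Basis)
  also have "\<dots> = card S" by (rule card_image) (rule inj_on_subset[OF inj], simp)
  finally show ?thesis .
qed

lemma btri_iff_supp: "btri f h \<longleftrightarrow> h \<in> supp {(p, q). f p \<le> f q}"
  by (simp add: btri_def supp_def)

lemma one_plus_supp:
  assumes g: "inj g" and Z: "Z \<in> supp {(p, q). f q < f p \<and> g p < g q}"
  shows "btri g (mat 1 + Z)" "(mat 1 + Z) $ p $ p = 1" "invertible (mat 1 + Z)"
proof -
  show b: "btri g (mat 1 + Z)"
    by (intro btri_add btri_mat1) (use Z in \<open>auto simp: supp_def btri_def less_imp_le\<close>)
  have d: "(mat 1 + Z) $ p $ p = 1" for p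
    using Z by (auto simp: supp_def mat_def)
  show "(mat 1 + Z) $ p $ p = 1" by (rule d)
  show "invertible (mat 1 + Z)" by (rule btri_invertible[OF g b]) (use d in simp)
qed

text \<open>Apply \<open>triangular_split\<close> to the identity with the grading \<open>mu\<close>
  pulled back along \<open>s\<close>. Its factor \<open>K\<close> stabilises the coset of
  \<open>Pm s\<close>, since conjugation by \<open>Pm s\<close> carries it into P; the entries of
  \<open>Z\<close> are the directions transverse to this stabiliser.\<close>

lemma cell_normal_form:
  assumes g: "inj g" and l: "btri g l" "invertible l" and s: "bij s"
  obtains Z H where "Z \<in> supp {(p, q). mu (s q) < mu (s p) \<and> g p < g q}"
    "btri mu H" "invertible H" "(mat 1 + Z) ** Pm s = l ** Pm s ** H"
proof -
  obtain Y K where YK: "mat 1 = Y + l ** K" "btri (\<lambda>p. mu (s p)) K"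
      "\<And>p q. Y $ p $ q \<noteq> 0 \<Longrightarrow> mu (s q) < mu (s p) \<and> g p < g q"
    using triangular_split[OF g l btri_mat1, of "\<lambda>p. mu (s p)"] by metis
  define Z where "Z = - Y"
  define H where "H = Pm (inv s) ** K ** Pm s"
  have Z: "Z \<in> supp {(p, q). mu (s q) < mu (s p) \<and> g p < g q}"
    using YK(3) by (auto simp: supp_def Z_def)
  have lK: "mat 1 + Z = l ** K" using YK(1) by (simp add: Z_def)
  have "invertible (l ** K)" using one_plus_supp(3)[OF g Z] lK by simp
  then have K: "invertible K" using invertible_mult_left[OF l(2)] by blast
  have "(mat 1 + Z) ** Pm s = l ** (Pm s ** Pm (inv s)) ** K ** Pm s" by (simp add: lK Pm_inv_right s)
  then have "(mat 1 + Z) ** Pm s = l ** Pm s ** H" by (simp add: H_def matrix_mul_assoc)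
  moreover have "invertible H" unfolding H_def by (intro invertible_mult invertible_Pm bij_imp_bij_inv s K)
  moreover have "btri mu H" unfolding H_def by (rule btri_Pm_conj[OF s YK(2)])
  ultimately show ?thesis using that Z by blast
qed

text \<open>A common point has normal forms \<open>(mat 1 + Z') ** Pm s'\<close> and
  \<open>(mat 1 + Z) ** Pm s\<close>, which represent the same flag when an \<open>h\<close> in P
  joins them. Recording \<open>h\<close> as a coordinate keeps the equation polynomial.\<close>

definition chart_eq :: "('n \<Rightarrow> 'n) \<Rightarrow> ('n \<Rightarrow> 'n) \<Rightarrow> 'n::finite rmat \<times> 'n rmat \<times> 'n rmat \<Rightarrow> 'n rmat" where
  "chart_eq s s' v = (mat 1 + fst v) ** Pm s' ** fst (snd v) - (mat 1 + snd (snd v)) ** Pm s"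

definition chart_space :: "('n::{finite,linorder} \<Rightarrow> real) \<Rightarrow> ('n \<Rightarrow> 'n) \<Rightarrow> ('n \<Rightarrow> 'n) \<Rightarrow> ('n rmat \<times> 'n rmat \<times> 'n rmat) set" where
  "chart_space mu s s' = supp {(p, q). mu (s' q) < mu (s' p) \<and> up p < up q} \<times>
      supp {(p, q). mu p \<le> mu q} \<times> supp {(p, q). mu (s q) < mu (s p) \<and> low p < low q}"

definition chart_deriv :: "('n \<Rightarrow> 'n) \<Rightarrow> ('n \<Rightarrow> 'n) \<Rightarrow> 'n::finite rmat \<times> 'n rmat \<times> 'n rmat \<Rightarrow> 'n rmat \<times> 'n rmat \<times> 'n rmat \<Rightarrow> 'n rmat" where
  "chart_deriv s s' v d = (mat 1 + fst v) ** Pm s' ** fst (snd d) + fst d ** Pm s' ** fst (snd v) - snd (snd d) ** Pm s"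

lemma chart_eq_derivative: "(chart_eq s s' has_derivative chart_deriv s s' v) (at v)"
proof -
  note mm = bounded_bilinear.FDERIV[OF bounded_bilinear_matrix_mult]
  have 1: "((\<lambda>v. (mat 1 + fst v) ** Pm s') has_derivative (\<lambda>d. fst d ** Pm s')) (at v)"
  proof -
    have "((\<lambda>v. mat 1 + fst v) has_derivative (\<lambda>d. 0 + fst d)) (at v)"
      by (intro has_derivative_add has_derivative_const has_derivative_fst has_derivative_ident)
    from mm[OF this has_derivative_const[of "Pm s'"]] show ?thesis
      by (simp add: bounded_bilinear.zero_right[OF bounded_bilinear_matrix_mult])
  qed
  have 2: "((\<lambda>v. (mat 1 + snd (snd v)) ** Pm s) has_derivative (\<lambda>d. snd (snd d) ** Pm s)) (at v)"
  proof -
    have "((\<lambda>v. mat 1 + snd (snd v)) has_derivative (\<lambda>d. 0 + snd (snd d))) (at v)"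
      by (intro has_derivative_add has_derivative_const has_derivative_snd has_derivative_ident)
    from mm[OF this has_derivative_const[of "Pm s"]] show ?thesis
      by (simp add: bounded_bilinear.zero_right[OF bounded_bilinear_matrix_mult])
  qed
  have 3: "((\<lambda>v. fst (snd v)) has_derivative (\<lambda>d. fst (snd d))) (at v)"
    by (intro has_derivative_fst has_derivative_snd has_derivative_ident)
  from has_derivative_diff[OF mm[OF 1 3] 2] show ?thesis
    unfolding chart_eq_def[abs_def] chart_deriv_def[abs_def] .
qed

text \<open>Strictly upper and lower triangular matrices together span all matrices, so the tangent
  spaces of the opposite orbits span the tangent space of the quotient. Each half of
  \<open>Y\<close> is split by \<open>triangular_split\<close> into a coordinate direction and a
  stabiliser direction, and the latter is realised by varying \<open>h\<close>.\<close>

lemma chart_deriv_surj: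
  fixes s s' :: "'n::{finite,linorder} \<Rightarrow> 'n"
  assumes s: "bij s" "bij s'" and v: "v \<in> chart_space mu s s'" "chart_eq s s' v = 0"
  shows "chart_deriv s s' v ` chart_space mu s s' = UNIV"
proof -
  obtain Z' h Z where vdef: "v = (Z', h, Z)" by (metis prod.collapse)
  have Z': "Z' \<in> supp {(p, q). mu (s' q) < mu (s' p) \<and> up p < up q}"
    and h: "btri mu h" and Z: "Z \<in> supp {(p, q). mu (s q) < mu (s p) \<and> low p < low q}"
    using v(1) by (auto simp: vdef chart_space_def btri_iff_supp)
  define u where "u = mat 1 + Z'"
  define l where "l = mat 1 + Z"
  have u: "btri up u" "invertible u" unfolding u_def by (rule one_plus_supp[OF inj_up Z'])+
  have l: "btri low l" "invertible l" unfolding l_def by (rule one_plus_supp[OF inj_low Z])+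
  have eq: "u ** Pm s' ** h = l ** Pm s" using v(2) by (simp add: vdef chart_eq_def u_def l_def)
  define g where "g = l ** Pm s"
  have g: "invertible g" unfolding g_def by (intro invertible_mult l invertible_Pm s)
  have "X \<in> chart_deriv s s' v ` chart_space mu s s'" for X
  proof -
    define Y where "Y = X ** matrix_inv g"
    have XY: "X = Y ** g" unfolding Y_def by (metis g matrix_inv_left matrix_mul_assoc matrix_mul_rid)
    define U where "U = upper_part Y"
    have U: "btri up U" by (auto simp: U_def upper_part_def btri_up_iff)
    have Lw: "btri low (Y - U)" by (auto simp: U_def upper_part_def btri_low_iff)
    obtain Y1 K1 where Y1: "U ** u = Y1 + u ** K1" "btri (\<lambda>p. mu (s' p)) K1"
        "\<And>p q. Y1 $ p $ q \<noteq> 0 \<Longrightarrow> mu (s' q) < mu (s' p) \<and> up p < up q"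
      using triangular_split[OF inj_up u btri_mult[OF U u(1)], of "\<lambda>p. mu (s' p)"] by metis
    obtain Y2 K2 where Y2: "(Y - U) ** l = Y2 + l ** K2" "btri (\<lambda>p. mu (s p)) K2"
        "\<And>p q. Y2 $ p $ q \<noteq> 0 \<Longrightarrow> mu (s q) < mu (s p) \<and> low p < low q"
      using triangular_split[OF inj_low l btri_mult[OF Lw l(1)], of "\<lambda>p. mu (s p)"] by metis
    \<comment> \<open>The two stabiliser directions, transported to \<open>h\<close>: the first
      summand produces \<open>u ** K1 ** Pm s' ** h\<close>, and the second produces
      \<open>l ** K2 ** Pm s\<close> through the equation \<open>eq\<close>.\<close>
    define dh where "dh = Pm (inv s') ** K1 ** Pm s' ** h + h ** (Pm (inv s) ** K2 ** Pm s)"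
    have dh: "btri mu dh" unfolding dh_def
      by (intro btri_add btri_mult h btri_Pm_conj s) (use Y1 Y2 in auto)
    have "(Y1, dh, - Y2) \<in> chart_space mu s s'"
      using Y1(3) Y2(3) dh by (auto simp: chart_space_def btri_iff_supp) (auto simp: supp_def)
    moreover have "chart_deriv s s' v (Y1, dh, - Y2) = X"
    proof -
      have "u ** Pm s' ** dh = u ** (Pm s' ** Pm (inv s')) ** K1 ** Pm s' ** h + (u ** Pm s' ** h) ** Pm (inv s) ** K2 ** Pm s"
        by (simp add: dh_def matrix_mult_add_right matrix_mul_assoc)
      also have "\<dots> = u ** K1 ** Pm s' ** h + l ** (Pm s ** Pm (inv s)) ** K2 ** Pm s"
        unfolding eq by (simp only: Pm_inv_right[OF s(2)] matrix_mul_rid) (simp only: matrix_mul_assoc)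
      finally have "u ** Pm s' ** dh = u ** K1 ** Pm s' ** h + l ** K2 ** Pm s" by (simp add: Pm_inv_right s)
      then have "chart_deriv s s' v (Y1, dh, - Y2)
          = (Y1 + u ** K1) ** Pm s' ** h + (Y2 + l ** K2) ** Pm s"
        by (simp add: chart_deriv_def vdef u_def[symmetric] matrix_mult_add_left matrix_mult_minus_left)
      also have "\<dots> = U ** (u ** Pm s' ** h) + (Y - U) ** (l ** Pm s)"
        by (simp add: Y1(1)[symmetric] Y2(1)[symmetric] matrix_mul_assoc)
      also have "\<dots> = (U + (Y - U)) ** g" unfolding eq g_def matrix_mult_add_left ..
      also have "\<dots> = X" by (simp add: XY)
      finally show ?thesis .
    qed
    ultimately show ?thesis by (metis imageI)
  qed
  then show ?thesis by blast
qed

lemma card_comp_pairs: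
  fixes s :: "'n::finite \<Rightarrow> 'n"
  assumes "bij s" shows "card {(p, q). P (s p) (s q)} = card {(p, q). P p q}"
proof -
  have "map_prod s s ` {(p, q). P (s p) (s q)} = {(p, q). P p q}"
  proof (intro equalityI subsetI)
    fix x assume "x \<in> {(p, q). P p q}"
    moreover have "x = map_prod s s (inv s (fst x), inv s (snd x))"
      using assms by (simp add: bij_is_surj surj_f_inv_f)
    ultimately show "x \<in> map_prod s s ` {(p, q). P (s p) (s q)}"
      using assms by (intro image_eqI[where x="(inv s (fst x), inv s (snd x))"])
        (auto simp: bij_is_surj surj_f_inv_f)
  qed auto
  moreover have "inj (map_prod s s)" using assms by (simp add: bij_is_inj prod.inj_map)
  ultimately show ?thesis using card_image[of "map_prod s s" "{(p, q). P (s p) (s q)}"]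
    by (metis inj_on_subset subset_UNIV)
qed

text \<open>The three factors contribute the inversions of \<open>omega\<close>, the dimension of P,
  and the pairs of positions that \<open>psi\<close> puts in increasing order. The last number is
  the number of pairs with distinct letters less \<open>invs psi\<close>; as \<open>s\<close> is a
  permutation, that number of pairs is the codimension of P.\<close>

lemma dim_chart_space:
  fixes s s' :: "'n::{finite,linorder} \<Rightarrow> 'n"
  assumes s: "bij s" and psi: "\<And>p q. mu (s p) < mu (s q) \<longleftrightarrow> psi p < psi q"
    and omega: "\<And>p q. mu (s' p) < mu (s' q) \<longleftrightarrow> omega p < omega q"
  shows "dim (chart_space mu s s') + invs psi = invs omega + DIM('n rmat)"
proof -
  have 1: "dim (chart_space mu s s') = card {(p, q). mu (s' q) < mu (s' p) \<and> up p < up q}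
      + (card {(p, q). mu p \<le> mu q} + card {(p, q). mu (s q) < mu (s p) \<and> low p < low q})"
    unfolding chart_space_def by (simp add: dim_Times subspace_supp subspace_Times dim_supp)
  have 2: "card {(p, q). mu (s' q) < mu (s' p) \<and> up p < up q} = invs omega"
    unfolding invs_def omega by (simp add: conj_commute)
  have "{(p, q). mu (s q) < mu (s p)}
      = {(p, q). p < q \<and> psi q < psi p} \<union> {(p, q). mu (s q) < mu (s p) \<and> low p < low q}"
    unfolding psi by (auto simp: not_less order_le_less)
  then have "card {(p, q). mu (s q) < mu (s p)} = invs psi + card {(p, q). mu (s q) < mu (s p) \<and> low p < low q}"
    unfolding invs_def by (subst card_Un_disjoint[symmetric]) auto
  moreover have "card {(p, q). mu (s q) < mu (s p)} = card {(p, q). mu q < mu p}"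
    by (rule card_comp_pairs[OF s])
  moreover have "card {(p, q). mu p \<le> mu q} + card {(p, q). mu q < mu p} = DIM('n rmat)"
  proof -
    have "{(p, q). mu p \<le> mu q} \<union> {(p, q). mu q < mu p} = UNIV" by auto
    then have "card {(p, q). mu p \<le> mu q} + card {(p, q). mu q < mu p} = card (UNIV :: ('n \<times> 'n) set)"
      by (subst card_Un_disjoint[symmetric]) (auto intro: arg_cong[where f=card])
    then show ?thesis by (simp add: card_prod)
  qed
  ultimately show ?thesis using 1 2 by simp
qed

lemma chart_manifold:
  fixes s s' :: "'n::{finite,linorder} \<Rightarrow> 'n"
  assumes s: "bij s" "bij s'" and psi: "\<And>p q. mu (s p) < mu (s q) \<longleftrightarrow> psi p < psi q"
    and omega: "\<And>p q. mu (s' p) < mu (s' q) \<longleftrightarrow> omega p < omega q"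
    and d: "invs omega = invs psi + d"
  shows "manifold_dim (top_of_set {v \<in> chart_space mu s s'. chart_eq s s' v = 0}) d"
proof (rule zero_set_manifold)
  define F' where "F' v = Blinfun (chart_deriv s s' v)" for v
  have bl: "bounded_linear (chart_deriv s s' v)" for v
    using chart_eq_derivative by (rule has_derivative_bounded_linear)
  have F': "blinfun_apply (F' v) = chart_deriv s s' v" for v
    unfolding F'_def by (rule bounded_linear_Blinfun_apply[OF bl])
  show "(chart_eq s s' has_derivative blinfun_apply (F' v)) (at v)" for v
    unfolding F' by (rule chart_eq_derivative)
  show "continuous_on UNIV F'"
  proof (rule continuous_on_blinfun_componentwise)
    fix i show "continuous_on UNIV (\<lambda>v. blinfun_apply (F' v) i)"
      unfolding F' chart_deriv_def by (intro continuous_intros continuous_on_matrix_mult)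
  qed
  show "blinfun_apply (F' v) ` chart_space mu s s' = UNIV" if "v \<in> chart_space mu s s'" "chart_eq s s' v = 0" for v
    unfolding F' by (rule chart_deriv_surj[OF s that])
  show "subspace (chart_space mu s s')"
    unfolding chart_space_def by (intro subspace_Times subspace_supp)
  show "dim (chart_space mu s s') = d + DIM('n rmat)"
    using dim_chart_space[where mu=mu and psi=psi and omega=omega, OF s(1) psi omega] d by simp
qed

section \<open>Spectral projections\<close>

lemma Lax_eqD:
  assumes orth: "orthogonal_matrix Psi" "orthogonal_matrix Phi" and eq: "Lax mu Psi = Lax mu Phi"
    and nz: "(transpose Psi ** Phi) $ p $ q \<noteq> 0"
  shows "mu p = mu q"
proof -
  have "transpose Psi ** Lax mu Psi = diag_mat mu ** transpose Psi"
    unfolding Lax_def using orth(1) by (simp add: matrix_mul_assoc orthogonal_matrix_def)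
  then have "diag_mat mu ** (transpose Psi ** Phi) = transpose Psi ** Lax mu Phi ** Phi"
    by (simp add: matrix_mul_assoc eq)
  also have "\<dots> = transpose Psi ** Phi ** diag_mat mu"
    by (simp add: matrix_mul_assoc[symmetric] Lax_mult[OF orth(2)])
  finally have "(diag_mat mu ** (transpose Psi ** Phi)) $ p $ q = (transpose Psi ** Phi ** diag_mat mu) $ p $ q"
    by simp
  then show ?thesis using nz by (simp add: diag_mat_mult_nth mult_diag_mat_nth)
qed

text \<open>The transition matrix commutes with \<open>diag_mat nu\<close>. Leaving
  \<open>nu\<close> free lets the same argument serve the Lax matrix and its spectral
  projections.\<close>

lemma Lax_levi_cong:
  assumes orth: "orthogonal_matrix Psi" "orthogonal_matrix Phi"
    and levi: "\<And>p q. (transpose Psi ** Phi) $ p $ q \<noteq> 0 \<Longrightarrow> nu p = nu q"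
  shows "Lax nu Phi = Lax nu Psi"
proof -
  define k where "k = transpose Psi ** Phi"
  have Phi: "Phi = Psi ** k" unfolding k_def using orth(1) by (simp add: matrix_mul_assoc orthogonal_matrix_def)
  have k: "k ** transpose k = mat 1"
  proof -
    have "orthogonal_matrix k" unfolding k_def by (intro orthogonal_matrix_mul) (simp_all add: orth)
    then show ?thesis by (simp add: orthogonal_matrix_def)
  qed
  have "k $ p $ q * nu q = nu p * k $ p $ q" for p q
    using levi[of p q] unfolding k_def[symmetric] by (cases "k $ p $ q = 0") auto
  then have comm: "k ** diag_mat nu = diag_mat nu ** k"
    by (simp add: vec_eq_iff diag_mat_mult_nth mult_diag_mat_nth)
  have "Lax nu Phi = Psi ** (k ** diag_mat nu) ** transpose k ** transpose Psi"
    by (simp add: Lax_def Phi matrix_transpose_mul matrix_mul_assoc)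
  also have "\<dots> = Psi ** diag_mat nu ** (k ** transpose k) ** transpose Psi"
    unfolding comm by (simp add: matrix_mul_assoc)
  finally show ?thesis by (simp add: k Lax_def)
qed

text \<open>The factor \<open>k\<close> is orthogonal, so its transpose is block upper triangular as
  well and \<open>k\<close> is block diagonal. Thus the Lax matrix depends only on the flag.\<close>

lemma Lax_btri_mult:
  assumes orth: "orthogonal_matrix Psi" "orthogonal_matrix (Psi ** k)" and k: "btri mu k" "invertible k"
  shows "Lax mu (Psi ** k) = Lax mu Psi"
proof (rule Lax_levi_cong[OF orth])
  fix p q
  have eq: "transpose Psi ** (Psi ** k) = k" using orth(1) by (simp add: matrix_mul_assoc orthogonal_matrix_def)
  have "orthogonal_matrix (transpose Psi ** (Psi ** k))"
    by (rule orthogonal_matrix_mul[OF _ orth(2)]) (simp add: orth)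
  then have "orthogonal_matrix k" by (simp only: eq)
  then have t: "btri mu (transpose k)" using btri_matrix_inv[OF k] matrix_inv_orthogonal by metis
  assume "(transpose Psi ** (Psi ** k)) $ p $ q \<noteq> 0"
  then have "k $ p $ q \<noteq> 0" unfolding eq .
  moreover from this have "transpose k $ q $ p \<noteq> 0" by (simp add: transpose_def)
  ultimately show "mu p = mu q" using k(1) t unfolding btri_def by (meson antisym)
qed

definition level :: "('n \<Rightarrow> real) \<Rightarrow> real \<Rightarrow> 'n \<Rightarrow> real" where
  "level mu c p = (if mu p \<le> c then 1 else 0)"

text \<open>The orthogonal projection onto the eigenspaces with eigenvalue at most \<open>c\<close>.
  It is independent of the diagonalisation chosen by \<open>spectral_Lax\<close>, and its continuity
  is obtained from compactness of the orthogonal group.\<close>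

definition spectral :: "('n \<Rightarrow> real) \<Rightarrow> real \<Rightarrow> 'n::finite rmat \<Rightarrow> 'n rmat" where
  "spectral mu c L = Lax (level mu c) (SOME Psi. orthogonal_matrix Psi \<and> Lax mu Psi = L)"

lemma spectral_Lax:
  assumes "orthogonal_matrix Psi" shows "spectral mu c (Lax mu Psi) = Lax (level mu c) Psi"
proof -
  define Phi where "Phi = (SOME Phi. orthogonal_matrix Phi \<and> Lax mu Phi = Lax mu Psi)"
  have "orthogonal_matrix Phi \<and> Lax mu Phi = Lax mu Psi"
    unfolding Phi_def by (rule someI[of _ Psi]) (simp add: assms)
  then have "Lax (level mu c) Phi = Lax (level mu c) Psi"
    using assms Lax_eqD[of Psi Phi mu] by (intro Lax_levi_cong) (auto simp: level_def)
  then show ?thesis by (simp add: spectral_def Phi_def)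
qed

lemma compact_orthogonal: "compact {Psi :: 'n::finite rmat. orthogonal_matrix Psi}"
proof -
  have "continuous_on UNIV (\<lambda>Psi :: 'n rmat. transpose Psi ** Psi)"
    unfolding continuous_on_def by (intro ballI tendsto_matrix_mult tendsto_transpose tendsto_ident_at)
  then have "closed ((\<lambda>Psi :: 'n rmat. transpose Psi ** Psi) -` {mat 1})"
    by (intro closed_vimage) auto
  moreover have "{Psi :: 'n rmat. orthogonal_matrix Psi} = (\<lambda>Psi. transpose Psi ** Psi) -` {mat 1}"
    by (auto simp: orthogonal_matrix)
  moreover have "bounded {Psi :: 'n rmat. orthogonal_matrix Psi}"
  proof (rule boundedI)
    fix Psi :: "'n rmat" assume "Psi \<in> {Psi. orthogonal_matrix Psi}"
    then have o: "norm (Psi $ p) = 1" for p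
      by (simp add: orthogonal_matrix_orthonormal_rows row_def vec_lambda_eta)
    have "norm Psi \<le> (\<Sum>p\<in>UNIV. norm (Psi $ p))"
      unfolding norm_vec_def by (rule L2_set_le_sum) simp
    then show "norm Psi \<le> real CARD('n)" by (simp add: o)
  qed
  ultimately show ?thesis by (simp add: compact_eq_bounded_closed)
qed

lemma continuous_on_Lax: "continuous_on S (Lax mu :: 'n::finite rmat \<Rightarrow> 'n rmat)"
  unfolding continuous_on_def by (intro ballI tendsto_Lax tendsto_ident_at)

text \<open>A continuous map from a compact space to a Hausdorff space is closed, hence a quotient
  map onto its image. Here it lets a function of \<open>Psi\<close> descend to a continuous function
  of \<open>Lax mu Psi\<close>.\<close>

lemma continuous_on_compact_quotient:
  fixes g :: "'a::t2_space \<Rightarrow> 'b::t2_space" and h :: "'a \<Rightarrow> 'c::t2_space"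
  assumes K: "compact K" and g: "continuous_on K g" and h: "continuous_on K h"
    and eq: "\<And>x. x \<in> K \<Longrightarrow> f (g x) = h x"
  shows "continuous_on (g ` K) f"
  unfolding continuous_on_closed
proof (intro allI impI)
  fix T assume "closedin (top_of_set (f ` g ` K)) T"
  then obtain C where C: "closed C" "T = f ` g ` K \<inter> C" by (auto simp: closedin_closed)
  have "g ` K \<inter> f -` T = g ` (K \<inter> h -` C)" using eq by (auto simp: C(2))
  moreover have "compact (g ` (K \<inter> h -` C))"
  proof (rule compact_continuous_image)
    obtain D where "closed D" "D \<inter> K = h -` C \<inter> K"
      using continuous_on_closed_invariant[THEN iffD1, OF h] C(1) by blast
    then show "compact (K \<inter> h -` C)" using K by (metis closed_Int_compact inf_commute)
    show "continuous_on (K \<inter> h -` C) g" using g by (rule continuous_on_subset) auto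
  qed
  ultimately show "closedin (top_of_set (g ` K)) (g ` K \<inter> f -` T)"
    by (intro closed_subset) (auto intro: compact_imp_closed)
qed

lemma continuous_on_spectral:
  "continuous_on (Lax mu ` {Psi :: 'n::finite rmat. orthogonal_matrix Psi}) (spectral mu c)"
  by (rule continuous_on_compact_quotient[OF compact_orthogonal continuous_on_Lax continuous_on_Lax])
     (simp add: spectral_Lax)

lemma matrix_inv_cramer:
  fixes A :: "'n::finite rmat"
  assumes "invertible A"
  shows "matrix_inv A $ k $ q = det (\<chi> i j. if j = k then axis q 1 $ i else A $ i $ j) / det A"
proof -
  have "A *v (matrix_inv A *v axis q 1) = axis q 1"
    by (simp add: matrix_vector_mul_assoc matrix_inv_right assms)
  then have "(matrix_inv A *v axis q 1) $ k = det (\<chi> i j. if j = k then axis q 1 $ i else A $ i $ j) / det A"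
    using cramer[of A "matrix_inv A *v axis q 1" "axis q 1"] assms by (simp add: invertible_det_nz)
  moreover have "(matrix_inv A *v axis q 1) $ k = matrix_inv A $ k $ q"
    by (subst matrix_vector_mult_basis) (simp add: column_def)
  ultimately show ?thesis by simp
qed

lemma continuous_on_matrix_inv:
  fixes f :: "'a::topological_space \<Rightarrow> 'n::finite rmat"
  assumes f: "continuous_on S f" and inv: "\<And>x. x \<in> S \<Longrightarrow> invertible (f x)"
  shows "continuous_on S (\<lambda>x. matrix_inv (f x))"
  unfolding continuous_on_def
proof (intro ballI tendsto_matrix_entries)
  fix x k q assume x: "x \<in> S"
  have fx: "(f \<longlongrightarrow> f x) (at x within S)" using f x by (simp add: continuous_on_def)
  have "((\<lambda>x. det (\<chi> i j. if j = k then axis q 1 $ i else f x $ i $ j) / det (f x)) \<longlongrightarrow>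
      det (\<chi> i j. if j = k then axis q 1 $ i else f x $ i $ j) / det (f x)) (at x within S)"
  proof (intro tendsto_divide tendsto_det fx)
    show "((\<lambda>x. \<chi> i j. if j = k then axis q 1 $ i else f x $ i $ j) \<longlongrightarrow>
      (\<chi> i j. if j = k then axis q 1 $ i else f x $ i $ j)) (at x within S)"
      by (rule tendsto_matrix_entries) (auto intro!: tendsto_vec_nth[OF tendsto_vec_nth[OF fx]])
    show "det (f x) \<noteq> 0" using inv[OF x] by (simp add: invertible_det_nz)
  qed
  moreover have "\<forall>\<^sub>F y in at x within S. det (\<chi> i j. if j = k then axis q 1 $ i else f y $ i $ j) / det (f y)
      = matrix_inv (f y) $ k $ q"
    using inv by (auto simp: eventually_at_filter matrix_inv_cramer)
  ultimately show "((\<lambda>y. matrix_inv (f y) $ k $ q) \<longlongrightarrow> matrix_inv (f x) $ k $ q) (at x within S)"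
    using matrix_inv_cramer[OF inv[OF x]] by (simp add: tendsto_cong)
qed

section \<open>The coordinates as functions of the Lax matrix\<close>

lemma diag_sandwich_nth: "(diag_mat d ** A ** diag_mat e) $ p $ q = d p * A $ p $ q * e q"
  by (simp add: mult_diag_mat_nth diag_mat_mult_nth)

lemma btri_level:
  assumes "btri f A"
  shows "diag_mat (level f c) ** A ** diag_mat (level f c) = A ** diag_mat (level f c)"
proof -
  have "level f c p * A $ p $ q * level f c q = A $ p $ q * level f c q" for p q
    using assms by (cases "A $ p $ q = 0") (auto simp: level_def btri_def, force)
  then show ?thesis unfolding vec_eq_iff mult_diag_mat_nth diag_mat_mult_nth by blast
qed

lemma btri_minus_level:
  assumes "btri (\<lambda>p. - f p) A"
  shows "diag_mat (level f c) ** A ** diag_mat (level f c) = diag_mat (level f c) ** A"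
proof -
  have "level f c p * A $ p $ q * level f c q = level f c p * A $ p $ q" for p q
    using assms by (cases "A $ p $ q = 0") (auto simp: level_def btri_def, force)
  then show ?thesis unfolding vec_eq_iff mult_diag_mat_nth diag_mat_mult_nth by blast
qed

text \<open>Column \<open>j\<close> of \<open>n = 1 + Z\<close> is the vector of the eigenvalue flag whose coordinates on the
  positions \<open>p\<close> with \<open>mu (s p) \<le> mu (s j)\<close> are those of the \<open>j\<close>-th unit vector. This singles it
  out as the solution of a linear system depending continuously on the Lax matrix.\<close>
definition level_system :: "('n \<Rightarrow> real) \<Rightarrow> ('n \<Rightarrow> 'n) \<Rightarrow> real \<Rightarrow> 'n::finite rmat \<Rightarrow> 'n rmat" where
  "level_system mu s c L = mat 1 - spectral mu c L + diag_mat (\<lambda>p. level mu c (s p))"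

definition coord :: "('n \<Rightarrow> real) \<Rightarrow> ('n \<Rightarrow> 'n) \<Rightarrow> 'n::finite rmat \<Rightarrow> 'n rmat" where
  "coord mu s L = (\<chi> p j. matrix_inv (level_system mu s (mu (s j)) L) $ p $ j) - mat 1"

text \<open>Here \<open>P\<close> projects onto the eigenspaces up to \<open>c\<close> and
  \<open>E\<close> onto the matching positions. The matrix \<open>n\<close> carries the image of
  \<open>E\<close> to that of \<open>P\<close> and is triangular with respect to \<open>E\<close>,
  so the image of \<open>P\<close> projects isomorphically to the image of \<open>E\<close>. For
  \<open>x\<close> in the kernel, \<open>x - P *v x = - (E *v x)\<close> is orthogonal to the image
  of \<open>P\<close> and lies in that of \<open>E\<close>, hence is 0; then \<open>x\<close> lies
  in the image of \<open>P\<close> with \<open>E *v x = 0\<close>, and is 0 too.\<close>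

lemma level_system_props:
  fixes Psi :: "'n::finite rmat"
  assumes s: "bij s" and orth: "orthogonal_matrix Psi" and k: "btri mu k" "invertible k"
    and Z: "Z \<in> supp {(p, q). mu (s q) < mu (s p)}" and inv: "invertible (mat 1 + Z)"
    and eq: "Psi ** k = (mat 1 + Z) ** Pm s"
  shows "invertible (level_system mu s c (Lax mu Psi))"
    and "coord mu s (Lax mu Psi) = Z"
proof -
  define n where "n = mat 1 + Z"
  have nb: "btri (\<lambda>p. - mu (s p)) n"
    unfolding n_def by (intro btri_add btri_mat1) (use Z in \<open>auto simp: supp_def btri_def less_imp_le\<close>)
  have ninv: "invertible n" using inv by (simp add: n_def)
  have main: "invertible (level_system mu s c (Lax mu Psi)) \<and>
      level_system mu s c (Lax mu Psi) ** n ** diag_mat (\<lambda>p. level mu c (s p))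
        = diag_mat (\<lambda>p. level mu c (s p)) ** n ** diag_mat (\<lambda>p. level mu c (s p))" for c
  proof -
    define D where "D = diag_mat (level mu c)"
    define E where "E = diag_mat (\<lambda>p. level mu c (s p))"
    define P where "P = Psi ** D ** transpose Psi"
    have PE: "Pm s ** D = E ** Pm s" unfolding D_def E_def by (rule Pm_diag_mat)
    have EE: "E ** E = E" unfolding E_def diag_mat_mult_diag_mat by (simp add: level_def if_distrib cong: if_cong)
    have N: "level_system mu s c (Lax mu Psi) = mat 1 - P + E"
      unfolding level_system_def spectral_Lax[OF orth] by (simp add: Lax_def P_def D_def E_def)
    have PsiT: "transpose Psi ** Psi = mat 1" "Psi ** transpose Psi = mat 1"
      using orth by (simp_all add: orthogonal_matrix_def)
    have nE: "n ** E = Psi ** k ** D ** Pm (inv s)"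
    proof -
      have "Psi ** k ** D ** Pm (inv s) = n ** (Pm s ** D) ** Pm (inv s)"
        by (simp add: eq n_def matrix_mul_assoc)
      also have "\<dots> = n ** E ** (Pm s ** Pm (inv s))" unfolding PE by (simp add: matrix_mul_assoc)
      finally show ?thesis by (simp add: Pm_inv_right s)
    qed
    have DkD: "D ** k ** D = k ** D" unfolding D_def by (rule btri_level[OF k(1)])
    have PnE: "P ** (n ** E) = n ** E"
    proof -
      have "P ** (n ** E) = Psi ** D ** (transpose Psi ** Psi) ** k ** D ** Pm (inv s)"
        by (simp add: P_def nE matrix_mul_assoc)
      also have "\<dots> = Psi ** (D ** k ** D) ** Pm (inv s)" by (simp add: PsiT matrix_mul_assoc)
      finally show ?thesis unfolding DkD nE by (simp add: matrix_mul_assoc)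
    qed
    have E_T: "transpose E = E" and P_T: "transpose P = P"
      by (simp_all add: E_def P_def D_def matrix_transpose_mul matrix_mul_assoc)
    have lev: "level (\<lambda>p. mu (s p)) c = (\<lambda>p. level mu c (s p))" by (simp add: level_def fun_eq_iff)
    have EnE: "E ** n ** E = E ** n"
      unfolding E_def using btri_minus_level[of "\<lambda>p. mu (s p)" n c] nb by (simp add: lev)
    have EniE: "E ** matrix_inv n ** E = E ** matrix_inv n"
      unfolding E_def using btri_minus_level[of "\<lambda>p. mu (s p)" "matrix_inv n" c] btri_matrix_inv[OF nb ninv]
      by (simp add: lev)
    have "invertible (mat 1 - P + E)"
      unfolding invertible_inj
    proof (intro allI impI)
      fix x assume x0: "(mat 1 - P + E) *v x = 0"
      have xP: "x - P *v x = - (E *v x)"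
        using x0 by (simp add: matrix_vector_mult_add_rdistrib matrix_vector_mult_diff_rdistrib eq_neg_iff_add_eq_0)
      define w where "w = x - P *v x"
      have nET: "transpose n ** E = E ** transpose n ** E"
        using arg_cong[OF EnE, of transpose] by (simp add: matrix_transpose_mul E_T matrix_mul_assoc)
      have EnP: "E ** transpose n ** P = E ** transpose n"
        using arg_cong[OF PnE, of transpose] by (simp add: matrix_transpose_mul E_T P_T)
      have Enw: "(E ** transpose n) *v w = 0"
      proof -
        have "(E ** transpose n) *v w = (E ** transpose n) *v x - (E ** transpose n ** P) *v x"
          by (simp add: w_def matrix_vector_mult_diff_distrib matrix_vector_mul_assoc)
        then show ?thesis by (simp add: EnP)
      qed
      have wE: "E *v w = w"
      proof -
        have "E *v w = - ((E ** E) *v x)"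
          by (simp add: w_def xP matrix_vector_mul_assoc[symmetric] linear_neg[OF matrix_vector_mul_linear])
        then show ?thesis by (simp add: EE w_def xP)
      qed
      have "transpose n *v w = (transpose n ** E) *v w" by (simp add: matrix_vector_mul_assoc[symmetric] wE)
      also have "\<dots> = (E ** transpose n) *v (E *v w)" unfolding nET by (simp add: matrix_vector_mul_assoc)
      finally have "transpose n *v w = 0" by (simp add: wE Enw)
      then have "w = 0" using transpose_invertible[OF ninv] invertible_inj by blast
      then have Ex: "E *v x = 0" and Px: "P *v x = x" using xP by (simp_all add: w_def)
      define y where "y = matrix_inv n *v x"
      have Ey: "E *v y = 0"
      proof -
        have "E *v y = (E ** matrix_inv n) *v x" by (simp add: y_def matrix_vector_mul_assoc)
        also have "\<dots> = (E ** matrix_inv n) *v (E *v x)"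
          by (simp add: matrix_vector_mul_assoc EniE)
        finally show ?thesis by (simp add: Ex)
      qed
      \<comment> \<open>The inverse of \<open>n\<close> takes the image of \<open>P\<close> back
        into the image of \<open>E\<close>.\<close>
      have EniP: "E ** matrix_inv n ** P = matrix_inv n ** P"
      proof -
        have "matrix_inv n ** Psi = Pm s ** matrix_inv k"
        proof -
          have "n ** (Pm s ** matrix_inv k) = Psi ** (k ** matrix_inv k)"
            by (simp add: eq[folded n_def] matrix_mul_assoc)
          then have "n ** (Pm s ** matrix_inv k) = Psi" by (simp add: matrix_inv_right k)
          then have "matrix_inv n ** (n ** (Pm s ** matrix_inv k)) = matrix_inv n ** Psi" by simp
          then show ?thesis by (simp add: matrix_mul_assoc matrix_inv_left ninv)
        qed
        then have niP: "matrix_inv n ** P = Pm s ** (matrix_inv k ** D) ** transpose Psi"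
          by (simp add: P_def matrix_mul_assoc)
        have DkiD: "matrix_inv k ** D = D ** matrix_inv k ** D"
          unfolding D_def by (rule btri_level[OF btri_matrix_inv[OF k], symmetric])
        have "E ** (matrix_inv n ** P) = (E ** Pm s) ** (matrix_inv k ** D) ** transpose Psi"
          unfolding niP by (simp add: matrix_mul_assoc)
        also have "\<dots> = Pm s ** (D ** matrix_inv k ** D) ** transpose Psi"
          unfolding PE[symmetric] by (simp add: matrix_mul_assoc)
        also have "\<dots> = matrix_inv n ** P" by (simp add: DkiD[symmetric] niP)
        finally show ?thesis by (simp add: matrix_mul_assoc)
      qed
      have "y = (matrix_inv n ** P) *v x" by (simp add: y_def matrix_vector_mul_assoc[symmetric] Px)
      also have "\<dots> = E *v ((matrix_inv n ** P) *v x)"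
        by (subst EniP[symmetric]) (simp add: matrix_vector_mul_assoc matrix_mul_assoc)
      also have "\<dots> = E *v y" by (simp add: y_def matrix_vector_mul_assoc[symmetric] Px)
      finally have "y = 0" using Ey by simp
      moreover have "x = n *v y" by (simp add: y_def matrix_vector_mul_assoc matrix_inv_right ninv)
      ultimately show "x = 0" by simp
    qed
    moreover have "(mat 1 - P + E) ** n ** E = E ** n ** E"
      using PnE by (simp add: matrix_mult_add_left matrix_mult_diff_left matrix_mul_assoc[symmetric])
    ultimately show ?thesis unfolding N E_def by simp
  qed
  show "invertible (level_system mu s c (Lax mu Psi))" using main by blast
  have "matrix_inv (level_system mu s (mu (s j)) (Lax mu Psi)) $ p $ j = n $ p $ j" for p j
  proof -
    define N where "N = level_system mu s (mu (s j)) (Lax mu Psi)"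
    define E where "E = diag_mat (\<lambda>p. level mu (mu (s j)) (s p))"
    have N: "invertible N" "N ** n ** E = E ** n ** E" using main[of "mu (s j)"] by (simp_all add: N_def E_def)
    \<comment> \<open>In column \<open>j\<close> the matrix \<open>Z\<close> is supported on rows
      with \<open>mu (s p)\<close> above \<open>mu (s j)\<close>, and \<open>E\<close> removes
      exactly those.\<close>
    have "(E ** n ** E) $ q $ j = mat 1 $ q $ j" for q
      using Z by (auto simp: E_def diag_sandwich_nth level_def n_def mat_def supp_def) (meson leD)
    moreover have "(N ** n ** E) $ q $ j = (N ** n) $ q $ j" for q
      by (simp add: E_def mult_diag_mat_nth level_def)
    ultimately have col: "(N ** n) $ q $ j = mat 1 $ q $ j" for q using N(2) by metis
    have "n = matrix_inv N ** (N ** n)" by (simp add: matrix_mul_assoc matrix_inv_left N(1))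
    then have "n $ p $ j = (\<Sum>q\<in>UNIV. matrix_inv N $ p $ q * (N ** n) $ q $ j)"
      by (metis matrix_mult_nth)
    also have "\<dots> = (\<Sum>q\<in>UNIV. matrix_inv N $ p $ q * (mat 1 :: 'n rmat) $ q $ j)" by (simp only: col)
    also have "\<dots> = (matrix_inv N ** mat 1) $ p $ j" by (rule matrix_mult_nth[symmetric])
    finally show ?thesis by (simp add: N_def)
  qed
  then show "coord mu s (Lax mu Psi) = Z" by (simp add: coord_def vec_eq_iff n_def)
qed

text \<open>The open Richardson variety of the two words, realised by symmetric matrices.\<close>

definition rich :: "('n \<Rightarrow> real) \<Rightarrow> ('n \<Rightarrow> 'n) \<Rightarrow> ('n \<Rightarrow> 'n) \<Rightarrow> ('n::{finite,linorder}) rmat set" where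
  "rich mu s s' = {Lax mu Psi |Psi. orthogonal_matrix Psi \<and> cell mu s Psi \<and> cell (\<lambda>p. - mu p) s' Psi}"

definition chart_zero :: "('n \<Rightarrow> real) \<Rightarrow> ('n \<Rightarrow> 'n) \<Rightarrow> ('n \<Rightarrow> 'n) \<Rightarrow> (('n::{finite,linorder}) rmat \<times> 'n rmat \<times> 'n rmat) set" where
  "chart_zero mu s s' = {v \<in> chart_space mu s s'. chart_eq s s' v = 0}"

text \<open>Transposing around \<open>GS\<close> orthonormalises columns, so by
  \<open>column_GS\<close> the orthogonal matrix represents the same flag as the normal
  form.\<close>

definition chart_lax :: "('n \<Rightarrow> real) \<Rightarrow> ('n \<Rightarrow> 'n) \<Rightarrow> ('n::{finite,linorder}) rmat \<times> 'n rmat \<times> 'n rmat \<Rightarrow> 'n rmat" where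
  "chart_lax mu s v = Lax mu (transpose (GS (transpose ((mat 1 + snd (snd v)) ** Pm s))))"

definition lax_chart :: "('n \<Rightarrow> real) \<Rightarrow> ('n \<Rightarrow> 'n) \<Rightarrow> ('n \<Rightarrow> 'n) \<Rightarrow> ('n::{finite,linorder}) rmat \<Rightarrow> 'n rmat \<times> 'n rmat \<times> 'n rmat" where
  "lax_chart mu s s' L = (coord mu s' L,
     matrix_inv ((mat 1 + coord mu s' L) ** Pm s') ** ((mat 1 + coord mu s L) ** Pm s), coord mu s L)"

text \<open>Invertibility of \<open>h\<close> is a consequence of the equation, since the other
  factors are unipotent or permutations.\<close>

lemma chart_zeroD:
  assumes s: "bij s" "bij s'" and v: "v \<in> chart_zero mu s s'"
  obtains Z' h Z where "v = (Z', h, Z)" "Z' \<in> supp {(p, q). mu (s' q) < mu (s' p) \<and> up p < up q}"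
    "btri mu h" "invertible h" "Z \<in> supp {(p, q). mu (s q) < mu (s p) \<and> low p < low q}"
    "(mat 1 + Z') ** Pm s' ** h = (mat 1 + Z) ** Pm s" "invertible (mat 1 + Z)" "invertible (mat 1 + Z')"
proof -
  obtain Z' h Z where vdef: "v = (Z', h, Z)" by (metis prod.collapse)
  have *: "Z' \<in> supp {(p, q). mu (s' q) < mu (s' p) \<and> up p < up q}" "btri mu h"
    "Z \<in> supp {(p, q). mu (s q) < mu (s p) \<and> low p < low q}"
    "(mat 1 + Z') ** Pm s' ** h = (mat 1 + Z) ** Pm s"
    using v by (auto simp: chart_zero_def vdef chart_space_def chart_eq_def btri_iff_supp)
  have i: "invertible (mat 1 + Z)" "invertible (mat 1 + Z')"
    using one_plus_supp(3)[OF inj_low *(3)] one_plus_supp(3)[OF inj_up *(1)] by auto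
  have "invertible ((mat 1 + Z') ** Pm s' ** h)"
    unfolding *(4) by (intro invertible_mult i invertible_Pm s)
  then have "invertible h"
    using invertible_mult_left[of "(mat 1 + Z') ** Pm s'" h] invertible_mult[OF i(2) invertible_Pm[OF s(2)]] by blast
  then show ?thesis using that vdef * i by blast
qed

lemma chart_lax_props:
  assumes mono: "\<And>p q. p \<le> q \<Longrightarrow> mu p \<le> mu q" and s: "bij s" "bij s'" and v: "v \<in> chart_zero mu s s'"
  shows "chart_lax mu s v \<in> rich mu s s'" and "lax_chart mu s s' (chart_lax mu s v) = v"
proof -
  obtain Z' h Z where *: "v = (Z', h, Z)" "Z' \<in> supp {(p, q). mu (s' q) < mu (s' p) \<and> up p < up q}"
    "btri mu h" "invertible h" "Z \<in> supp {(p, q). mu (s q) < mu (s p) \<and> low p < low q}"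
    "(mat 1 + Z') ** Pm s' ** h = (mat 1 + Z) ** Pm s" "invertible (mat 1 + Z)" "invertible (mat 1 + Z')"
    by (rule chart_zeroD[OF s v])
  define M where "M = (mat 1 + Z) ** Pm s"
  have M: "invertible M" unfolding M_def by (intro invertible_mult * invertible_Pm s)
  obtain k where k: "orthogonal_matrix (M ** k)" "btri up k" "invertible k" "M ** k = transpose (GS (transpose M))"
    by (rule column_GS[OF M])
  have kmu: "btri mu k" by (rule btri_mono[OF k(2) mono])
  define Psi where "Psi = M ** k"
  have L: "chart_lax mu s v = Lax mu Psi" unfolding chart_lax_def Psi_def k(4) unfolding M_def *(1) by simp
  have "unilow (mat 1 + Z)"
    using one_plus_supp(1,2)[OF inj_low *(5)] by (simp only: unilow_def) simp
  then have "cell mu s Psi" unfolding cell_def using kmu k(3) Psi_def M_def by blast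
  moreover have "unilow (transpose (mat 1 + Z'))"
    unfolding unilow_def btri_low_transpose
    using one_plus_supp(1,2)[OF inj_up *(2)] by (simp add: transpose_def)
  then have "cell (\<lambda>p. - mu p) s' Psi"
    unfolding cell_opposite_iff[OF k(1)[folded Psi_def] s(2)]
    using btri_mult[OF *(3) kmu] invertible_mult[OF *(4) k(3)] *(6)
    by (intro exI[of _ "mat 1 + Z'"] exI[of _ "h ** k"]) (simp add: Psi_def M_def matrix_mul_assoc)
  ultimately show "chart_lax mu s v \<in> rich mu s s'"
    unfolding rich_def L using k(1) Psi_def by blast
  have ki: "btri mu (matrix_inv k)" "invertible (matrix_inv k)"
    by (intro btri_matrix_inv kmu invertible_matrix_inv k)+
  have Z: "Z \<in> supp {(p, q). mu (s q) < mu (s p)}" and Z': "Z' \<in> supp {(p, q). mu (s' q) < mu (s' p)}"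
    using *(2,5) by (auto simp: supp_def)
  have e1: "Psi ** matrix_inv k = (mat 1 + Z) ** Pm s"
    unfolding Psi_def M_def[symmetric] by (metis k(3) matrix_inv_right matrix_mul_assoc matrix_mul_rid)
  have cZ: "coord mu s (Lax mu Psi) = Z"
    by (rule level_system_props(2)[OF s(1) k(1)[folded Psi_def] ki Z *(7) e1])
  have e2: "Psi ** (matrix_inv k ** matrix_inv h) = (mat 1 + Z') ** Pm s'"
    unfolding matrix_mul_assoc e1 *(6)[symmetric]
    by (metis *(4) matrix_inv_right matrix_mul_assoc matrix_mul_rid)
  have cZ': "coord mu s' (Lax mu Psi) = Z'"
    by (rule level_system_props(2)[OF s(2) k(1)[folded Psi_def] _ _ Z' *(8) e2])
       (intro btri_mult ki btri_matrix_inv invertible_mult invertible_matrix_inv *)+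
  have "matrix_inv ((mat 1 + Z') ** Pm s') ** ((mat 1 + Z) ** Pm s) = h"
    unfolding *(6)[symmetric]
    unfolding matrix_mul_assoc[of _ "(mat 1 + Z') ** Pm s'" h]
      matrix_inv_left[OF invertible_mult[OF *(8) invertible_Pm[OF s(2)]]] by simp
  then show "lax_chart mu s s' (chart_lax mu s v) = v"
    unfolding L lax_chart_def cZ cZ' by (simp add: *(1))
qed

text \<open>Each description of \<open>Psi\<close> is brought to normal form on the right, by
  \<open>k\<close> and by \<open>k'\<close>. Comparing the two gives the middle coordinate
  \<open>matrix_inv k' ** k\<close>, and orthonormalising columns returns to the flag of
  \<open>Psi\<close>.\<close>

lemma rich_chart:
  assumes mono: "\<And>p q. p \<le> q \<Longrightarrow> mu p \<le> mu q" and s: "bij s" "bij s'" and L: "L \<in> rich mu s s'"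
  shows "\<exists>v \<in> chart_zero mu s s'. chart_lax mu s v = L"
    and "invertible (level_system mu s c L)" and "invertible (level_system mu s' c L)"
    and "invertible ((mat 1 + coord mu s' L) ** Pm s')"
proof -
  obtain Psi where Psi: "L = Lax mu Psi" "orthogonal_matrix Psi" "cell mu s Psi" "cell (\<lambda>p. - mu p) s' Psi"
    using L unfolding rich_def by blast
  obtain l h0 where l: "unilow l" "btri mu h0" "invertible h0" "Psi = l ** Pm s ** h0"
    using Psi(3) unfolding cell_def by blast
  obtain u h1 where u: "unilow (transpose u)" "btri mu h1" "invertible h1" "Psi = u ** Pm s' ** h1"
    using Psi(4) unfolding cell_opposite_iff[OF Psi(2) s(2)] by blast
  have ui: "btri up u" "invertible u"
    using u(1) transpose_invertible[OF unilow_invertible[OF u(1)]] by (auto simp: unilow_def btri_low_transpose)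
  have li: "btri low l" "invertible l" using l(1) unilow_invertible by (auto simp: unilow_def)
  obtain Z H where Z: "Z \<in> supp {(p, q). mu (s q) < mu (s p) \<and> low p < low q}"
      "btri mu H" "invertible H" "(mat 1 + Z) ** Pm s = l ** Pm s ** H"
    by (rule cell_normal_form[OF inj_low li s(1)])
  obtain Z' H' where Z': "Z' \<in> supp {(p, q). mu (s' q) < mu (s' p) \<and> up p < up q}"
      "btri mu H'" "invertible H'" "(mat 1 + Z') ** Pm s' = u ** Pm s' ** H'"
    by (rule cell_normal_form[OF inj_up ui s(2)])
  define k where "k = matrix_inv h0 ** H"
  define k' where "k' = matrix_inv h1 ** H'"
  have k: "btri mu k" "invertible k" unfolding k_def
    by (intro btri_mult btri_matrix_inv l Z invertible_mult invertible_matrix_inv)+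
  have k': "btri mu k'" "invertible k'" unfolding k'_def
    by (intro btri_mult btri_matrix_inv u Z' invertible_mult invertible_matrix_inv)+
  have e: "Psi ** k = (mat 1 + Z) ** Pm s"
    unfolding k_def l(4) Z(4) by (metis l(3) matrix_inv_right matrix_mul_assoc matrix_mul_rid)
  have e': "Psi ** k' = (mat 1 + Z') ** Pm s'"
    unfolding k'_def u(4) Z'(4) by (metis u(3) matrix_inv_right matrix_mul_assoc matrix_mul_rid)
  have Zi: "invertible (mat 1 + Z)" "invertible (mat 1 + Z')"
    using one_plus_supp(3)[OF inj_low Z(1)] one_plus_supp(3)[OF inj_up Z'(1)] by auto
  have Zs: "Z \<in> supp {(p, q). mu (s q) < mu (s p)}" "Z' \<in> supp {(p, q). mu (s' q) < mu (s' p)}"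
    using Z(1) Z'(1) by (auto simp: supp_def)
  show "invertible (level_system mu s c L)" unfolding Psi(1)
    by (rule level_system_props(1)[OF s(1) Psi(2) k Zs(1) Zi(1) e])
  show "invertible (level_system mu s' c L)" unfolding Psi(1)
    by (rule level_system_props(1)[OF s(2) Psi(2) k' Zs(2) Zi(2) e'])
  have "coord mu s' L = Z'" unfolding Psi(1)
    by (rule level_system_props(2)[OF s(2) Psi(2) k' Zs(2) Zi(2) e'])
  then show "invertible ((mat 1 + coord mu s' L) ** Pm s')"
    using Zi(2) by (simp add: invertible_mult invertible_Pm s)
  define h where "h = matrix_inv k' ** k"
  have h: "btri mu h" unfolding h_def by (intro btri_mult btri_matrix_inv k k')
  have "(mat 1 + Z') ** Pm s' ** h = (mat 1 + Z) ** Pm s"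
    unfolding h_def e[symmetric] e'[symmetric] by (metis k'(2) matrix_inv_right matrix_mul_assoc matrix_mul_rid)
  then have v: "(Z', h, Z) \<in> chart_zero mu s s'"
    using Z(1) Z'(1) h by (simp add: chart_zero_def chart_space_def chart_eq_def btri_iff_supp)
  define M where "M = (mat 1 + Z) ** Pm s"
  have M: "invertible M" unfolding M_def by (intro invertible_mult Zi invertible_Pm s)
  obtain j where j: "orthogonal_matrix (M ** j)" "btri up j" "invertible j" "M ** j = transpose (GS (transpose M))"
    by (rule column_GS[OF M])
  have "chart_lax mu s (Z', h, Z) = Lax mu (Psi ** (k ** j))"
    by (simp add: chart_lax_def j(4)[symmetric] M_def[symmetric]) (simp add: M_def e[symmetric] matrix_mul_assoc)
  also have "\<dots> = L" unfolding Psi(1)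
  proof (rule Lax_btri_mult[OF Psi(2)])
    show "orthogonal_matrix (Psi ** (k ** j))" using j(1) by (simp add: M_def e[symmetric] matrix_mul_assoc)
    show "btri mu (k ** j)" by (intro btri_mult k btri_mono[OF j(2) mono])
    show "invertible (k ** j)" by (intro invertible_mult k j)
  qed
  finally show "\<exists>v \<in> chart_zero mu s s'. chart_lax mu s v = L" using v by blast
qed

lemma continuous_on_coord:
  fixes s :: "'n::{finite,linorder} \<Rightarrow> 'n"
  assumes S: "S \<subseteq> Lax mu ` {Psi :: 'n rmat. orthogonal_matrix Psi}"
    and inv: "\<And>c L. L \<in> S \<Longrightarrow> invertible (level_system mu s c L)"
  shows "continuous_on S (coord mu s)"
proof -
  have "continuous_on S (level_system mu s c)" for c
    unfolding level_system_def[abs_def]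
    by (intro continuous_intros continuous_on_subset[OF continuous_on_spectral S])
  then have "continuous_on S (\<lambda>L. matrix_inv (level_system mu s c L))" for c
    by (rule continuous_on_matrix_inv) (rule inv)
  then have "continuous_on S (\<lambda>L. matrix_inv (level_system mu s c L) $ p $ j)" for c p j
    by (intro continuous_intros)
  then show ?thesis
    unfolding coord_def[abs_def] by (intro continuous_on_diff continuous_on_const continuous_on_vec_lambda)
qed

lemma rich_homeomorphic:
  fixes s s' :: "'n::{finite,linorder} \<Rightarrow> 'n"
  assumes mono: "\<And>p q. p \<le> q \<Longrightarrow> mu p \<le> mu q" and s: "bij s" "bij s'"
  shows "homeomorphic_maps (top_of_set (rich mu s s')) (top_of_set (chart_zero mu s s'))
    (lax_chart mu s s') (chart_lax mu s)"
proof -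
  have fw: "chart_lax mu s v \<in> rich mu s s'" "lax_chart mu s s' (chart_lax mu s v) = v"
    if "v \<in> chart_zero mu s s'" for v
    using chart_lax_props[of mu s s' v] mono s that by blast+
  have bw: "\<exists>v \<in> chart_zero mu s s'. chart_lax mu s v = L"
    "invertible (level_system mu s c L)" "invertible (level_system mu s' c L)"
    "invertible ((mat 1 + coord mu s' L) ** Pm s')" if "L \<in> rich mu s s'" for c L
    using rich_chart[of mu s s' L] mono s that by blast+
  have sub: "rich mu s s' \<subseteq> Lax mu ` {Psi. orthogonal_matrix Psi}" by (auto simp: rich_def)
  have c: "continuous_on (rich mu s s') (coord mu s)" "continuous_on (rich mu s s') (coord mu s')"
    using bw(2,3) by (auto intro!: continuous_on_coord[OF sub])
  have "continuous_on (rich mu s s') (\<lambda>L. matrix_inv ((mat 1 + coord mu s' L) ** Pm s'))"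
    by (intro continuous_on_matrix_inv continuous_on_matrix_mult continuous_intros c) (rule bw(4))
  then have cont1: "continuous_on (rich mu s s') (lax_chart mu s s')"
    unfolding lax_chart_def[abs_def] by (intro continuous_intros continuous_on_matrix_mult c)
  have cont2: "continuous_on (chart_zero mu s s') (chart_lax mu s)"
    unfolding continuous_on_def
  proof
    fix v assume v: "v \<in> chart_zero mu s s'"
    obtain Z' h Z where *: "v = (Z', h, Z)" "invertible (mat 1 + Z)" using chart_zeroD[OF s v] by metis
    show "(chart_lax mu s \<longlongrightarrow> chart_lax mu s v) (at v within chart_zero mu s s')"
      unfolding chart_lax_def[abs_def]
    proof (intro tendsto_Lax tendsto_transpose tendsto_GS tendsto_matrix_mult tendsto_intros)
      show "invertible (transpose ((mat 1 + snd (snd v)) ** Pm s))"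
        by (intro transpose_invertible invertible_mult invertible_Pm s) (use * in simp)
    qed
  qed
  have inv1: "chart_lax mu s (lax_chart mu s s' L) = L" "lax_chart mu s s' L \<in> chart_zero mu s s'"
    if L: "L \<in> rich mu s s'" for L
  proof -
    obtain v where v: "v \<in> chart_zero mu s s'" "chart_lax mu s v = L" using bw(1)[OF L] by blast
    then have "lax_chart mu s s' L = v" using fw(2)[OF v(1)] by simp
    then show "chart_lax mu s (lax_chart mu s s' L) = L" "lax_chart mu s s' L \<in> chart_zero mu s s'"
      using v by auto
  qed
  have "homeomorphism (rich mu s s') (chart_zero mu s s') (lax_chart mu s s') (chart_lax mu s)"
    by (rule homeomorphismI[OF cont1 cont2]) (use inv1 fw in auto)
  then show ?thesis by (rule homeomorphism_imp_homeomorphic_maps)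
qed

lemma rich_manifold:
  fixes s s' :: "'n::{finite,linorder} \<Rightarrow> 'n"
  assumes mono: "\<And>p q. p \<le> q \<Longrightarrow> mu p \<le> mu q" and s: "bij s" "bij s'"
    and psi: "\<And>p q. mu (s p) < mu (s q) \<longleftrightarrow> psi p < psi q"
    and omega: "\<And>p q. mu (s' p) < mu (s' q) \<longleftrightarrow> omega p < omega q"
    and d: "invs omega = invs psi + d"
  shows "manifold_dim (top_of_set (rich mu s s')) d"
proof (rule manifold_dim_homeomorphic)
  show "homeomorphic_maps (top_of_set (rich mu s s')) (top_of_set (chart_zero mu s s'))
      (lax_chart mu s s') (chart_lax mu s)"
    by (rule rich_homeomorphic[OF mono s])
  show "manifold_dim (top_of_set (chart_zero mu s s')) d"
    unfolding chart_zero_def by (rule chart_manifold[where psi=psi and omega=omega, OF s psi omega d])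
qed

section \<open>The flag manifold as an isospectral orbit\<close>

lemma openin_FlI_top:
  fixes U :: "('n::{finite,linorder}) rmat set set"
  shows "openin (FlI_top I) U \<longleftrightarrow> U \<subseteq> FlI I \<and> openin (top_of_set SOn) {Psi \<in> SOn. coset I Psi \<in> U}"
proof -
  have "istopology (\<lambda>U :: 'n rmat set set. U \<subseteq> FlI I \<and> openin (top_of_set SOn) {Psi \<in> SOn. coset I Psi \<in> U})"
    unfolding istopology_def
  proof (intro conjI allI impI)
    fix S T :: "'n rmat set set"
    assume "S \<subseteq> FlI I \<and> openin (top_of_set SOn) {Psi \<in> SOn. coset I Psi \<in> S}"
      and "T \<subseteq> FlI I \<and> openin (top_of_set SOn) {Psi \<in> SOn. coset I Psi \<in> T}"
    moreover have "{Psi \<in> SOn. coset I Psi \<in> S \<inter> T} = {Psi \<in> SOn. coset I Psi \<in> S} \<inter> {Psi \<in> SOn. coset I Psi \<in> T}"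
      by auto
    ultimately show "S \<inter> T \<subseteq> FlI I" "openin (top_of_set SOn) {Psi \<in> SOn. coset I Psi \<in> S \<inter> T}"
      by (auto intro: openin_Int)
  next
    fix K :: "'n rmat set set set" assume K: "\<forall>S\<in>K. S \<subseteq> FlI I \<and> openin (top_of_set SOn) {Psi \<in> SOn. coset I Psi \<in> S}"
    then show "\<Union>K \<subseteq> FlI I" by blast
    have "{Psi \<in> SOn. coset I Psi \<in> \<Union>K} = (\<Union>S\<in>K. {Psi \<in> SOn. coset I Psi \<in> S})" by auto
    then show "openin (top_of_set SOn) {Psi \<in> SOn. coset I Psi \<in> \<Union>K}"
      using K by (auto intro!: openin_Union)
  qed
  then show ?thesis unfolding FlI_top_def by (simp add: topology_inverse')
qed

lemma topspace_FlI_top: "topspace (FlI_top I :: ('n::{finite,linorder}) rmat set topology) = FlI I"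
proof
  show "topspace (FlI_top I :: 'n rmat set topology) \<subseteq> FlI I"
    using openin_FlI_top[of I "topspace (FlI_top I :: 'n rmat set topology)"] by simp
  have "{Psi :: 'n rmat. Psi \<in> SOn \<and> coset I Psi \<in> FlI I} = SOn" by (auto simp: FlI_def)
  then have "openin (FlI_top I) (FlI I :: 'n rmat set set)" by (simp add: openin_FlI_top)
  then show "FlI I \<subseteq> topspace (FlI_top I :: 'n rmat set topology)" by (rule openin_subset)
qed

section \<open>The groups of the quotient and their cosets\<close>

lemma SOn_D: "Psi \<in> SOn \<Longrightarrow> orthogonal_matrix Psi" "Psi \<in> SOn \<Longrightarrow> det Psi = 1"
  by (auto simp: SOn_def)

lemma SOn_mult: "A \<in> SOn \<Longrightarrow> B \<in> SOn \<Longrightarrow> A ** B \<in> SOn"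
  by (simp add: SOn_def orthogonal_matrix_mul det_mul)

lemma SOn_transpose: "A \<in> SOn \<Longrightarrow> transpose A \<in> SOn"
  by (simp add: SOn_def)

lemma Gsub_mult: "g \<in> Gsub I \<Longrightarrow> h \<in> Gsub I \<Longrightarrow> g ** h \<in> Gsub I"
proof -
  assume g: "g \<in> Gsub I" and h: "h \<in> Gsub I"
  have "(g ** h) $ p $ q = 0" if "std_block I p \<noteq> std_block I q" for p q
    unfolding matrix_mult_nth
  proof (rule sum.neutral, intro ballI)
    fix r show "g $ p $ r * h $ r $ q = 0"
      using g h that by (cases "std_block I p = std_block I r") (auto simp: Gsub_def)
  qed
  then show ?thesis using g h by (simp add: Gsub_def SOn_mult)
qed

lemma Gsub_transpose: "g \<in> Gsub I \<Longrightarrow> transpose g \<in> Gsub I"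
  unfolding Gsub_def by (auto simp: SOn_transpose) (simp add: transpose_def)

lemma coset_mult_Gsub:
  assumes g: "g \<in> Gsub I" shows "coset I (Psi ** g) = coset I Psi"
proof -
  have gt: "transpose g \<in> Gsub I" "g ** transpose g = mat 1"
    using g Gsub_transpose by (auto simp: Gsub_def SOn_def orthogonal_matrix_def)
  show ?thesis
  proof (intro equalityI subsetI)
    fix x assume "x \<in> coset I (Psi ** g)"
    then obtain h where "h \<in> Gsub I" "x = Psi ** g ** h" by (auto simp: coset_def)
    then show "x \<in> coset I Psi" using Gsub_mult[OF g] by (auto simp: coset_def matrix_mul_assoc[symmetric])
  next
    fix x assume "x \<in> coset I Psi"
    then obtain h where h: "h \<in> Gsub I" "x = Psi ** h" by (auto simp: coset_def)
    have "x = Psi ** g ** (transpose g ** h)"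
      by (metis gt(2) h(2) matrix_mul_assoc matrix_mul_rid)
    then show "x \<in> coset I (Psi ** g)" using Gsub_mult[OF gt(1) h(1)] by (auto simp: coset_def)
  qed
qed

lemma coset_self: "Psi \<in> coset I Psi"
proof -
  have "mat 1 \<in> Gsub I" by (auto simp: Gsub_def SOn_def orthogonal_matrix_id) (auto simp: mat_def)
  then show ?thesis unfolding coset_def by force
qed

lemma cell_mult_diag:
  assumes "cell f s Psi" "\<And>p. e p \<noteq> 0" shows "cell f s (Psi ** diag_mat e)"
proof -
  obtain l h where *: "unilow l" "btri f h" "invertible h" "Psi = l ** Pm s ** h"
    using assms(1) unfolding cell_def by blast
  have "btri f (h ** diag_mat e)" "invertible (h ** diag_mat e)"
    using * assms(2) by (auto intro: btri_mult invertible_mult invertible_diag_mat)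
  moreover have "Psi ** diag_mat e = l ** Pm s ** (h ** diag_mat e)" by (simp add: *(4) matrix_mul_assoc)
  ultimately show ?thesis unfolding cell_def using *(1) by blast
qed

text \<open>Changing the sign of one column corrects the determinant. A diagonal sign matrix
  commutes with every \<open>diag_mat nu\<close> and belongs to P, so it affects neither the Lax
  matrix nor the cells.\<close>

lemma SOn_adjust:
  fixes Psi :: "('n::{finite,linorder}) rmat"
  assumes orth: "orthogonal_matrix Psi"
  obtains e where "\<forall>p. e p \<noteq> 0" "Psi ** diag_mat e \<in> SOn" "\<forall>nu. Lax nu (Psi ** diag_mat e) = Lax nu Psi"
proof -
  define p0 :: 'n where "p0 = undefined"
  define e where "e p = (if p = p0 then det Psi else 1)" for p
  have d: "det Psi = 1 \<or> det Psi = -1" by (rule det_orthogonal_matrix[OF orth])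
  then have ee: "e p * e p = 1" for p by (auto simp: e_def)
  have orthE: "orthogonal_matrix (diag_mat e)"
    by (simp add: orthogonal_matrix diag_mat_mult_diag_mat ee diag_mat_one)
  have "det (diag_mat e) = (\<Prod>p\<in>UNIV. diag_mat e $ p $ p)"
    by (rule det_diagonal) (simp add: diag_mat_def)
  also have "\<dots> = (\<Prod>p\<in>UNIV. if p = p0 then det Psi else 1)" by (simp add: diag_mat_def e_def)
  finally have "det (diag_mat e) = det Psi" by simp
  then have SO: "Psi ** diag_mat e \<in> SOn"
    using d orth orthE by (auto simp: SOn_def orthogonal_matrix_mul det_mul)
  have "Lax nu (Psi ** diag_mat e) = Lax nu Psi" for nu
  proof (rule Lax_levi_cong[OF orth SOn_D(1)[OF SO]])
    fix p q
    have "transpose Psi ** (Psi ** diag_mat e) = diag_mat e"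
      using orth by (simp add: matrix_mul_assoc orthogonal_matrix_def)
    moreover assume "(transpose Psi ** (Psi ** diag_mat e)) $ p $ q \<noteq> 0"
    ultimately show "nu p = nu q" by (simp add: diag_mat_def split: if_splits)
  qed
  then show ?thesis using that SO ee by (metis mult_zero_left zero_neq_one)
qed

lemma compact_SOn: "compact (SOn :: ('n::{finite,linorder}) rmat set)"
proof -
  have "closed (det -` {1} :: 'n rmat set)"
    by (intro closed_vimage continuous_on_det) auto
  then have "compact ({Psi :: 'n rmat. orthogonal_matrix Psi} \<inter> det -` {1})"
    by (rule compact_Int_closed[OF compact_orthogonal])
  moreover have "SOn = {Psi :: 'n rmat. orthogonal_matrix Psi} \<inter> det -` {1}" by (auto simp: SOn_def)
  ultimately show ?thesis by simp
qed

text \<open>The choice of representative is harmless on cosets of \<open>SOn\<close>: the subgroup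
  is block diagonal and commutes with the eigenvalue matrix, as \<open>coset_lax_coset\<close>
  shows.\<close>

definition coset_lax :: "('n \<Rightarrow> real) \<Rightarrow> ('n::{finite,linorder}) rmat set \<Rightarrow> 'n rmat" where
  "coset_lax mu c = Lax mu (SOME Psi. Psi \<in> c)"

locale toda_flag =
  fixes k :: nat and I :: "nat \<Rightarrow> nat" and lam :: "nat \<Rightarrow> real" and mu :: "'n::{finite,linorder} \<Rightarrow> real"
  assumes lam_incr: "\<And>a b. 1 \<le> a \<Longrightarrow> a < b \<Longrightarrow> b \<le> k \<Longrightarrow> lam a < lam b"
    and I_sum: "(\<Sum>j=1..k. I j) = CARD('n)"
    and mu_def: "mu = (\<lambda>p. lam (std_block I p))"
begin

lemma lam_less_iff: "a \<in> {1..k} \<Longrightarrow> b \<in> {1..k} \<Longrightarrow> lam a < lam b \<longleftrightarrow> a < b"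
  using lam_incr[of a b] lam_incr[of b a] by (cases a b rule: linorder_cases) auto

lemma lam_eq_iff: "a \<in> {1..k} \<Longrightarrow> b \<in> {1..k} \<Longrightarrow> lam a = lam b \<longleftrightarrow> a = b"
  using lam_less_iff by (metis less_irrefl linorder_neqE_nat)

lemma mu_eq_iff: "mu p = mu q \<longleftrightarrow> std_block I p = std_block I q"
  unfolding mu_def by (rule lam_eq_iff) (rule std_block_range[OF I_sum])+

lemma mu_mono: assumes "p \<le> q" shows "mu p \<le> mu q"
proof -
  have "std_block I p \<le> std_block I q" by (rule std_block_mono[OF I_sum assms])
  moreover have "std_block I p \<in> {1..k}" "std_block I q \<in> {1..k}" by (rule std_block_range[OF I_sum])+
  ultimately show ?thesis unfolding mu_def using lam_incr[of "std_block I p" "std_block I q"]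
    by (cases "std_block I p = std_block I q") auto
qed

lemma coset_lax_coset:
  assumes "Psi \<in> SOn" shows "coset_lax mu (coset I Psi) = Lax mu Psi"
proof -
  define Phi where "Phi = (SOME Phi. Phi \<in> coset I Psi)"
  have "Phi \<in> coset I Psi" unfolding Phi_def by (rule someI[of _ Psi]) (rule coset_self)
  then obtain g where g: "g \<in> Gsub I" "Phi = Psi ** g" by (auto simp: coset_def)
  have o: "orthogonal_matrix Psi" "orthogonal_matrix Phi"
    using assms g by (auto simp: SOn_def Gsub_def orthogonal_matrix_mul)
  have "transpose Psi ** Phi = g" using o(1) by (simp add: g(2) matrix_mul_assoc orthogonal_matrix_def)
  then have "Lax mu Phi = Lax mu Psi"
    using g(1) by (intro Lax_levi_cong o) (auto simp: mu_eq_iff Gsub_def)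
  then show ?thesis by (simp add: coset_lax_def Phi_def)
qed

lemma coset_eq_of_Lax_eq:
  assumes "Psi \<in> SOn" "Phi \<in> SOn" "Lax mu Psi = Lax mu Phi" shows "coset I Psi = coset I Phi"
proof -
  define g where "g = transpose Psi ** Phi"
  have "g \<in> Gsub I"
    unfolding Gsub_def g_def
    using assms Lax_eqD[OF SOn_D(1)[OF assms(1)] SOn_D(1)[OF assms(2)] assms(3)]
    by (auto simp: SOn_mult SOn_transpose mu_eq_iff)
  moreover have "Phi = Psi ** g"
    using SOn_D(1)[OF assms(1)] by (simp add: g_def matrix_mul_assoc orthogonal_matrix_def)
  ultimately show ?thesis using coset_mult_Gsub by metis
qed

text \<open>A continuous bijection from a compact space, the image of SO(n), to a Hausdorff space.
  From here on limits and subspaces of the flag manifold are handled by matrices.\<close>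

lemma coset_lax_homeomorphic:
  "homeomorphic_map (FlI_top I) (top_of_set (Lax mu ` SOn)) (coset_lax mu)"
proof (rule continuous_imp_homeomorphic_map)
  have img: "coset_lax mu ` FlI I = Lax mu ` SOn"
    unfolding FlI_def image_image by (rule image_cong[OF refl]) (rule coset_lax_coset)
  then show "coset_lax mu ` topspace (FlI_top I) = topspace (top_of_set (Lax mu ` SOn))"
    by (simp add: topspace_FlI_top)
  have "continuous_map (FlI_top I) euclidean (coset_lax mu)"
    unfolding continuous_map_def
  proof (intro conjI allI impI)
    fix U :: "'n rmat set" assume "openin euclidean U"
    then have U: "open U" by simp
    have "{Psi \<in> SOn. coset I Psi \<in> {c \<in> topspace (FlI_top I). coset_lax mu c \<in> U}} = SOn \<inter> Lax mu -` U"
      by (auto simp: topspace_FlI_top FlI_def coset_lax_coset)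
    moreover have "openin (top_of_set SOn) (SOn \<inter> Lax mu -` U)"
      by (rule continuous_openin_preimage_gen[OF continuous_on_Lax U])
    ultimately show "openin (FlI_top I) {c \<in> topspace (FlI_top I). coset_lax mu c \<in> U}"
      by (auto simp: openin_FlI_top topspace_FlI_top)
  qed simp
  then show "continuous_map (FlI_top I) (top_of_set (Lax mu ` SOn)) (coset_lax mu)"
    using img by (auto simp: continuous_map_in_subtopology topspace_FlI_top)
  have "continuous_map (top_of_set SOn) (FlI_top I) (coset I :: 'n rmat \<Rightarrow> _)"
    unfolding continuous_map_def by (auto simp: topspace_FlI_top FlI_def openin_FlI_top)
  moreover have "compactin (top_of_set SOn) (SOn :: 'n rmat set)"
    by (simp add: compactin_subtopology compact_SOn)
  ultimately have "compactin (FlI_top I) (coset I ` (SOn :: 'n rmat set))" by (rule image_compactin[rotated])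
  then show "compact_space (FlI_top I :: 'n rmat set topology)"
    by (simp add: compact_space_def topspace_FlI_top FlI_def)
  show "Hausdorff_space (top_of_set (Lax mu ` SOn))" by (intro Hausdorff_space_subtopology) simp
  show "inj_on (coset_lax mu) (topspace (FlI_top I))"
  proof (rule inj_onI)
    fix c d assume cd: "c \<in> topspace (FlI_top I)" "d \<in> topspace (FlI_top I)" "coset_lax mu c = coset_lax mu d"
    then obtain Psi Phi where P: "Psi \<in> SOn" "c = coset I Psi" "Phi \<in> SOn" "d = coset I Phi"
      unfolding topspace_FlI_top FlI_def by blast
    then have "Lax mu Psi = Lax mu Phi" using cd(3) by (simp add: coset_lax_coset)
    then show "c = d" unfolding P(2,4) by (rule coset_eq_of_Lax_eq[OF P(1,3)])
  qed
qed

section \<open>Connecting trajectories\<close>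

text \<open>The definite description is meaningful because the Lax matrix determines the coset;
  existence comes from a permutation matrix with a corrected sign.\<close>

lemma sing_pt_eq:
  assumes tau: "tau \<in> SnI k I"
  obtains Psi where "Psi \<in> SOn" "Lax mu Psi = diag_mat (\<lambda>p. lam (tau p))" "sing_pt lam I tau = coset I Psi"
proof -
  obtain s :: "'n \<Rightarrow> 'n" where s: "bij s" "\<And>p. std_block I (s p) = tau p"
    using SnI_permutation[OF I_sum tau] by metis
  obtain e where e: "\<forall>p. e p \<noteq> 0" "Pm s ** diag_mat e \<in> SOn" "\<forall>nu. Lax nu (Pm s ** diag_mat e) = Lax nu (Pm s)"
    by (rule SOn_adjust[OF orthogonal_Pm[OF s(1)]])
  define Psi where "Psi = Pm s ** diag_mat e"
  have "Lax mu (Pm s) = diag_mat (\<lambda>p. mu (s p)) ** (Pm s ** transpose (Pm s))"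
    by (simp add: Lax_def Pm_diag_mat matrix_mul_assoc)
  also have "Pm s ** transpose (Pm s) = mat 1" using orthogonal_Pm[OF s(1)] by (simp add: orthogonal_matrix_def)
  finally have L: "Lax mu Psi = diag_mat (\<lambda>p. lam (tau p))" by (simp add: Psi_def e(3) mu_def s(2))
  have eq: "Phi ** Lambda_mat lam I ** matrix_inv Phi = Lax mu Phi" if "Phi \<in> SOn" for Phi
    using SOn_D(1)[OF that] by (simp add: Lax_def Lambda_mat_def mu_def matrix_inv_orthogonal)
  have Psi: "Psi \<in> SOn" using e(2) by (simp add: Psi_def)
  have "sing_pt lam I tau = coset I Psi"
    unfolding sing_pt_def
  proof (rule the_equality)
    show "\<exists>Phi\<in>SOn. Phi ** Lambda_mat lam I ** matrix_inv Phi = diag_mat (\<lambda>p. lam (tau p)) \<and> coset I Psi = coset I Phi"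
      using Psi eq[OF Psi] L by (intro bexI[of _ Psi]) auto
    fix c assume "\<exists>Phi\<in>SOn. Phi ** Lambda_mat lam I ** matrix_inv Phi = diag_mat (\<lambda>p. lam (tau p)) \<and> c = coset I Phi"
    then obtain Phi where Phi: "Phi \<in> SOn" "Phi ** Lambda_mat lam I ** matrix_inv Phi = diag_mat (\<lambda>p. lam (tau p))"
        "c = coset I Phi" by blast
    show "c = coset I Psi" unfolding Phi(3)
      by (rule coset_eq_of_Lax_eq[OF Phi(1) Psi]) (use Phi(2) eq[OF Phi(1)] L in simp)
  qed
  then show ?thesis using that Psi L by blast
qed

lemma limitin_sing_pt_iff:
  assumes Psi: "\<And>t. Psi t \<in> SOn" and gamma: "\<And>t. gamma t = coset I (Psi t)" and tau: "tau \<in> SnI k I"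
  shows "limitin (FlI_top I) gamma (sing_pt lam I tau) F \<longleftrightarrow>
    ((\<lambda>t. Lax mu (Psi t)) \<longlongrightarrow> diag_mat (\<lambda>p. lam (tau p))) F"
proof -
  obtain Phi where Phi: "Phi \<in> SOn" "Lax mu Phi = diag_mat (\<lambda>p. lam (tau p))" "sing_pt lam I tau = coset I Phi"
    using sing_pt_eq[OF tau] by metis
  obtain g where hom: "homeomorphic_maps (FlI_top I) (top_of_set (Lax mu ` SOn)) (coset_lax mu) g"
    using coset_lax_homeomorphic homeomorphic_map_maps by blast
  have cf: "continuous_map (FlI_top I) (top_of_set (Lax mu ` SOn)) (coset_lax mu)"
    and cg: "continuous_map (top_of_set (Lax mu ` SOn)) (FlI_top I) g"
    and gf: "\<And>c. c \<in> FlI I \<Longrightarrow> g (coset_lax mu c) = c"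
    using hom by (auto simp: homeomorphic_maps_def topspace_FlI_top)
  have cl: "coset_lax mu \<circ> gamma = (\<lambda>t. Lax mu (Psi t))" by (auto simp: gamma coset_lax_coset Psi)
  have gl: "g (Lax mu Q) = coset I Q" if "Q \<in> SOn" for Q
    using gf[of "coset I Q"] that by (simp add: coset_lax_coset FlI_def)
  have sub: "limitin (top_of_set (Lax mu ` SOn)) (\<lambda>t. Lax mu (Psi t)) (Lax mu Phi) F \<longleftrightarrow>
      ((\<lambda>t. Lax mu (Psi t)) \<longlongrightarrow> Lax mu Phi) F"
    using Psi Phi(1) by (auto simp: limitin_subtopology)
  show ?thesis
  proof
    assume "limitin (FlI_top I) gamma (sing_pt lam I tau) F"
    from continuous_map_limit[OF cf this] show "((\<lambda>t. Lax mu (Psi t)) \<longlongrightarrow> diag_mat (\<lambda>p. lam (tau p))) F"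
      using sub by (simp add: cl Phi coset_lax_coset)
  next
    assume "((\<lambda>t. Lax mu (Psi t)) \<longlongrightarrow> diag_mat (\<lambda>p. lam (tau p))) F"
    then have "limitin (top_of_set (Lax mu ` SOn)) (\<lambda>t. Lax mu (Psi t)) (Lax mu Phi) F"
      using sub Phi(2) by simp
    from continuous_map_limit[OF cg this] show "limitin (FlI_top I) gamma (sing_pt lam I tau) F"
      using Psi gl[OF Phi(1)] by (simp add: o_def gl Phi(2,3) gamma[abs_def])
  qed
qed

lemma trajectory_in_cells:
  assumes Psi: "\<And>t. Psi t \<in> SOn"
    and der: "\<And>t. (Psi has_vector_derivative Mfield lam I (Psi t)) (at t)"
    and bot: "((\<lambda>t. Lax mu (Psi t)) \<longlongrightarrow> diag_mat (\<lambda>p. lam (a p))) at_bot"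
    and top: "((\<lambda>t. Lax mu (Psi t)) \<longlongrightarrow> diag_mat (\<lambda>p. lam (b p))) at_top"
    and s: "bij s" "\<And>p. std_block I (s p) = a p" and s': "bij s'" "\<And>p. std_block I (s' p) = b p"
  shows "cell mu s (Psi t0)" and "cell (\<lambda>p. - mu p) s' (Psi t0)"
proof -
  \<comment> \<open>The field is autonomous, so the trajectory may be restarted at
    \<open>t0\<close>; the cells can then be read off at the initial point, while both limits are
    unaffected.\<close>
  define Q where "Q t = Psi (t + t0)" for t
  have orth: "orthogonal_matrix (Q t)" for t using SOn_D(1)[OF Psi] by (simp add: Q_def)
  have "(Q has_vector_derivative (upper_part (Lax mu (Q t)) - lower_part (Lax mu (Q t))) ** Q t) (at t)" for t
  proof -
    have "((\<lambda>t. t + t0) has_vector_derivative 1 + 0) (at t)"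
      by (intro has_vector_derivative_add has_vector_derivative_id has_vector_derivative_const)
    then have "((\<lambda>t. t + t0) has_vector_derivative 1) (at t)" by simp
    from vector_diff_chain_at[OF this der] have "(Q has_vector_derivative Mfield lam I (Q t)) (at t)"
      by (simp add: Q_def[abs_def] o_def)
    then show ?thesis using Mfield_eq[OF orth[of t]] by (simp add: mu_def)
  qed
  then have flow: "Q t = GS (Psi t0 ** expD mu t)" for t
    using flow_eq_GS[of Q mu t] orth by (simp add: Q_def)
  have "filterlim (\<lambda>t. t + t0) at_bot at_bot"
    using filterlim_shift_iff[of "\<lambda>t. t" t0 at_bot] by (simp add: filterlim_at_bot eventually_at_bot_linorder) (metis add_le_imp_le_diff le_diff_eq)
  from filterlim_compose[OF bot this]
  have "((\<lambda>t. Lax mu (GS (Psi t0 ** expD mu t))) \<longlongrightarrow> diag_mat (\<lambda>p. lam (a p))) at_bot"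
    by (simp add: flow[symmetric] Q_def)
  then obtain r where r: "bij r" "cell mu r (Psi t0)" "(\<lambda>p. lam (a p)) = (\<lambda>p. mu (r p))"
    using cell_of_limit_at_bot[of mu "Psi t0" "\<lambda>p. lam (a p)"] mu_mono SOn_D(1)[OF Psi] by metis
  have "mu (r p) = mu (s p)" for p using fun_cong[OF r(3), of p] s(2) by (simp add: mu_def)
  then show "cell mu s (Psi t0)" using cell_cong[OF r(1) s(1) _ r(2)] by blast
  have "filterlim (\<lambda>t. t + t0) at_top at_top"
    by (simp add: filterlim_at_top eventually_at_top_linorder) (metis diff_le_eq)
  from filterlim_compose[OF top this]
  have "((\<lambda>t. Lax mu (GS (Psi t0 ** expD mu t))) \<longlongrightarrow> diag_mat (\<lambda>p. lam (b p))) at_top"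
    by (simp add: flow[symmetric] Q_def)
  then obtain r' where r': "bij r'" "cell (\<lambda>p. - mu p) r' (Psi t0)" "(\<lambda>p. lam (b p)) = (\<lambda>p. mu (r' p))"
    using cell_of_limit_at_top[of mu "Psi t0" "\<lambda>p. lam (b p)"] mu_mono SOn_D(1)[OF Psi] by metis
  have "- mu (r' p) = - mu (s' p)" for p using fun_cong[OF r'(3), of p] s'(2) by (simp add: mu_def)
  then show "cell (\<lambda>p. - mu p) s' (Psi t0)" using cell_cong[OF r'(1) s'(1) _ r'(2)] by blast
qed

lemma cells_meet_imp_bruhat_le:
  assumes ab: "a \<in> SnI k I" "b \<in> SnI k I"
    and s: "bij s" "\<And>p. std_block I (s p) = a p" and s': "bij s'" "\<And>p. std_block I (s' p) = b p"
    and cells: "cell mu s Psi" "cell (\<lambda>p. - mu p) s' Psi"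
  shows "bruhat_le k a b"
  unfolding bruhat_le_def
proof (intro allI ballI)
  fix p q assume q: "q \<in> {1..k}"
  show "rk a p q \<le> rk b p q"
  \<comment> \<open>The threshold \<open>lam (q - 1)\<close> separates letters below
    \<open>q\<close> from the others only for \<open>q > 1\<close>, as \<open>lam 0\<close> is
    unconstrained. For \<open>q = 1\<close> both ranks count all positions up to
    \<open>p\<close>.\<close>
  proof (cases "q = 1")
    case True
    then show ?thesis using SnI_range[OF ab(1)] SnI_range[OF ab(2)] by (simp add: rk_def)
  next
    case False
    have ge: "lam (q - 1) < lam v \<longleftrightarrow> q \<le> v" if "v \<in> {1..k}" for v
    proof -
      have "q - 1 \<in> {1..k}" using q False by auto
      then show ?thesis using lam_less_iff[OF _ that, of "q - 1"] q by auto
    qed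
    have "lam (q - 1) < mu (s i) \<longleftrightarrow> q \<le> a i" "lam (q - 1) < mu (s' i) \<longleftrightarrow> q \<le> b i" for i
      unfolding mu_def s(2) s'(2) using ge SnI_range[OF ab(1)] SnI_range[OF ab(2)] by blast+
    moreover have "card {i. i \<le> p \<and> lam (q - 1) < mu (s i)} \<le> card {i. i \<le> p \<and> lam (q - 1) < mu (s' i)}"
      by (rule cells_meet_imp_le[OF s(1) s'(1) cells])
    ultimately show ?thesis by (simp add: rk_def)
  qed
qed

lemma connects_of_cells:
  assumes ab: "a \<in> SnI k I" "b \<in> SnI k I"
    and s: "bij s" "\<And>p. std_block I (s p) = a p" and s': "bij s'" "\<And>p. std_block I (s' p) = b p"
    and Psi: "Psi \<in> SOn" "cell mu s Psi" "cell (\<lambda>p. - mu p) s' Psi"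
  obtains gamma where "connects lam I gamma a b" "gamma 0 = coset I Psi"
proof -
  define Q where "Q t = GS (Psi ** expD mu t)" for t
  note fl = flow_exists[OF SOn_D(1)[OF Psi(1)], of mu, folded Q_def]
  have Q: "Q t \<in> SOn" for t using fl(1,3) SOn_D(2)[OF Psi(1)] by (simp add: SOn_def)
  have der: "(Q has_vector_derivative Mfield lam I (Q t)) (at t)" for t
    using fl(4)[of t] Mfield_eq[OF fl(1)[of t]] by (simp add: mu_def Q_def[abs_def])
  define gamma where "gamma t = coset I (Q t)" for t
  have int: "xi_integral_curve lam I gamma"
    unfolding xi_integral_curve_def using Q der gamma_def by blast
  have lim: "limitin (FlI_top I) gamma (sing_pt lam I tau) F \<longleftrightarrow>
      ((\<lambda>t. Lax mu (Q t)) \<longlongrightarrow> diag_mat (\<lambda>p. lam (tau p))) F" if "tau \<in> SnI k I" for tau F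
    by (rule limitin_sing_pt_iff[OF Q gamma_def that])
  have "limitin (FlI_top I) gamma (sing_pt lam I a) at_bot"
    unfolding lim[OF ab(1)] using flow_limit_at_bot[OF s(1) Psi(2)] by (simp add: Q_def mu_def s(2))
  moreover have "limitin (FlI_top I) gamma (sing_pt lam I b) at_top"
    unfolding lim[OF ab(2)] using flow_limit_at_top[OF s'(1) Psi(3)] by (simp add: Q_def mu_def s'(2))
  ultimately have "connects lam I gamma a b" unfolding connects_def using int by blast
  moreover have "gamma 0 = coset I Psi" using fl(2) by (simp add: gamma_def)
  ultimately show ?thesis by (rule that)
qed

text \<open>The flow runs from the smaller word to the larger, whereas \<open>connects\<close>
  allows both orientations. The reversed one is kept only as a comparability statement, which
  \<open>swept_manifold\<close> can refute.\<close>

lemma connectsE: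
  assumes "connects lam I gamma a b" and ab: "a \<in> SnI k I" "b \<in> SnI k I"
    and s: "bij s" "\<And>p. std_block I (s p) = a p" and s': "bij s'" "\<And>p. std_block I (s' p) = b p"
  shows "(bruhat_le k a b \<and> (\<forall>t. \<exists>Psi\<in>SOn. gamma t = coset I Psi \<and> cell mu s Psi \<and> cell (\<lambda>p. - mu p) s' Psi))
    \<or> bruhat_le k b a"
proof -
  obtain Psi where Psi: "\<And>t. Psi t \<in> SOn" "\<And>t. (Psi has_vector_derivative Mfield lam I (Psi t)) (at t)"
      "\<And>t. gamma t = coset I (Psi t)"
    using assms(1) unfolding connects_def xi_integral_curve_def by blast
  note lim = limitin_sing_pt_iff[OF Psi(1) Psi(3)]
  consider "((\<lambda>t. Lax mu (Psi t)) \<longlongrightarrow> diag_mat (\<lambda>p. lam (a p))) at_bot"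
      "((\<lambda>t. Lax mu (Psi t)) \<longlongrightarrow> diag_mat (\<lambda>p. lam (b p))) at_top"
    | "((\<lambda>t. Lax mu (Psi t)) \<longlongrightarrow> diag_mat (\<lambda>p. lam (b p))) at_bot"
      "((\<lambda>t. Lax mu (Psi t)) \<longlongrightarrow> diag_mat (\<lambda>p. lam (a p))) at_top"
    using assms(1) unfolding connects_def lim[OF ab(1)] lim[OF ab(2)] by blast
  then show ?thesis
  proof cases
    case 1
    note c = trajectory_in_cells[OF Psi(1,2) 1 s s']
    have "bruhat_le k a b" by (rule cells_meet_imp_bruhat_le[OF ab s s' c[of 0]])
    then show ?thesis using Psi(1,3) c by blast
  next
    case 2
    note c = trajectory_in_cells[OF Psi(1,2) 2 s' s]
    have "bruhat_le k b a" by (rule cells_meet_imp_bruhat_le[OF ab(2,1) s' s c[of 0]])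
    then show ?thesis by blast
  qed
qed

lemma connects_of_bruhat_le:
  fixes a b :: "'n \<Rightarrow> nat"
  assumes ab: "a \<in> SnI k I" "b \<in> SnI k I" and le: "bruhat_le k a b"
  obtains gamma where "connects lam I gamma a b"
proof -
  obtain s :: "'n \<Rightarrow> 'n" where s: "bij s" "\<And>p. std_block I (s p) = a p"
    using SnI_permutation[OF I_sum ab(1)] by metis
  obtain s' :: "'n \<Rightarrow> 'n" where s': "bij s'" "\<And>p. std_block I (s' p) = b p"
    using SnI_permutation[OF I_sum ab(2)] by metis
  have "Pm s \<in> closure (upcell mu s')"
    unfolding mu_def
    by (rule Pm_in_closure_of_bruhat_le[OF ab le]) (fact lam_incr | fact mu_mono[unfolded mu_def] | fact s s')+
  then obtain Psi where Psi: "orthogonal_matrix Psi" "cell mu s Psi" "cell (\<lambda>p. - mu p) s' Psi"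
    using cells_meet[of mu s s'] mu_mono s(1) s'(1) by blast
  obtain e where e: "\<forall>p. e p \<noteq> 0" "Psi ** diag_mat e \<in> SOn" "\<forall>nu. Lax nu (Psi ** diag_mat e) = Lax nu Psi"
    by (rule SOn_adjust[OF Psi(1)])
  have c: "cell mu s (Psi ** diag_mat e)" "cell (\<lambda>p. - mu p) s' (Psi ** diag_mat e)"
    by (rule cell_mult_diag, fact Psi, rule e(1)[rule_format])+
  show ?thesis
    by (rule connects_of_cells[OF ab s(1) _ s'(1) _ e(2) c]) (rule s(2) s'(2) that, assumption?)+
qed

lemma swept_manifold:
  fixes a b :: "'n \<Rightarrow> nat"
  assumes ab: "a \<in> SnI k I" "b \<in> SnI k I" and le: "bruhat_le k a b" and ne: "a \<noteq> b"
    and d: "invs b = invs a + d"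
  shows "manifold_dim (subtopology (FlI_top I) (swept lam I a b :: 'n rmat set set)) d"
proof -
  obtain s :: "'n \<Rightarrow> 'n" where s: "bij s" "\<And>p. std_block I (s p) = a p"
    using SnI_permutation[OF I_sum ab(1)] by metis
  obtain s' :: "'n \<Rightarrow> 'n" where s': "bij s'" "\<And>p. std_block I (s' p) = b p"
    using SnI_permutation[OF I_sum ab(2)] by metis
  \<comment> \<open>This rules out reversed trajectories, so \<open>swept\<close> consists of
    exactly the points common to the past cell of \<open>a\<close> and the future cell of
    \<open>b\<close>.\<close>
  have not: "\<not> bruhat_le k b a" using bruhat_le_antisym[OF ab le] ne by blast
  have fwd: "\<exists>Psi\<in>SOn. c = coset I Psi \<and> cell mu s Psi \<and> cell (\<lambda>p. - mu p) s' Psi" if c: "c \<in> swept lam I a b" for c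
  proof -
    obtain gamma t where "connects lam I gamma a b" "c = gamma t" using c unfolding swept_def by blast
    then show ?thesis using connectsE[of gamma a b s s'] ab s s' not by blast
  qed
  have bwd: "coset I Psi \<in> swept lam I a b" if c: "Psi \<in> SOn" "cell mu s Psi" "cell (\<lambda>p. - mu p) s' Psi" for Psi
  proof -
    obtain gamma where "connects lam I gamma a b" "gamma 0 = coset I Psi"
      using connects_of_cells[of a b s s' Psi] ab s s' c by blast
    then show ?thesis unfolding swept_def by (metis (mono_tags, lifting) UnionI mem_Collect_eq rangeI)
  qed
  have rich_SOn: "\<exists>Psi\<in>SOn. L = Lax mu Psi \<and> cell mu s Psi \<and> cell (\<lambda>p. - mu p) s' Psi" if L: "L \<in> rich mu s s'" for L
  proof -
    obtain Psi where Psi: "L = Lax mu Psi" "orthogonal_matrix Psi" "cell mu s Psi" "cell (\<lambda>p. - mu p) s' Psi"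
      using L unfolding rich_def by blast
    obtain e where e: "\<forall>p. e p \<noteq> 0" "Psi ** diag_mat e \<in> SOn" "\<forall>nu. Lax nu (Psi ** diag_mat e) = Lax nu Psi"
      by (rule SOn_adjust[OF Psi(2)])
    show ?thesis
      using e(2,3) Psi(1) cell_mult_diag[OF Psi(3) e(1)[rule_format]] cell_mult_diag[OF Psi(4) e(1)[rule_format]] by (intro bexI[OF _ e(2)]) auto
  qed
  have "coset_lax mu ` swept lam I a b = rich mu s s'"
  proof (intro equalityI subsetI)
    fix L assume "L \<in> coset_lax mu ` swept lam I a b"
    then obtain Psi where "Psi \<in> SOn" "L = Lax mu Psi" "cell mu s Psi" "cell (\<lambda>p. - mu p) s' Psi"
      using fwd coset_lax_coset by auto
    then show "L \<in> rich mu s s'" unfolding rich_def using SOn_D(1) by blast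
  next
    fix L assume "L \<in> rich mu s s'"
    then obtain Psi where "Psi \<in> SOn" "L = Lax mu Psi" "cell mu s Psi" "cell (\<lambda>p. - mu p) s' Psi"
      using rich_SOn by blast
    then show "L \<in> coset_lax mu ` swept lam I a b" using bwd coset_lax_coset by (metis imageI)
  qed
  moreover have "swept lam I a b \<subseteq> FlI I" using fwd unfolding FlI_def by blast
  moreover have sub: "rich mu s s' \<subseteq> Lax mu ` SOn" using rich_SOn by blast
  ultimately have "homeomorphic_map (subtopology (FlI_top I) (swept lam I a b))
      (subtopology (top_of_set (Lax mu ` SOn)) (rich mu s s')) (coset_lax mu)"
    by (intro homeomorphic_map_subtopologies[OF coset_lax_homeomorphic])
       (simp add: topspace_FlI_top Int_absorb1 inf.absorb2)
  moreover have "subtopology (top_of_set (Lax mu ` SOn)) (rich mu s s') = top_of_set (rich mu s s')"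
    using sub by (simp add: subtopology_subtopology Int_absorb1)
  ultimately obtain g where g: "homeomorphic_maps (subtopology (FlI_top I) (swept lam I a b))
      (top_of_set (rich mu s s')) (coset_lax mu) g"
    using homeomorphic_map_maps by metis
  have "mu (s p) < mu (s q) \<longleftrightarrow> a p < a q" "mu (s' p) < mu (s' q) \<longleftrightarrow> b p < b q" for p q
    unfolding mu_def s(2) s'(2) using lam_less_iff SnI_range[OF ab(1)] SnI_range[OF ab(2)] by blast+
  then have "manifold_dim (top_of_set (rich mu s s')) d"
    using rich_manifold[of mu s s' a b d] mu_mono s(1) s'(1) d by blast
  then show ?thesis by (rule manifold_dim_homeomorphic[OF g])
qed

end

theorem theorem4p2:
  fixes k :: nat and I :: "nat \<Rightarrow> nat" and lam :: "nat \<Rightarrow> real"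
    and psi omega :: "'n::{finite,linorder} \<Rightarrow> nat"
  assumes lam_incr: "\<And>a b. 1 \<le> a \<Longrightarrow> a < b \<Longrightarrow> b \<le> k \<Longrightarrow> lam a < lam b"
    and I_pos: "\<And>j. j \<in> {1..k} \<Longrightarrow> I j > 0"
    and I_sum: "(\<Sum>j=1..k. I j) = CARD('n)"
    and psi: "psi \<in> SnI k I" and omega: "omega \<in> SnI k I"
    and neq: "psi \<noteq> omega"
  shows "((\<exists>gamma :: real \<Rightarrow> (((real, 'n) vec, 'n) vec) set. connects lam I gamma psi omega)
            \<longleftrightarrow> (bruhat_le k psi omega \<or> bruhat_le k omega psi))
       \<and> (bruhat_le k psi omega \<longrightarrow>
            (\<exists>xs. hasse_path k I xs \<and> hd xs = psi \<and> last xs = omega) \<and>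
            (\<forall>xs. hasse_path k I xs \<and> hd xs = psi \<and> last xs = omega \<longrightarrow>
               manifold_dim (subtopology (FlI_top I) (swept lam I psi omega)) (length xs - 1)))"
proof -
  interpret toda_flag k I lam "\<lambda>p :: 'n. lam (std_block I p)"
    by unfold_locales (use lam_incr I_sum in auto)
  show ?thesis
  proof (intro conjI impI iffI allI)
    assume "\<exists>gamma :: real \<Rightarrow> 'n rmat set. connects lam I gamma psi omega"
    then obtain gamma :: "real \<Rightarrow> 'n rmat set" where gamma: "connects lam I gamma psi omega" by blast
    obtain s :: "'n \<Rightarrow> 'n" where s: "bij s" "\<And>p. std_block I (s p) = psi p"
      using SnI_permutation[OF I_sum psi] by metis
    obtain s' :: "'n \<Rightarrow> 'n" where s': "bij s'" "\<And>p. std_block I (s' p) = omega p"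
      using SnI_permutation[OF I_sum omega] by metis
    show "bruhat_le k psi omega \<or> bruhat_le k omega psi"
      using connectsE[OF gamma psi omega s s'] by blast
  next
    assume "bruhat_le k psi omega \<or> bruhat_le k omega psi"
    then show "\<exists>gamma :: real \<Rightarrow> 'n rmat set. connects lam I gamma psi omega"
    proof
      assume "bruhat_le k psi omega"
      then show ?thesis using connects_of_bruhat_le[OF psi omega] by metis
    next
      assume "bruhat_le k omega psi"
      then obtain gamma :: "real \<Rightarrow> 'n rmat set" where "connects lam I gamma omega psi"
        using connects_of_bruhat_le[OF omega psi] by metis
      then show ?thesis unfolding connects_def by blast
    qed
  next
    assume "bruhat_le k psi omega"
    then show "\<exists>xs. hasse_path k I xs \<and> hd xs = psi \<and> last xs = omega"
      by (rule hasse_path_exists[OF psi omega])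
  next
    fix xs assume le: "bruhat_le k psi omega" and xs: "hasse_path k I xs \<and> hd xs = psi \<and> last xs = omega"
    \<comment> \<open>Every Hasse path between the two words has the same length, because each edge
      adds one inversion.\<close>
    then have "invs omega = invs psi + (length xs - 1)" using hasse_path_invs by metis
    then show "manifold_dim (subtopology (FlI_top I) (swept lam I psi omega)) (length xs - 1)"
      using swept_manifold[OF psi omega le neq] by blast
  qed
qed

end
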